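(* Let $H=H(N)=\sum_{\langle i,j\rangle}\mathbb{I}\otimes H_{i,j}$ be a local Hamiltonian on $(\mathbb{C}^{d})^{\otimes n}$ with $N$ summands, where the $H_{i,j}$ are random $d^{2}\times d^{2}$ Hermitian matrices. Suppose that the $H_{i,j}$ are independent and that each $H_{i,j}$ has a continuous joint distribution of eigenvalues with the following property: for all $\epsilon>0$ there exists a real number $\mu_{i,j}$ such that the probability that all of the eigenvalues of $H_{i,j}$ are within $\epsilon$ of $\mu_{i,j}$ is positive. Then $H$ is almost surely gapless and has a continuous density of states above the ground state.
   Context: Setting. $d$ is the (fixed, finite) dimension of the Hilbert space of one particle and $n$ is the number of particles. The particles sit at the vertices of a lattice in any spatial dimension, or of a graph whose maximum vertex degree is bounded by a constant independent of the system size. The sum in $H(N)=\sum_{\langle i,j\rangle}\mathbb{I}\otimes H_{i,j}$ runs over pairs of nearest neighbors (edges) $\langle i,j\rangle$, $N$ is the total number of summands, $H_{i,j}$ is a $d^2\times d^2$ Hermitian matrix acting on sites $i$ and $j$, and $\mathbb{I}$ is the identity on all sites other than $i$ and $j$. One considers a growing family of such systems with $N\to\infty$. Standing assumptions: the $H_{i,j}$ have bounded operator norms, and the number of neighbors of any given $H_{i,j}$ (other local terms sharing a site with it) is bounded by a constant independent of $N$. "Almost surely" means with probability one with respect to the random local terms. Gapless. Let $\lambda_0(H)$ and $\lambda_1(H)$ be the smallest and second smallest distinct eigenvalues of $H$; the gap of $H$ is $\lambda_1(H)-\lambda_0(H)$ (so it is positive for finite systems, and exact degeneracies do not count as zero gap).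 $H$ is gapless if for any constant $\epsilon>0$ there exists $N>0$ such that $\lambda_1(H(N))-\lambda_0(H(N))\le\epsilon$. Continuous density of states above the ground state. Let $\lambda_0\le\lambda_1\le\lambda_2\le\cdots$ be the eigenvalues of $H(N)$ in increasing order. $H$ has a continuous density of states above the ground state if for every sufficiently small constant $c>0$, every point $s\in[0,c]$ and every $\epsilon>0$ sufficiently small relative to $c$ ($\epsilon\ll c$), there exist positive integers $j>0$ and $N_j>0$ such that $|\lambda_j-(\lambda_0+s)|\le\epsilon$ for all $N>N_j$.
   Formalization: Added: the probability of being near a scalar and the absolute continuity of the eigenvalue law are uniform over all local terms (false otherwise; automatic for finitely many laws). In the density of states, j may depend on N, as a fixed j is impossible. Also d ≥ 2. *)

theory Defs
  imports
    "HOL-Probability.Probability"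
    "Jordan_Normal_Form.Spectral_Radius"
    "Jordan_Normal_Form.Schur_Decomposition"
begin

subsection \<open>Hermitian matrices, their eigenvalues and the operator norm\<close>

definition hermitian_mat :: "nat \<Rightarrow> complex mat \<Rightarrow> bool" where
  "hermitian_mat k A \<longleftrightarrow> A \<in> carrier_mat k k \<and> mat_adjoint A = A"

text \<open>
  The eigenvalues in increasing order, repeated according to multiplicity. Only used for Hermitian
  matrices, where all eigenvalues are real (so that \<open>Re\<close> loses nothing) and algebraic and
  geometric multiplicity agree.
\<close>
definition eigs :: "complex mat \<Rightarrow> real list" where
  "eigs A = sorted_list_of_multiset (image_mset Re (proots (char_poly A)))"

lemma length_eigs: "A \<in> carrier_mat k k \<Longrightarrow> length (eigs A) = k"
  by (metis degree_monic_char_poly eigs_def mset_sorted_list_of_multiset size_image_mset size_mset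
      size_proots_complex)

lemma set_eigs:
  assumes "A \<in> carrier_mat k k"
  shows "set (eigs A) = Re ` spectrum A"
proof -
  have "char_poly A \<noteq> 0"
    using degree_monic_char_poly[OF assms] by auto
  moreover have "Collect (eigenvalue A) = {x. poly (char_poly A) x = 0}"
    using eigenvalue_root_char_poly[OF assms] by auto
  ultimately show ?thesis
    by (simp add: eigs_def spectrum_def)
qed

definition vnorm :: "complex vec \<Rightarrow> real" where
  "vnorm v = sqrt (\<Sum>i<dim_vec v. (cmod (vec_index v i))\<^sup>2)"

definition op_norm :: "complex mat \<Rightarrow> real" where
  "op_norm A = (SUP v \<in> {v \<in> carrier_vec (dim_col A). vnorm v = 1}. vnorm (A *\<^sub>v v))"


subsection \<open>Local Hamiltonians on a graph\<close>

text \<open>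
  The sites are \<open>0, \<dots>, n - 1\<close>; an edge between sites \<open>i < j\<close> is the pair
  \<open>(i, j)\<close>.
\<close>
definition simple_graph :: "nat \<Rightarrow> (nat \<times> nat) set \<Rightarrow> bool" where
  "simple_graph n E \<longleftrightarrow> (\<forall>(i, j) \<in> E. i < j \<and> j < n)"

definition degree_at :: "(nat \<times> nat) set \<Rightarrow> nat \<Rightarrow> nat" where
  "degree_at E v = card {(i, j) \<in> E. i = v \<or> j = v}"

text \<open>
  The standard basis of the \<open>n\<close>-fold tensor power of \<open>\<complex>\<^sup>d\<close> is indexed by \<open>r < d ^ n\<close>, the
  base-\<open>d\<close> digit of \<open>r\<close> at position \<open>i\<close> being the state of site \<open>i\<close>. For a single edge
  \<open>(i, j)\<close> the basis of the two-site space is indexed by \<open>x\<^sub>i * d + x\<^sub>j\<close>.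
\<close>
definition site :: "nat \<Rightarrow> nat \<Rightarrow> nat \<Rightarrow> nat" where
  "site d r i = (r div d ^ i) mod d"

text \<open>The identity on all sites but \<open>i\<close> and \<open>j\<close>, tensored with the two-site matrix \<open>h\<close>.\<close>
definition embed :: "nat \<Rightarrow> nat \<Rightarrow> nat \<times> nat \<Rightarrow> complex mat \<Rightarrow> complex mat" where
  "embed d n = (\<lambda>(i, j) h. mat (d ^ n) (d ^ n) (\<lambda>(r, s).
     if \<forall>k<n. k \<noteq> i \<and> k \<noteq> j \<longrightarrow> site d r k = site d s k
     then h $$ (site d r i * d + site d r j, site d s i * d + site d s j) else 0))"

definition hamiltonian ::
    "nat \<Rightarrow> nat \<Rightarrow> (nat \<times> nat) set \<Rightarrow> (nat \<times> nat \<Rightarrow> complex mat) \<Rightarrow> complex mat" where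
  "hamiltonian d n E h =
     mat (d ^ n) (d ^ n) (\<lambda>(r, s). \<Sum>e\<in>E. embed d n e (h e) $$ (r, s))"


subsection \<open>Gaplessness and density of states\<close>

text \<open>
  A family of Hamiltonians is a function \<open>HN\<close> of the number \<open>N\<close> of summands, of which only the
  values at \<open>N \<in> S\<close> matter: \<open>S\<close> is the infinite set of sizes occurring in the family (for
  instance, not every number is the number of bonds of a cubic box).
\<close>

definition ground_energy :: "complex mat \<Rightarrow> real" where
  "ground_energy A = Min (set (eigs A))"

text \<open>The smallest eigenvalue distinct from the ground energy, whatever the multiplicity of the latter.\<close>
definition first_excited_energy :: "complex mat \<Rightarrow> real" where
  "first_excited_energy A = Min (set (eigs A) - {ground_energy A})"

text \<open>The cardinality condition only says that a second distinct eigenvalue exists.\<close>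
definition gapless :: "nat set \<Rightarrow> (nat \<Rightarrow> complex mat) \<Rightarrow> bool" where
  "gapless S HN \<longleftrightarrow> (\<forall>\<epsilon>>0. \<exists>N\<in>S. N > 0 \<and> card (set (eigs (HN N))) \<ge> 2 \<and>
      first_excited_energy (HN N) - ground_energy (HN N) \<le> \<epsilon>)"

text \<open>
  The index \<open>j\<close> of the eigenvalue approximating \<open>\<lambda>\<^sub>0 + s\<close> is allowed to depend on \<open>N\<close>, since the
  number of eigenvalues in a fixed interval above \<open>\<lambda>\<^sub>0\<close> grows with \<open>N\<close>.
\<close>
definition continuous_dos :: "nat set \<Rightarrow> (nat \<Rightarrow> complex mat) \<Rightarrow> bool" where
  "continuous_dos S HN \<longleftrightarrow>
     (\<exists>c\<^sub>0>0. \<forall>c. 0 < c \<and> c \<le> c\<^sub>0 \<longrightarrow>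
       (\<exists>\<epsilon>\<^sub>0>0. \<forall>s\<in>{0..c}. \<forall>\<epsilon>. 0 < \<epsilon> \<and> \<epsilon> \<le> \<epsilon>\<^sub>0 \<longrightarrow>
         (\<exists>N\<^sub>0>0. \<forall>N\<in>S. N > N\<^sub>0 \<longrightarrow>
           (\<exists>j>0. j < length (eigs (HN N)) \<and>
             \<bar>eigs (HN N) ! j - (eigs (HN N) ! 0 + s)\<bar> \<le> \<epsilon>))))"


subsection \<open>Random local terms\<close>

abbreviation matrix_space :: "nat \<Rightarrow> (nat \<times> nat \<Rightarrow> complex) measure" where
  "matrix_space k \<equiv> Pi\<^sub>M ({..<k} \<times> {..<k}) (\<lambda>_. borel)"

text \<open>The entries of a \<open>k \<times> k\<close> matrix, as a point of a measurable space.\<close>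
definition entries :: "nat \<Rightarrow> complex mat \<Rightarrow> nat \<times> nat \<Rightarrow> complex" where
  "entries k A = (\<lambda>p\<in>{..<k} \<times> {..<k}. A $$ p)"

abbreviation eig_space :: "nat \<Rightarrow> (nat \<Rightarrow> real) measure" where
  "eig_space k \<equiv> Pi\<^sub>M {..<k} (\<lambda>_. lborel)"

definition eig_vec :: "nat \<Rightarrow> complex mat \<Rightarrow> nat \<Rightarrow> real" where
  "eig_vec k A = (\<lambda>l\<in>{..<k}. eigs A ! l)"

definition continuous_eig_distribution :: "'w measure \<Rightarrow> nat \<Rightarrow> ('w \<Rightarrow> complex mat) \<Rightarrow> bool" where
  "continuous_eig_distribution M k A \<longleftrightarrow>
     (\<exists>f. distributed M (eig_space k) (\<lambda>\<omega>. eig_vec k (A \<omega>)) f)"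

definition near_scalar :: "'w measure \<Rightarrow> ('w \<Rightarrow> complex mat) \<Rightarrow> real \<Rightarrow> real \<Rightarrow> 'w set" where
  "near_scalar M A \<mu> \<epsilon> = {\<omega> \<in> space M. \<forall>x \<in> set (eigs (A \<omega>)). \<bar>x - \<mu>\<bar> \<le> \<epsilon>}"

text \<open>
  The local terms of a growing family need not be identically distributed. The following says
  that their laws do not degenerate along the family: the positive probability of being within
  \<open>\<epsilon>\<close> of a scalar and the absolute continuity of the joint law of the eigenvalues are uniform in
  the local term. Without it, independent terms which all have the two properties individually
  can have, for example, the law of a perturbation of size \<open>2\<^sup>-\<^sup>k\<close> of a fixed gapped interaction
  with probability \<open>1 - 2\<^sup>-\<^sup>k\<close> for the \<open>k\<close>-th term, and the system is then gapped with positive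
  probability.
\<close>
definition uniform_laws :: "'w measure \<Rightarrow> nat \<Rightarrow> 'i set \<Rightarrow> ('i \<Rightarrow> 'w \<Rightarrow> complex mat) \<Rightarrow> bool" where
  "uniform_laws M k I A \<longleftrightarrow>
     (\<forall>\<epsilon>>0. \<exists>p>0. \<forall>i\<in>I. \<exists>\<mu>. measure M (near_scalar M (A i) \<mu> \<epsilon>) \<ge> p) \<and>
     (\<forall>\<eta>>0. \<exists>\<delta>>0. \<forall>i\<in>I. \<forall>B \<in> sets (eig_space k). emeasure (eig_space k) B \<le> ennreal \<delta> \<longrightarrow>
        measure M {\<omega> \<in> space M. eig_vec k (A i \<omega>) \<in> B} \<le> \<eta>)"

lemma small_measure_of_absolutely_continuous:
  fixes L N :: "'a measure" and \<eta> :: real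
  assumes ac: "absolutely_continuous N L" and sets: "sets L = sets N"
    and fin: "finite_measure L" and \<eta>: "\<eta> > 0"
  shows "\<exists>\<delta>>0. \<forall>B\<in>sets N. emeasure N B \<le> ennreal \<delta> \<longrightarrow> measure L B \<le> \<eta>"
proof (rule ccontr)
  interpret finite_measure L by fact
  assume "\<not> ?thesis"
  then have "\<exists>B. B \<in> sets N \<and> emeasure N B \<le> ennreal ((1/2)^m) \<and> measure L B > \<eta>" for m :: nat
    by (auto simp: not_le dest: spec[of _ "(1/2)^m"])
  then obtain B where B: "\<And>m. B m \<in> sets N" "\<And>m. emeasure N (B m) \<le> ennreal ((1/2)^m)"
      "\<And>m::nat. measure L (B m) > \<eta>"
    by metis
  define U where "U m = (\<Union>l. B (l + m))" for m
  have U[measurable]: "U m \<in> sets N" for m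
    using B(1) by (auto simp: U_def)
  have "decseq U"
  proof (rule decseq_SucI)
    fix m show "U (Suc m) \<subseteq> U m"
    proof
      fix x assume "x \<in> U (Suc m)"
      then obtain l where "x \<in> B (l + Suc m)" by (auto simp: U_def)
      then have "x \<in> B (Suc l + m)" by simp
      then show "x \<in> U m" unfolding U_def by blast
    qed
  qed
  have N: "emeasure N (U m) \<le> ennreal (2 * (1/2)^m)" for m
  proof -
    have "emeasure N (U m) \<le> (\<Sum>l. emeasure N (B (l + m)))"
      unfolding U_def by (rule emeasure_subadditive_countably) (use B(1) in auto)
    also have "\<dots> \<le> (\<Sum>l. ennreal ((1/2)^(l + m)))"
      by (intro suminf_le B) auto
    also have "\<dots> = ennreal (2 * (1/2)^m)"
    proof (rule suminf_ennreal_eq)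
      show "(\<lambda>l. (1/2)^(l + m)) sums (2 * (1/2::real)^m)"
        using sums_mult2[OF geometric_sums[of "1/2::real"], of "(1/2)^m"] by (simp add: power_add)
    qed auto
    finally show ?thesis .
  qed
  have "emeasure N (\<Inter>m. U m) \<le> ennreal (2 * (1/2)^m)" for m
    by (rule order_trans[OF emeasure_mono N[of m]]) auto
  moreover have "(\<lambda>m. ennreal (2 * (1/2)^m)) \<longlonglongrightarrow> ennreal (2 * 0)"
    by (intro tendsto_ennrealI tendsto_intros LIMSEQ_power_zero) auto
  ultimately have "emeasure N (\<Inter>m. U m) \<le> ennreal (2 * 0)"
    by (intro LIMSEQ_le_const) auto
  then have "(\<Inter>m. U m) \<in> null_sets N"
    by (intro null_setsI) auto
  then have "(\<Inter>m. U m) \<in> null_sets L"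
    using ac by (auto simp: absolutely_continuous_def)
  then have "measure L (\<Inter>m. U m) = 0"
    by (simp add: measure_def null_setsD1)
  moreover have "(\<lambda>m. measure L (U m)) \<longlonglongrightarrow> measure L (\<Inter>m. U m)"
  proof (rule finite_Lim_measure_decseq)
    show "range U \<subseteq> sets L" using U unfolding sets by blast
  qed fact
  moreover have "\<eta> \<le> measure L (U m)" for m
  proof -
    have "measure L (B m) \<le> measure L (U m)"
    proof (rule finite_measure_mono)
      have "B (0 + m) \<subseteq> U m" unfolding U_def by blast
      then show "B m \<subseteq> U m" by simp
      show "U m \<in> sets L" using U unfolding sets by blast
    qed
    then show ?thesis using B(3)[of m] by simp
  qed
  ultimately have "\<eta> \<le> 0"
    by (intro LIMSEQ_le_const) auto
  then show False using \<eta> by simp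
qed

text \<open>
  If only finitely many laws occur, in particular for identically distributed terms (disorder
  that is translation invariant in law), uniformity is automatic.
\<close>
lemma uniform_laws_finite:
  assumes M: "prob_space M"
    and carrier: "\<And>i \<omega>. i \<in> I \<Longrightarrow> \<omega> \<in> space M \<Longrightarrow> A i \<omega> \<in> carrier_mat k k"
    and cont: "\<And>i. i \<in> I \<Longrightarrow> continuous_eig_distribution M k (A i)"
    and near: "\<And>i \<epsilon>. i \<in> I \<Longrightarrow> \<epsilon> > 0 \<Longrightarrow> \<exists>\<mu>. measure M (near_scalar M (A i) \<mu> \<epsilon>) > 0"
    and fin: "finite ((\<lambda>i. distr M (eig_space k) (\<lambda>\<omega>. eig_vec k (A i \<omega>))) ` I)"
  shows "uniform_laws M k I A"
proof -
  interpret prob_space M by fact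
  define law where "law i = distr M (eig_space k) (\<lambda>\<omega>. eig_vec k (A i \<omega>))" for i
  define C where "C \<mu> \<epsilon> = {x \<in> space (eig_space k). \<forall>l\<in>{..<k}. \<bar>x l - \<mu>\<bar> \<le> \<epsilon>}" for \<mu> \<epsilon> :: real
  have meas: "(\<lambda>\<omega>. eig_vec k (A i \<omega>)) \<in> measurable M (eig_space k)" if "i \<in> I" for i
    using cont[OF that] by (auto simp: continuous_eig_distribution_def distributed_def)
  have C[measurable]: "C \<mu> \<epsilon> \<in> sets (eig_space k)" for \<mu> \<epsilon>
    unfolding C_def by measurable
  have pull: "measure (law i) B = measure M {\<omega> \<in> space M. eig_vec k (A i \<omega>) \<in> B}"
    if "i \<in> I" "B \<in> sets (eig_space k)" for i B
    unfolding law_def by (subst measure_distr[OF meas]) (use that in \<open>auto intro: arg_cong[where f="measure M"]\<close>)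
  have near_law: "measure M (near_scalar M (A i) \<mu> \<epsilon>) = measure (law i) (C \<mu> \<epsilon>)" if "i \<in> I" for i \<mu> \<epsilon>
  proof -
    have "length (eigs (A i \<omega>)) = k" if "\<omega> \<in> space M" for \<omega>
      using carrier[OF \<open>i \<in> I\<close> that] by (rule length_eigs)
    then have "near_scalar M (A i) \<mu> \<epsilon> = {\<omega> \<in> space M. eig_vec k (A i \<omega>) \<in> C \<mu> \<epsilon>}"
      by (auto simp: near_scalar_def C_def eig_vec_def space_PiM all_set_conv_all_nth)
    then show ?thesis using pull[OF that C] by simp
  qed
  have fin': "finite (law ` I)" using fin by (simp add: law_def)
  have "\<exists>p>0. \<forall>i\<in>I. \<exists>\<mu>. measure M (near_scalar M (A i) \<mu> \<epsilon>) \<ge> p" if "\<epsilon> > 0" for \<epsilon>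
  proof -
    have "\<forall>Q\<in>law ` I. \<exists>\<mu>. measure Q (C \<mu> \<epsilon>) > 0"
      using near[OF _ that] by (simp add: near_law)
    then obtain m where m: "\<And>Q. Q \<in> law ` I \<Longrightarrow> measure Q (C (m Q) \<epsilon>) > 0" by metis
    define p where "p = Min (insert 1 ((\<lambda>Q. measure Q (C (m Q) \<epsilon>)) ` law ` I))"
    have "p > 0" using m fin' by (auto simp: p_def)
    moreover have "p \<le> measure M (near_scalar M (A i) (m (law i)) \<epsilon>)" if "i \<in> I" for i
      unfolding near_law[OF that] p_def using fin' that by (intro Min_le) auto
    ultimately show ?thesis by blast
  qed
  moreover have "\<exists>\<delta>>0. \<forall>i\<in>I. \<forall>B \<in> sets (eig_space k). emeasure (eig_space k) B \<le> ennreal \<delta> \<longrightarrow>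
      measure M {\<omega> \<in> space M. eig_vec k (A i \<omega>) \<in> B} \<le> \<eta>" if "\<eta> > 0" for \<eta>
  proof -
    have "\<forall>Q\<in>law ` I. \<exists>\<delta>>0. \<forall>B\<in>sets (eig_space k).
        emeasure (eig_space k) B \<le> ennreal \<delta> \<longrightarrow> measure Q B \<le> \<eta>"
    proof
      fix Q assume "Q \<in> law ` I"
      then obtain i where i: "i \<in> I" "Q = law i" by auto
      obtain f where f: "law i = density (eig_space k) f" "f \<in> borel_measurable (eig_space k)"
        using cont[OF i(1)] by (auto simp: continuous_eig_distribution_def distributed_def law_def)
      have "absolutely_continuous (eig_space k) (law i)"
        unfolding f(1) using f(2) by (rule absolutely_continuousI_density)
      moreover have "sets (law i) = sets (eig_space k)" by (simp add: law_def)
      moreover have "finite_measure (law i)"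
        using prob_space_distr[OF meas[OF i(1)]] by (simp add: law_def prob_space.finite_measure)
      ultimately show "\<exists>\<delta>>0. \<forall>B\<in>sets (eig_space k).
          emeasure (eig_space k) B \<le> ennreal \<delta> \<longrightarrow> measure Q B \<le> \<eta>"
        using small_measure_of_absolutely_continuous that i(2) by blast
    qed
    then obtain D where D: "\<And>Q. Q \<in> law ` I \<Longrightarrow> D Q > 0"
        "\<And>Q B. Q \<in> law ` I \<Longrightarrow> B \<in> sets (eig_space k) \<Longrightarrow>
          emeasure (eig_space k) B \<le> ennreal (D Q) \<Longrightarrow> measure Q B \<le> \<eta>"
      by metis
    define \<delta> where "\<delta> = Min (insert (1::real) (D ` law ` I))"
    have "\<delta> > 0" using D(1) fin' by (auto simp: \<delta>_def)
    moreover have "measure M {\<omega> \<in> space M. eig_vec k (A i \<omega>) \<in> B} \<le> \<eta>"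
      if "i \<in> I" "B \<in> sets (eig_space k)" "emeasure (eig_space k) B \<le> ennreal \<delta>" for i B
    proof -
      have "\<delta> \<le> D (law i)"
        unfolding \<delta>_def using fin' that(1) by (intro Min_le) auto
      then have "emeasure (eig_space k) B \<le> ennreal (D (law i))"
        using that(3) by (meson ennreal_leI order_trans)
      then show ?thesis using D(2)[of "law i" B] that(1,2) by (simp add: pull)
    qed
    ultimately show ?thesis by blast
  qed
  ultimately show ?thesis by (simp add: uniform_laws_def)
qed

end

theory Submission
  imports Defs
begin

text \<open>
  If all bonds touching a bond \<open>l\<close> carried multiples of the identity, the Hamiltonian would split as
  \<open>B \<otimes> \<one> + \<one> \<otimes> H\<^sub>l\<close>, so the spread (largest minus smallest eigenvalue) of \<open>H\<^sub>l\<close> could be added to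
  the ground energy. For \<open>m\<close> such bonds with spreads in \<open>[\<delta>, \<epsilon>]\<close> and \<open>m \<delta> \<ge> 1\<close>, the sums of spreads form an
  \<open>\<epsilon>\<close>-net of \<open>[0, 1]\<close>. If the surrounding bonds are only within \<open>\<eta>\<close> of scalars, with \<open>\<eta>\<close> small
  compared to \<open>\<epsilon> / m\<close>, all this holds up to an error of order \<open>\<epsilon>\<close>.

  A given bond starts such a region with probability bounded below: near-scalar terms have
  uniformly positive probability, and by uniform absolute continuity the spread is unlikely to be
  below \<open>\<delta>\<close> when \<open>\<delta>\<close> is small. Since degrees are bounded there are of order \<open>N\<close> pairwise disjoint,
  hence independent, candidate regions. Fewer than \<open>m\<close> of them succeed with probability exponentially small in
  \<open>N\<close>, and Borel-Cantelli applies, whatever the dependence between different \<open>N\<close>.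
\<close>

subsection \<open>The spectral theorem for Hermitian matrices\<close>

text \<open>The constants must be chosen in an order that is not circular: \<open>\<epsilon>\<close>
  fixes a success probability and a lower bound \<open>\<delta>\<close> for the spread of the
  central bond, \<open>\<delta>\<close> fixes \<open>m\<close>, \<open>m\<close> fixes the tolerance
  \<open>\<eta>\<close> of the surrounding bonds, and only then is the probability of that tolerance
  bounded from below. Uniformity of the laws makes all of them independent of N.

  The eigenstate being excited need not be known explicitly: on a decoupled bond the ground state
  can only occupy the lowest level, since lowering it further would beat the ground energy. This is
  why the spread is the excitation to use. An explicit tensor factorisation is avoided; only
  commutation with operators on a bond enters.

  Two descriptions of a random term have to be reconciled: independence concerns its entries,
  absolute continuity its ordered eigenvalues. Events are therefore sets of entries, and absolute
  continuity enters only through an inclusion of events and an upper bound for a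
  probability.\<close>

text \<open>
  The Schur decomposition of the library does not provide a unitary matrix, so an orthonormal
  eigenbasis is built vector by vector: a vector orthogonal to the previous ones is
  annihilated by a polynomial in the matrix, one of whose linear factors yields the next eigenvector.
\<close>

lemma nontrivial_kernel:
  fixes a :: "nat \<Rightarrow> nat \<Rightarrow> complex"
  assumes "m < n"
  shows "\<exists>v. (\<exists>x<n. v x \<noteq> 0) \<and> (\<forall>i<m. (\<Sum>x<n. a i x * v x) = 0)"
proof -
  \<comment> \<open>Zero rows pad the system to a square matrix; every Leibniz term of the
    determinant contains an entry of the last row, which is zero.\<close>
  define A where "A = mat n n (\<lambda>(i, x). if i < m then a i x else 0)"
  have A: "A \<in> carrier_mat n n" by (simp add: A_def)
  have "(\<Prod>i = 0..<n. A $$ (i, p i)) = 0" if "p permutes {0..<n}" for p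
  proof -
    have "p (n - 1) < n" using permutes_in_image[OF that, of "n - 1"] assms by simp
    then have "A $$ (n - 1, p (n - 1)) = 0" using assms by (simp add: A_def)
    then show ?thesis using assms by (intro prod_zero) (auto intro!: bexI[of _ "n - 1"])
  qed
  then have "det A = 0"
    unfolding det_def'[OF A] by (intro sum.neutral) (auto simp del: prod_zero_iff)
  then obtain v where v: "v \<in> carrier_vec n" "v \<noteq> 0\<^sub>v n" "A *\<^sub>v v = 0\<^sub>v n"
    using det_0_iff_vec_prod_zero_field[OF A] by auto
  have "\<exists>x<n. vec_index v x \<noteq> 0"
  proof (rule ccontr)
    assume "\<not> ?thesis"
    then have "v = 0\<^sub>v n" using v(1) by (intro eq_vecI) auto
    then show False using v(2) by simp
  qed
  moreover have "(\<Sum>x<n. a i x * vec_index v x) = 0" if "i < m" for i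
  proof -
    have "vec_index (A *\<^sub>v v) i = 0" using v(3) that assms by simp
    then show ?thesis using that assms v(1)
      by (simp add: A_def scalar_prod_def lessThan_atLeast0)
  qed
  ultimately show ?thesis by (intro exI[of _ "vec_index v"]) auto
qed

text \<open>A root z of p splits off a linear factor p = (X - z) q. Either w = F v - z v vanishes
  and v is an eigenvector, or w is nonzero and annihilated by q, which has smaller degree.
  \<open>V\<close> plays the role of an invariant subspace, later an orthogonal complement.\<close>

lemma invariant_eigenvector:
  fixes F :: "(nat \<Rightarrow> complex) \<Rightarrow> nat \<Rightarrow> complex"
  assumes lin: "\<And>a b f g. F (\<lambda>x. a * f x + b * g x) = (\<lambda>x. a * F f x + b * F g x)"
    and V: "\<And>a b f g. f \<in> V \<Longrightarrow> g \<in> V \<Longrightarrow> (\<lambda>x. a * f x + b * g x) \<in> V"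
    and inv: "\<And>f. f \<in> V \<Longrightarrow> F f \<in> V"
  shows "p \<noteq> 0 \<Longrightarrow> v \<in> V \<Longrightarrow> v \<noteq> (\<lambda>_. 0) \<Longrightarrow>
    (\<And>x. (\<Sum>i\<le>degree p. coeff p i * (F ^^ i) v x) = 0) \<Longrightarrow>
    \<exists>w\<in>V. w \<noteq> (\<lambda>_. 0) \<and> (\<exists>z. F w = (\<lambda>x. z * w x))"
proof (induction "degree p" arbitrary: p v)
  case 0
  then have "coeff p 0 * v x = 0" for x using 0(5)[of x] by simp
  moreover have "coeff p 0 \<noteq> 0" using 0 leading_coeff_0_iff[of p] by simp
  ultimately have "v = (\<lambda>_. 0)" by auto
  with 0 show ?case by simp
next
  case (Suc n)
  have "\<exists>z. poly p z = 0"
    using Suc.hyps(2) by (intro fundamental_theorem_of_algebra_alt) (metis degree_pCons_0 nat.distinct(1))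
  then obtain z where "poly p z = 0" by blast
  then obtain q where q: "p = [:-z, 1:] * q" by (metis dvdE poly_eq_0_iff_dvd)
  have q0: "q \<noteq> 0" using Suc.prems(1) q by auto
  have dq: "n = degree q"
    using Suc.hyps(2) q0 unfolding q by (subst (asm) degree_mult_eq) auto
  define w where "w = (\<lambda>x. 1 * F v x + (- z) * v x)"
  have wV: "w \<in> V" unfolding w_def by (intro V inv Suc.prems)
  have Fw: "(F ^^ i) w = (\<lambda>x. 1 * (F ^^ Suc i) v x + (- z) * (F ^^ i) v x)" for i
    by (induction i) (simp_all only: w_def funpow.simps o_def id_apply lin)
  have "(\<Sum>i\<le>degree q. coeff q i * (F ^^ i) w x) = 0" for x
  proof -
    \<comment> \<open>Coefficients of (X - z) q; the constant one has no shifted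
      contribution.\<close>
    have c: "coeff p i = (if i = 0 then 0 else coeff q (i - 1)) - z * coeff q i" for i
      unfolding q by (cases i) (simp_all add: coeff_pCons)
    have "0 = (\<Sum>i\<le>Suc n. coeff p i * (F ^^ i) v x)"
      using Suc.prems(4)[of x] Suc.hyps(2) by simp
    also have "\<dots> = (\<Sum>i\<le>Suc n. (if i = 0 then 0 else coeff q (i - 1)) * (F ^^ i) v x)
        - z * (\<Sum>i\<le>Suc n. coeff q i * (F ^^ i) v x)"
      unfolding c left_diff_distrib sum_subtractf sum_distrib_left by (simp only: mult_ac)
    also have "(\<Sum>i\<le>Suc n. (if i = 0 then 0 else coeff q (i - 1)) * (F ^^ i) v x) =
        (\<Sum>i\<le>n. coeff q i * (F ^^ Suc i) v x)"
      by (subst sum.atMost_Suc_shift) simp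
    also have "(\<Sum>i\<le>Suc n. coeff q i * (F ^^ i) v x) = (\<Sum>i\<le>n. coeff q i * (F ^^ i) v x)"
      using dq by (simp add: coeff_eq_0)
    finally show ?thesis
      unfolding dq[symmetric] Fw by (simp add: ring_distribs sum.distrib sum_subtractf sum_distrib_left sum_negf mult_ac)
  qed
  note zero = this
  show ?case
  proof (cases "w = (\<lambda>_. 0)")
    case True
    then have "F v = (\<lambda>x. z * v x)" by (auto simp: w_def fun_eq_iff)
    with Suc.prems show ?thesis by blast
  next
    case False
    show ?thesis by (rule Suc.hyps(1)[OF dq q0 wV False zero])
  qed
qed

text \<open>Vectors are functions on all of nat. Cutting the result off at k turns eigenvector
  equations into plain equalities of functions for vectors supported below k.\<close>

definition mat_apply :: "nat \<Rightarrow> complex mat \<Rightarrow> (nat \<Rightarrow> complex) \<Rightarrow> nat \<Rightarrow> complex" where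
  "mat_apply k A w = (\<lambda>x. if x < k then \<Sum>y<k. A $$ (x, y) * w y else 0)"

definition inner_prod :: "nat \<Rightarrow> (nat \<Rightarrow> complex) \<Rightarrow> (nat \<Rightarrow> complex) \<Rightarrow> complex" where
  "inner_prod k v w = (\<Sum>x<k. cnj (v x) * w x)"

lemma hermitian_entries:
  assumes "hermitian_mat k A" "x < k" "y < k"
  shows "cnj (A $$ (x, y)) = A $$ (y, x)"
proof -
  have A: "A \<in> carrier_mat k k" "mat_adjoint A = A" using assms by (auto simp: hermitian_mat_def)
  have "mat_adjoint A $$ (y, x) = cnj (A $$ (x, y))"
    using A(1) assms(2,3) by (simp add: mat_adjoint_def mat_of_rows_def)
  then show ?thesis using A(2) by simp
qed

lemma hermitian_matI:
  assumes "A \<in> carrier_mat k k" "\<And>x y. x < k \<Longrightarrow> y < k \<Longrightarrow> cnj (A $$ (x, y)) = A $$ (y, x)"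
  shows "hermitian_mat k A"
  unfolding hermitian_mat_def
proof (intro conjI assms(1))
  show "mat_adjoint A = A"
    using assms by (intro eq_matI) (auto simp: mat_adjoint_def mat_of_rows_def)
qed

lemma inner_prod_hermitian:
  assumes "hermitian_mat k A"
  shows "inner_prod k v (mat_apply k A w) = inner_prod k (mat_apply k A v) w"
proof -
  have "inner_prod k v (mat_apply k A w) = (\<Sum>x<k. \<Sum>y<k. cnj (v x) * (A $$ (x, y) * w y))"
    by (simp add: inner_prod_def mat_apply_def sum_distrib_left)
  also have "\<dots> = (\<Sum>y<k. \<Sum>x<k. cnj (v x) * (A $$ (x, y) * w y))"
    by (rule sum.swap)
  also have "\<dots> = (\<Sum>y<k. \<Sum>x<k. cnj (A $$ (y, x) * v x) * w y)"
    by (intro sum.cong refl) (simp add: hermitian_entries[OF assms])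
  also have "\<dots> = inner_prod k (mat_apply k A v) w"
    by (simp add: inner_prod_def mat_apply_def sum_distrib_right)
  finally show ?thesis .
qed

lemma inner_prod_self: "inner_prod k v v = of_real (\<Sum>x<k. (cmod (v x))\<^sup>2)"
  by (simp add: inner_prod_def complex_norm_square mult.commute del: of_real_power)

lemma inner_prod_smult [simp]:
  "inner_prod k v (\<lambda>x. c * w x) = c * inner_prod k v w"
  "inner_prod k (\<lambda>x. c * v x) w = cnj c * inner_prod k v w"
  by (simp_all add: inner_prod_def sum_distrib_left mult_ac)

lemma inner_prod_linear:
  "inner_prod k v (\<lambda>x. a * f x + b * g x) = a * inner_prod k v f + b * inner_prod k v g"
  by (simp add: inner_prod_def ring_distribs sum.distrib sum_distrib_left mult_ac)

lemma inner_prod_cnj: "cnj (inner_prod k v w) = inner_prod k w v"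
  by (simp add: inner_prod_def mult.commute)

text \<open>The orthogonal complement of the vectors found so far is invariant because A is
  self-adjoint, and nonzero because m < k.\<close>

lemma hermitian_extend_eigenvectors:
  assumes A: "hermitian_mat k A" and m: "m < k"
    and ev: "\<And>a. a < m \<Longrightarrow> mat_apply k A (u a) = (\<lambda>x. D a * u a x)"
  shows "\<exists>w z. mat_apply k A w = (\<lambda>x. of_real z * w x) \<and> inner_prod k w w = 1 \<and>
    (\<forall>a<m. inner_prod k (u a) w = 0)"
proof -
  define V where "V = {w. (\<forall>x\<ge>k. w x = 0) \<and> (\<forall>a<m. inner_prod k (u a) w = 0)}"
  define F where "F = mat_apply k A"
  have lin: "F (\<lambda>x. a * f x + b * g x) = (\<lambda>x. a * F f x + b * F g x)" for a b f g
    by (auto simp: F_def mat_apply_def fun_eq_iff ring_distribs sum.distrib sum_distrib_left mult_ac)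
  have V: "(\<lambda>x. a * f x + b * g x) \<in> V" if "f \<in> V" "g \<in> V" for a b f g
    using that unfolding V_def by (simp add: inner_prod_linear)
  have inv: "F f \<in> V" if "f \<in> V" for f
  proof -
    have "inner_prod k (u a) (F f) = 0" if a: "a < m" for a
      unfolding F_def inner_prod_hermitian[OF A] ev[OF a] using \<open>f \<in> V\<close> a by (simp add: V_def)
    then show ?thesis by (simp add: V_def F_def mat_apply_def)
  qed
  obtain v0 where v0: "\<exists>x<k. v0 x \<noteq> 0" "\<And>i. i < m \<Longrightarrow> (\<Sum>x<k. cnj (u i x) * v0 x) = 0"
    using nontrivial_kernel[OF m, of "\<lambda>i x. cnj (u i x)"] by blast
  define v where "v = (\<lambda>x. if x < k then v0 x else 0)"
  have v: "v \<in> V" "v \<noteq> (\<lambda>_. 0)"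
    using v0 by (auto simp: V_def v_def inner_prod_def fun_eq_iff)
  \<comment> \<open>The k + 1 iterates have only k coordinates; their linear dependence supplies the
    annihilating polynomial.\<close>
  obtain c where c: "\<exists>i<Suc k. c i \<noteq> 0" "\<And>x. x < k \<Longrightarrow> (\<Sum>i<Suc k. (F ^^ i) v x * c i) = 0"
    using nontrivial_kernel[of k "Suc k" "\<lambda>x i. (F ^^ i) v x"] by blast
  define p where "p = Poly (map c [0..<Suc k])"
  have cp: "coeff p i = (if i < Suc k then c i else 0)" for i
    by (auto simp: p_def coeff_Poly_eq nth_default_def simp del: upt_Suc)
  have p0: "p \<noteq> 0" using c(1) cp by (metis coeff_0)
  have deg: "degree p \<le> k" by (rule degree_le) (simp add: cp)
  have Fk: "(F ^^ i) v x = 0" if "\<not> x < k" for i x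
  proof -
    have "(F ^^ i) v \<in> V" by (induction i) (auto intro: inv v)
    then show ?thesis using that by (simp add: V_def)
  qed
  have "(\<Sum>i\<le>degree p. coeff p i * (F ^^ i) v x) = 0" for x
  proof -
    have "(\<Sum>i\<le>degree p. coeff p i * (F ^^ i) v x) = (\<Sum>i<Suc k. coeff p i * (F ^^ i) v x)"
      using deg by (intro sum.mono_neutral_left) (auto simp: coeff_eq_0)
    also have "\<dots> = (\<Sum>i<Suc k. (F ^^ i) v x * c i)"
      by (intro sum.cong) (auto simp: cp)
    also have "\<dots> = 0" using c(2)[of x] Fk[of x] by (cases "x < k") simp_all
    finally show ?thesis .
  qed
  from invariant_eigenvector[OF lin V inv p0 v this]
  obtain w z where w: "w \<in> V" "w \<noteq> (\<lambda>_. 0)" "F w = (\<lambda>x. z * w x)" by blast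
  obtain x0 where x0: "x0 < k" "w x0 \<noteq> 0"
    using w(1,2) by (auto simp: V_def fun_eq_iff) (metis not_le)
  define s where "s = (\<Sum>x<k. (cmod (w x))\<^sup>2)"
  have s: "s > 0" unfolding s_def using x0 by (intro sum_pos2[of _ x0]) auto
  have ww: "inner_prod k w w = of_real s" by (simp add: inner_prod_self s_def)
  \<comment> \<open>Moving A across the inner product shows that z is real.\<close>
  have "cnj z * inner_prod k w w = z * inner_prod k w w"
    using inner_prod_hermitian[OF A, of w w] w(3) unfolding F_def by (simp only: inner_prod_smult)
  then have "cnj z = z" using s ww by simp
  then have z: "z = of_real (Re z)" by (simp add: complex_eq_iff)
  define w' where "w' = (\<lambda>x. of_real (1 / sqrt s) * w x)"
  have "mat_apply k A w' = (\<lambda>x. of_real (Re z) * w' x)"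
    using lin[of "of_real (1 / sqrt s)" w 0 w] w(3) z
    unfolding w'_def F_def by (simp add: mult_ac)
  moreover have "inner_prod k w' w' = 1"
    unfolding w'_def inner_prod_smult ww using s
    by (simp flip: of_real_mult add: real_sqrt_mult_self field_simps)
  moreover have "inner_prod k (u a) w' = 0" if "a < m" for a
    unfolding w'_def inner_prod_smult using w(1) that by (simp add: V_def)
  ultimately show ?thesis by blast
qed

lemma hermitian_orthonormal_eigenvectors:
  assumes A: "hermitian_mat k A" and "m \<le> k"
  shows "\<exists>u D. (\<forall>a<m. mat_apply k A (u a) = (\<lambda>x. complex_of_real (D a) * u a x)) \<and>
    (\<forall>a<m. \<forall>b<m. inner_prod k (u a) (u b) = (if a = b then 1 else 0))"
  using \<open>m \<le> k\<close>
proof (induction m)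
  case (Suc m)
  then obtain u and D :: "nat \<Rightarrow> real"
    where uD: "\<And>a. a < m \<Longrightarrow> mat_apply k A (u a) = (\<lambda>x. complex_of_real (D a) * u a x)"
      "\<And>a b. a < m \<Longrightarrow> b < m \<Longrightarrow> inner_prod k (u a) (u b) = (if a = b then 1 else 0)"
    by auto
  obtain w z where w: "mat_apply k A w = (\<lambda>x. of_real z * w x)" "inner_prod k w w = 1"
      "\<And>a. a < m \<Longrightarrow> inner_prod k (u a) w = 0"
    using hermitian_extend_eigenvectors[OF A, of m u "\<lambda>a. of_real (D a)"] Suc.prems uD(1) by auto
  have w': "inner_prod k w (u a) = 0" if "a < m" for a
    using w(3)[OF that] inner_prod_cnj[of k "u a" w] by simp
  show ?case
    by (rule exI[of _ "u(m := w)"], rule exI[of _ "D(m := z)"])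
      (use uD w w' in \<open>auto simp: less_Suc_eq\<close>)
qed auto

section \<open>Orthonormal eigenbases and residual estimates\<close>

text \<open>Completeness and the spectral decomposition are recorded next to orthonormality so that
  later sums collapse directly. \<open>D\<close> is tied to \<open>eigs\<close> as a set, which
  avoids matching multiplicities.\<close>

definition eigenbasis :: "nat \<Rightarrow> complex mat \<Rightarrow> (nat \<Rightarrow> nat \<Rightarrow> complex) \<Rightarrow> (nat \<Rightarrow> real) \<Rightarrow> bool" where
  "eigenbasis k A u D \<longleftrightarrow>
     (\<forall>a<k. \<forall>b<k. inner_prod k (u a) (u b) = (if a = b then 1 else 0)) \<and>
     (\<forall>x<k. \<forall>y<k. (\<Sum>a<k. u a x * cnj (u a y)) = (if x = y then 1 else 0)) \<and>
     (\<forall>x<k. \<forall>y<k. A $$ (x, y) = (\<Sum>a<k. D a * u a x * cnj (u a y))) \<and>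
     set (eigs A) = D ` {..<k}"

text \<open>For square matrices a left inverse is also a right inverse, so orthonormal columns have
  orthonormal rows.\<close>

lemma orthonormal_complete:
  assumes "\<And>a b. a < k \<Longrightarrow> b < k \<Longrightarrow> inner_prod k (u a) (u b) = (if a = b then 1 else 0)"
    and "x < k" "y < k"
  shows "(\<Sum>a<k. u a x * cnj (u a y)) = (if x = y then 1 else 0)"
proof -
  define U where "U = mat k k (\<lambda>(x, a). u a x)"
  define U' where "U' = mat k k (\<lambda>(a, x). cnj (u a x))"
  have c: "U \<in> carrier_mat k k" "U' \<in> carrier_mat k k" by (auto simp: U_def U'_def)
  have "U' * U = 1\<^sub>m k"
    using assms(1) by (intro eq_matI) (auto simp: U_def U'_def scalar_prod_def inner_prod_def lessThan_atLeast0)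
  then have "U * U' = 1\<^sub>m k" using mat_mult_left_right_inverse[OF c(2,1)] by simp
  then have "(U * U') $$ (x, y) = 1\<^sub>m k $$ (x, y)" by simp
  then show ?thesis using assms(2,3) by (simp add: U_def U'_def scalar_prod_def lessThan_atLeast0)
qed

theorem hermitian_eigenbasis:
  assumes A: "hermitian_mat k A"
  shows "\<exists>u D. eigenbasis k A u D"
proof -
  have cA: "A \<in> carrier_mat k k" using A by (simp add: hermitian_mat_def)
  obtain u and D :: "nat \<Rightarrow> real"
    where ev: "\<And>a. a < k \<Longrightarrow> mat_apply k A (u a) = (\<lambda>x. complex_of_real (D a) * u a x)"
      and orth: "\<And>a b. a < k \<Longrightarrow> b < k \<Longrightarrow> inner_prod k (u a) (u b) = (if a = b then 1 else 0)"
    using hermitian_orthonormal_eigenvectors[OF A order_refl] by auto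
  note complete = orthonormal_complete[where u = u, OF orth]
  have dec: "A $$ (x, y) = (\<Sum>a<k. D a * u a x * cnj (u a y))" if "x < k" "y < k" for x y
  proof -
    have "(\<Sum>a<k. D a * u a x * cnj (u a y)) = (\<Sum>a<k. mat_apply k A (u a) x * cnj (u a y))"
      using ev by (intro sum.cong) (auto simp: fun_eq_iff)
    also have "\<dots> = (\<Sum>a<k. \<Sum>z<k. A $$ (x, z) * (u a z * cnj (u a y)))"
      using that by (simp add: mat_apply_def sum_distrib_left sum_distrib_right mult_ac)
    also have "\<dots> = (\<Sum>z<k. A $$ (x, z) * (\<Sum>a<k. u a z * cnj (u a y)))"
      by (subst sum.swap) (simp add: sum_distrib_left)
    also have "\<dots> = (\<Sum>z<k. A $$ (x, z) * (if z = y then 1 else 0))"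
      using that by (intro sum.cong) (auto simp: complete)
    also have "\<dots> = A $$ (x, y)" using that by (simp add: if_distrib[of "(*) _"] cong: if_cong)
    finally show ?thesis by simp
  qed
  have nonz: "\<exists>x<k. u a x \<noteq> 0" if "a < k" for a
  proof (rule ccontr)
    assume "\<not> ?thesis"
    then have "inner_prod k (u a) (u a) = 0" by (simp add: inner_prod_def)
    then show False using orth[OF that that] by simp
  qed
  have "complex_of_real (D a) \<in> spectrum A" if a: "a < k" for a
  proof -
    have "A *\<^sub>v vec k (u a) = of_real (D a) \<cdot>\<^sub>v vec k (u a)"
    proof (rule eq_vecI)
      fix x assume "x < dim_vec (of_real (D a) \<cdot>\<^sub>v vec k (u a))"
      then have "x < k" by simp
      then show "vec_index (A *\<^sub>v vec k (u a)) x = vec_index (of_real (D a) \<cdot>\<^sub>v vec k (u a)) x"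
        using fun_cong[OF ev[OF a], of x] cA
        by (simp add: mat_apply_def scalar_prod_def lessThan_atLeast0)
    qed (use cA in auto)
    moreover have "vec k (u a) \<noteq> 0\<^sub>v k"
      using nonz[OF a] by (metis index_vec index_zero_vec(1))
    ultimately have "eigenvector A (vec k (u a)) (of_real (D a))"
      using cA by (simp add: eigenvector_def)
    then show ?thesis by (auto simp: spectrum_def eigenvalue_def)
  qed
  \<comment> \<open>By completeness an eigenvector w for z overlaps with some \<open>u a\<close>;
    evaluating the inner product of \<open>u a\<close> with A w in two ways then forces z = D
    a.\<close>
  moreover have "z \<in> (\<lambda>a. complex_of_real (D a)) ` {..<k}" if "z \<in> spectrum A" for z
  proof -
    obtain v where "eigenvector A v z"
      using \<open>z \<in> spectrum A\<close> by (auto simp: spectrum_def eigenvalue_def)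
    then have v: "v \<in> carrier_vec k" "v \<noteq> 0\<^sub>v k" "A *\<^sub>v v = z \<cdot>\<^sub>v v"
      using cA by (simp_all add: eigenvector_def)
    define w where "w = (\<lambda>x. if x < k then vec_index v x else 0)"
    have Aw: "mat_apply k A w = (\<lambda>x. z * w x)"
    proof
      fix x
      have "vec_index (A *\<^sub>v v) x = z * vec_index v x" if "x < k"
        using v that by simp
      then show "mat_apply k A w x = z * w x"
        using cA v(1) by (auto simp: mat_apply_def w_def scalar_prod_def lessThan_atLeast0)
    qed
    have "\<exists>a<k. inner_prod k (u a) w \<noteq> 0"
    proof (rule ccontr)
      assume "\<not> ?thesis"
      then have 0: "inner_prod k (u a) w = 0" if "a < k" for a using that by simp
      have "w x = 0" if "x < k" for x
      proof -
        have "w x = (\<Sum>y<k. (if x = y then 1 else 0) * w y)"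
          using that by (simp add: if_distrib[of "\<lambda>c. c * _"] cong: if_cong)
        also have "\<dots> = (\<Sum>y<k. (\<Sum>a<k. u a x * cnj (u a y)) * w y)"
          using that by (intro sum.cong) (auto simp: complete)
        also have "\<dots> = (\<Sum>a<k. u a x * inner_prod k (u a) w)"
          unfolding inner_prod_def sum_distrib_left sum_distrib_right
          by (subst sum.swap) (simp add: mult_ac)
        also have "\<dots> = 0" using 0 by simp
        finally show ?thesis .
      qed
      then have "v = 0\<^sub>v k" using v(1) by (intro eq_vecI) (auto simp: w_def)
      then show False using v(2) by simp
    qed
    then obtain a where a: "a < k" "inner_prod k (u a) w \<noteq> 0" by blast
    have "z * inner_prod k (u a) w = of_real (D a) * inner_prod k (u a) w"
      using inner_prod_hermitian[OF A, of "u a" w] unfolding Aw ev[OF a(1)] by simp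
    then show ?thesis using a by auto
  qed
  ultimately have "spectrum A = (\<lambda>a. complex_of_real (D a)) ` {..<k}" by auto
  then have "set (eigs A) = D ` {..<k}"
    unfolding set_eigs[OF cA] by (simp only: image_image Re_complex_of_real)
  then have "eigenbasis k A u D"
    unfolding eigenbasis_def by (intro conjI allI impI orth complete dec)
  then show ?thesis by blast
qed

lemma eigenbasisD:
  assumes "eigenbasis k A u D"
  shows "\<And>a b. a < k \<Longrightarrow> b < k \<Longrightarrow> inner_prod k (u a) (u b) = (if a = b then 1 else 0)"
    and "\<And>x y. x < k \<Longrightarrow> y < k \<Longrightarrow> (\<Sum>a<k. u a x * cnj (u a y)) = (if x = y then 1 else 0)"
    and "\<And>x y. x < k \<Longrightarrow> y < k \<Longrightarrow> A $$ (x, y) = (\<Sum>a<k. D a * u a x * cnj (u a y))"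
    and "set (eigs A) = D ` {..<k}"
  using assms unfolding eigenbasis_def by blast+

lemma eigenbasis_expand:
  assumes "eigenbasis k A u D" "x < k"
  shows "(\<Sum>a<k. u a x * inner_prod k (u a) w) = w x"
proof -
  have "(\<Sum>a<k. u a x * inner_prod k (u a) w) = (\<Sum>y<k. (\<Sum>a<k. u a x * cnj (u a y)) * w y)"
    unfolding inner_prod_def sum_distrib_left sum_distrib_right
    by (subst sum.swap) (simp add: mult_ac)
  also have "\<dots> = (\<Sum>y<k. (if x = y then 1 else 0) * w y)"
    using assms(2) by (intro sum.cong) (auto simp: eigenbasisD(2)[OF assms(1)])
  also have "\<dots> = w x"
    using assms(2) by (simp add: if_distrib[of "\<lambda>c. c * _"] cong: if_cong)
  finally show ?thesis .
qed

lemma eigenbasis_parseval: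
  assumes "eigenbasis k A u D"
  shows "(\<Sum>x<k. (cmod (w x))\<^sup>2) = (\<Sum>a<k. (cmod (inner_prod k (u a) w))\<^sup>2)"
proof -
  have "complex_of_real (\<Sum>x<k. (cmod (w x))\<^sup>2) = (\<Sum>x<k. cnj (w x) * w x)"
    by (simp only: inner_prod_self[symmetric] inner_prod_def)
  also have "\<dots> = (\<Sum>x<k. cnj (w x) * (\<Sum>a<k. u a x * inner_prod k (u a) w))"
    by (intro sum.cong refl) (simp add: eigenbasis_expand[OF assms])
  also have "\<dots> = (\<Sum>a<k. inner_prod k w (u a) * inner_prod k (u a) w)"
    unfolding inner_prod_def[of k w] sum_distrib_left sum_distrib_right
    by (subst sum.swap) (simp add: mult_ac)
  also have "\<dots> = (\<Sum>a<k. of_real ((cmod (inner_prod k (u a) w))\<^sup>2))"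
    by (intro sum.cong refl)
      (simp add: complex_norm_square inner_prod_cnj mult.commute del: of_real_power)
  finally show ?thesis by (simp flip: of_real_sum del: of_real_power)
qed

lemma eigenbasis_mat_apply:
  assumes "eigenbasis k A u D" "x < k"
  shows "mat_apply k A w x = (\<Sum>a<k. D a * u a x * inner_prod k (u a) w)"
proof -
  have "mat_apply k A w x = (\<Sum>y<k. (\<Sum>a<k. D a * u a x * cnj (u a y)) * w y)"
    using assms(2) by (simp add: mat_apply_def eigenbasisD(3)[OF assms(1)])
  also have "\<dots> = (\<Sum>a<k. D a * u a x * inner_prod k (u a) w)"
    unfolding inner_prod_def sum_distrib_left sum_distrib_right
    by (subst sum.swap) (simp add: mult_ac)
  finally show ?thesis .
qed

text \<open>In the eigenbasis, (A - t) w has the coordinates of w multiplied by D a - t, so this is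
  Parseval again. Bounding these factors from above or from below yields the two residual estimates
  that follow.\<close>

lemma eigenbasis_deviation:
  assumes "eigenbasis k A u D"
  shows "(\<Sum>x<k. (cmod (mat_apply k A w x - of_real t * w x))\<^sup>2) =
    (\<Sum>a<k. (D a - t)\<^sup>2 * (cmod (inner_prod k (u a) w))\<^sup>2)"
proof -
  have "inner_prod k (u a) (\<lambda>x. mat_apply k A w x - of_real t * w x) = of_real (D a - t) * inner_prod k (u a) w"
    if "a < k" for a
  proof -
    have "inner_prod k (u a) (mat_apply k A w) =
        (\<Sum>x<k. cnj (u a x) * (\<Sum>b<k. D b * u b x * inner_prod k (u b) w))"
      by (simp add: inner_prod_def[of k _ "mat_apply k A w"] eigenbasis_mat_apply[OF assms])
    also have "\<dots> = (\<Sum>b<k. inner_prod k (u a) (u b) * (D b * inner_prod k (u b) w))"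
      unfolding inner_prod_def[of k "u a" "u _"] sum_distrib_left sum_distrib_right
      by (subst sum.swap) (simp add: mult_ac)
    also have "\<dots> = (\<Sum>b<k. (if a = b then 1 else 0) * (D b * inner_prod k (u b) w))"
      using that by (intro sum.cong) (auto simp: eigenbasisD(1)[OF assms])
    also have "\<dots> = D a * inner_prod k (u a) w"
      using that by (simp add: if_distrib[of "\<lambda>c. c * _"] cong: if_cong)
    finally show ?thesis
      using inner_prod_linear[of k "u a" 1 "mat_apply k A w" "- of_real t" w] by (simp add: ring_distribs)
  qed
  then show ?thesis
    unfolding eigenbasis_parseval[OF assms, of "\<lambda>x. mat_apply k A w x - of_real t * w x"]
    by (intro sum.cong refl) (simp add: norm_mult power_mult_distrib del: of_real_diff)
qed

lemma hermitian_deviation_le: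
  assumes "hermitian_mat k A" and D: "\<And>x. x \<in> set (eigs A) \<Longrightarrow> \<bar>x - t\<bar> \<le> \<eta>"
  shows "(\<Sum>x<k. (cmod (mat_apply k A w x - of_real t * w x))\<^sup>2) \<le> \<eta>\<^sup>2 * (\<Sum>x<k. (cmod (w x))\<^sup>2)"
proof -
  obtain u D where e: "eigenbasis k A u D" using hermitian_eigenbasis[OF assms(1)] by blast
  have "(D a - t)\<^sup>2 \<le> \<eta>\<^sup>2" if "a < k" for a
    using D[of "D a"] that eigenbasisD(4)[OF e] by (intro abs_le_square_iff[THEN iffD1]) auto
  then show ?thesis
    unfolding eigenbasis_deviation[OF e] eigenbasis_parseval[OF e, of w] sum_distrib_left
    by (intro sum_mono mult_right_mono) auto
qed

text \<open>If every eigenvalue were farther than \<kappa> from t, each nonzero coordinate of w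
  would make the residual strictly too large. Later comparisons of spectra use this criterion in
  place of Weyl's inequalities.\<close>

lemma approximate_eigenvalue:
  assumes "hermitian_mat k A" and w: "x0 < k" "w x0 \<noteq> 0" and "\<kappa> \<ge> 0"
    and le: "(\<Sum>x<k. (cmod (mat_apply k A w x - of_real t * w x))\<^sup>2) \<le> \<kappa>\<^sup>2 * (\<Sum>x<k. (cmod (w x))\<^sup>2)"
  shows "\<exists>x\<in>set (eigs A). \<bar>x - t\<bar> \<le> \<kappa>"
proof (rule ccontr)
  assume neg: "\<not> ?thesis"
  obtain u D where e: "eigenbasis k A u D" using hermitian_eigenbasis[OF assms(1)] by blast
  have D: "\<kappa>\<^sup>2 < (D a - t)\<^sup>2" if "a < k" for a
  proof -
    have "D a \<in> set (eigs A)" unfolding eigenbasisD(4)[OF e] using that by simp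
    then have "\<kappa> < \<bar>D a - t\<bar>" using neg by (meson not_le)
    then show ?thesis using \<open>\<kappa> \<ge> 0\<close> power_strict_mono[of \<kappa> "\<bar>D a - t\<bar>" 2] by simp
  qed
  have "0 < (\<Sum>x<k. (cmod (w x))\<^sup>2)" using w by (intro sum_pos2[of _ x0]) auto
  then have "\<exists>a<k. inner_prod k (u a) w \<noteq> 0"
    unfolding eigenbasis_parseval[OF e, of w] by (rule contrapos_pp) simp
  then obtain a where a: "a < k" "inner_prod k (u a) w \<noteq> 0" by blast
  have "\<kappa>\<^sup>2 * (\<Sum>x<k. (cmod (w x))\<^sup>2) < (\<Sum>a<k. (D a - t)\<^sup>2 * (cmod (inner_prod k (u a) w))\<^sup>2)"
    unfolding eigenbasis_parseval[OF e, of w] sum_distrib_left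
  proof (rule sum_strict_mono_ex1)
    show "\<forall>b\<in>{..<k}. \<kappa>\<^sup>2 * (cmod (inner_prod k (u b) w))\<^sup>2 \<le> (D b - t)\<^sup>2 * (cmod (inner_prod k (u b) w))\<^sup>2"
      using D by (intro ballI mult_right_mono) (auto intro: less_imp_le)
    show "\<exists>b\<in>{..<k}. \<kappa>\<^sup>2 * (cmod (inner_prod k (u b) w))\<^sup>2 < (D b - t)\<^sup>2 * (cmod (inner_prod k (u b) w))\<^sup>2"
      using a D by (intro bexI[of _ a] mult_strict_right_mono) auto
  qed simp
  then show False using le unfolding eigenbasis_deviation[OF e] by simp
qed

section \<open>Eigenvalue moments as polynomials in the entries\<close>

primrec entries_power :: "nat \<Rightarrow> (nat \<times> nat \<Rightarrow> complex) \<Rightarrow> nat \<Rightarrow> nat \<Rightarrow> nat \<Rightarrow> complex" where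
  "entries_power k B 0 x y = (if x = y then 1 else 0)"
| "entries_power k B (Suc m) x y = (\<Sum>z<k. B (x, z) * entries_power k B m z y)"

text \<open>The trace of the m-th power of X - \<mu>. The real part is taken because X ranges over
  all points of \<open>matrix_space k\<close>, not only Hermitian ones.\<close>

definition central_moment :: "nat \<Rightarrow> real \<Rightarrow> nat \<Rightarrow> (nat \<times> nat \<Rightarrow> complex) \<Rightarrow> real" where
  "central_moment k \<mu> m X =
     Re (\<Sum>x<k. entries_power k (\<lambda>p. X p - (if fst p = snd p then of_real \<mu> else 0)) m x x)"

lemma central_moment_eigenbasis:
  assumes e: "eigenbasis k A u D"
  shows "central_moment k \<mu> m (entries k A) = (\<Sum>a<k. (D a - \<mu>) ^ m)"
proof -
  define B where "B p = entries k A p - (if fst p = snd p then of_real \<mu> else 0)" for p :: "nat \<times> nat"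
  have B: "B (x, y) = (\<Sum>a<k. of_real (D a - \<mu>) * u a x * cnj (u a y))" if "x < k" "y < k" for x y
  proof -
    have "(\<Sum>a<k. of_real (D a - \<mu>) * u a x * cnj (u a y)) =
        (\<Sum>a<k. D a * u a x * cnj (u a y)) - of_real \<mu> * (\<Sum>a<k. u a x * cnj (u a y))"
      by (simp add: ring_distribs sum_subtractf sum_distrib_left mult_ac)
    then show ?thesis using that
      by (simp add: B_def entries_def eigenbasisD(2)[OF e] eigenbasisD(3)[OF e])
  qed
  have pow: "entries_power k B m x y = (\<Sum>a<k. of_real ((D a - \<mu>) ^ m) * u a x * cnj (u a y))"
    if "x < k" "y < k" for x y
    using that
  proof (induction m arbitrary: x y)
    case 0
    then show ?case by (simp add: eigenbasisD(2)[OF e])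
  next
    case (Suc m)
    define c where "c a = complex_of_real (D a - \<mu>)" for a
    have "entries_power k B (Suc m) x y =
        (\<Sum>z<k. (\<Sum>a<k. c a * u a x * cnj (u a z)) * (\<Sum>b<k. c b ^ m * u b z * cnj (u b y)))"
      using Suc by (simp add: B c_def)
    also have "\<dots> = (\<Sum>z<k. \<Sum>a<k. \<Sum>b<k. c a * u a x * (c b ^ m * cnj (u b y)) * (cnj (u a z) * u b z))"
      unfolding sum_product by (intro sum.cong refl) (simp add: mult_ac)
    also have "\<dots> = (\<Sum>a<k. \<Sum>z<k. \<Sum>b<k. c a * u a x * (c b ^ m * cnj (u b y)) * (cnj (u a z) * u b z))"
      by (rule sum.swap)
    also have "\<dots> = (\<Sum>a<k. \<Sum>b<k. c a * u a x * (c b ^ m * cnj (u b y)) * inner_prod k (u a) (u b))"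
      unfolding inner_prod_def sum_distrib_left by (intro sum.cong refl sum.swap)
    also have "\<dots> = (\<Sum>a<k. \<Sum>b<k. if a = b then c a * u a x * (c b ^ m * cnj (u b y)) else 0)"
      by (intro sum.cong refl) (auto simp: eigenbasisD(1)[OF e])
    also have "\<dots> = (\<Sum>a<k. c a ^ Suc m * u a x * cnj (u a y))"
      by (simp add: mult_ac)
    finally show ?case by (simp add: c_def)
  qed
  have "(\<Sum>x<k. entries_power k B m x x) = (\<Sum>x<k. \<Sum>a<k. of_real ((D a - \<mu>) ^ m) * u a x * cnj (u a x))"
    by (intro sum.cong refl) (simp add: pow)
  also have "\<dots> = (\<Sum>a<k. of_real ((D a - \<mu>) ^ m) * inner_prod k (u a) (u a))"
    unfolding inner_prod_def sum_distrib_left by (subst sum.swap) (simp add: mult_ac)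
  also have "\<dots> = of_real (\<Sum>a<k. (D a - \<mu>) ^ m)"
    by (simp add: eigenbasisD(1)[OF e])
  finally show ?thesis by (simp add: central_moment_def B_def[abs_def])
qed

text \<open>
  Independence concerns the matrix entries, so being near scalar has to be a measurable condition on
  them. The even central moments are polynomials in the entries, and bounding all of them
  bounds every \<open>\<bar>D a - \<mu>\<bar>\<close>.
\<close>
definition near_scalar_entries :: "nat \<Rightarrow> real \<Rightarrow> real \<Rightarrow> (nat \<times> nat \<Rightarrow> complex) set" where
  "near_scalar_entries k \<mu> \<epsilon> =
     {X \<in> space (matrix_space k). \<forall>m. central_moment k \<mu> (2 * m) X \<le> real k * \<epsilon> ^ (2 * m)}"

lemma sets_near_scalar_entries: "near_scalar_entries k \<mu> \<epsilon> \<in> sets (matrix_space k)"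
proof -
  have pow: "(\<lambda>X. entries_power k (\<lambda>p. X p - (if fst p = snd p then of_real \<mu> else 0)) m x y)
      \<in> borel_measurable (matrix_space k)" if "x < k" "y < k" for m x y
    using that
  proof (induction m arbitrary: x y)
    case (Suc m)
    have "(\<lambda>X. X (x, z)) \<in> borel_measurable (matrix_space k)" if "z < k" for z
      using that Suc.prems by (intro measurable_component_singleton) auto
    then show ?case
      unfolding entries_power.simps using Suc
      by (intro borel_measurable_sum borel_measurable_times borel_measurable_diff) auto
  qed simp
  have "central_moment k \<mu> m \<in> borel_measurable (matrix_space k)" for m
    unfolding central_moment_def[abs_def]
    by (intro borel_measurable_Re borel_measurable_sum measurable_compose[OF _ borel_measurable_Re] pow) auto
  then show ?thesis unfolding near_scalar_entries_def by measurable
qed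

lemma near_scalar_entries_iff:
  assumes A: "hermitian_mat k A" and "\<epsilon> > 0"
  shows "entries k A \<in> near_scalar_entries k \<mu> \<epsilon> \<longleftrightarrow> (\<forall>x\<in>set (eigs A). \<bar>x - \<mu>\<bar> \<le> \<epsilon>)"
proof -
  obtain u D where e: "eigenbasis k A u D" using hermitian_eigenbasis[OF A] by blast
  have sp: "entries k A \<in> space (matrix_space k)" by (auto simp: entries_def space_PiM)
  have "(\<forall>m. (\<Sum>a<k. (D a - \<mu>) ^ (2 * m)) \<le> real k * \<epsilon> ^ (2 * m)) \<longleftrightarrow> (\<forall>a<k. \<bar>D a - \<mu>\<bar> \<le> \<epsilon>)"
  proof (intro iffI allI impI)
    fix m assume "\<forall>a<k. \<bar>D a - \<mu>\<bar> \<le> \<epsilon>"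
    then have "(D a - \<mu>) ^ (2 * m) \<le> \<epsilon> ^ (2 * m)" if "a < k" for a
      using power_mono[of "\<bar>D a - \<mu>\<bar>" \<epsilon> "2 * m"] that by (simp add: power_even_abs)
    then have "(\<Sum>a<k. (D a - \<mu>) ^ (2 * m)) \<le> (\<Sum>a<k. \<epsilon> ^ (2 * m))" by (intro sum_mono) auto
    then show "(\<Sum>a<k. (D a - \<mu>) ^ (2 * m)) \<le> real k * \<epsilon> ^ (2 * m)" by simp
  next
    fix a assume mom: "\<forall>m. (\<Sum>a<k. (D a - \<mu>) ^ (2 * m)) \<le> real k * \<epsilon> ^ (2 * m)" and a: "a < k"
    show "\<bar>D a - \<mu>\<bar> \<le> \<epsilon>"
    proof (rule ccontr)
      assume "\<not> ?thesis"
      \<comment> \<open>A ratio above 1 has powers that exceed the constant factor k, against the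
        moment bound of the same order.\<close>
      then have r: "1 < (D a - \<mu>)\<^sup>2 / \<epsilon>\<^sup>2"
        using \<open>\<epsilon> > 0\<close> power_strict_mono[of \<epsilon> "\<bar>D a - \<mu>\<bar>" 2] by simp
      obtain m where m: "real k < ((D a - \<mu>)\<^sup>2 / \<epsilon>\<^sup>2) ^ m" using real_arch_pow[OF r] by blast
      have "(D a - \<mu>) ^ (2 * m) \<le> (\<Sum>a<k. (D a - \<mu>) ^ (2 * m))"
        using a by (intro member_le_sum) (auto simp: power_mult)
      also have "\<dots> \<le> real k * \<epsilon> ^ (2 * m)" using mom by blast
      finally show False
        using m \<open>\<epsilon> > 0\<close> by (simp add: power_divide power_mult[symmetric] field_simps)
    qed
  qed
  moreover have "(\<forall>a<k. \<bar>D a - \<mu>\<bar> \<le> \<epsilon>) \<longleftrightarrow> (\<forall>x\<in>set (eigs A). \<bar>x - \<mu>\<bar> \<le> \<epsilon>)"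
    unfolding eigenbasisD(4)[OF e] by blast
  ultimately show ?thesis
    using sp by (simp add: near_scalar_entries_def central_moment_eigenbasis[OF e])
qed

subsection \<open>Operators acting on a single bond\<close>

text \<open>The base-d digits of r above position i form r div d ^ Suc i and those below form r mod
  d ^ i; the new digit x is inserted between the two.\<close>

definition put_site :: "nat \<Rightarrow> nat \<Rightarrow> nat \<Rightarrow> nat \<Rightarrow> nat" where
  "put_site d i x r = (r div d ^ Suc i * d + x) * d ^ i + r mod d ^ i"

lemma site_put_site:
  assumes "d > 0" "x < d"
  shows "site d (put_site d i x r) k = (if k = i then x else site d r k)"
proof -
  have lt: "r mod d ^ i < d ^ i" using assms by simp
  consider "k < i" | "k = i" | "k > i" by linarith
  then show ?thesis
  proof cases
    case 1
    then obtain m where i: "i = k + Suc m" by (metis add_Suc_right less_iff_Suc_add)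
    define q where "q = (r div d ^ Suc i * d + x) * d ^ m"
    have "put_site d i x r = (q * d) * d ^ k + r mod d ^ i"
      by (simp add: put_site_def i q_def power_add mult_ac)
    then have "put_site d i x r div d ^ k = q * d + (r mod d ^ i) div d ^ k"
      using assms by simp
    also have "(r mod d ^ i) div d ^ k = (r div d ^ k) mod d ^ Suc m"
    proof -
      have "d ^ i = d ^ k * d ^ Suc m" by (simp add: i power_add)
      then show ?thesis using assms(1) by (simp only: mod_mult2_eq) simp
    qed
    finally have "site d (put_site d i x r) k = ((r div d ^ k) mod d ^ Suc m) mod d"
      by (simp add: site_def)
    also have "\<dots> = site d r k" by (simp add: site_def mod_mod_cancel)
    finally show ?thesis using 1 by simp
  next
    case 2
    have "put_site d i x r div d ^ i = r div d ^ Suc i * d + x"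
      unfolding put_site_def using lt assms by (subst div_mult_self3) auto
    then show ?thesis using 2 assms by (simp add: site_def)
  next
    case 3
    then obtain m where k: "k = Suc i + m" by (metis add_Suc less_iff_Suc_add)
    have "put_site d i x r div d ^ i = r div d ^ Suc i * d + x"
      unfolding put_site_def using lt assms by (subst div_mult_self3) auto
    then have "put_site d i x r div d ^ i div d = r div d ^ Suc i"
      using assms by simp
    then have "put_site d i x r div d ^ Suc i = r div d ^ Suc i"
      by (simp add: div_mult2_eq[symmetric] mult.commute)
    then have "put_site d i x r div d ^ k = r div d ^ k"
      unfolding k power_add by (simp only: div_mult2_eq)
    then show ?thesis using 3 by (simp add: site_def)
  qed
qed

text \<open>Uniqueness of base-d expansions. All positions are compared, so no bound on r and s
  enters; equalities between basis states are reduced to digits by it.\<close>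

lemma sites_eqI:
  assumes d: "d \<ge> 2" and eq: "\<And>k. site d r k = site d s k"
  shows "r = s"
  using eq
proof (induction r arbitrary: s rule: less_induct)
  case (less r)
  have step: "site d (q div d) k = site d q (Suc k)" for q k
    by (simp add: site_def div_mult2_eq)
  have mod: "r mod d = s mod d" using less.prems[of 0] by (simp add: site_def)
  show ?case
  proof (cases "r = 0")
    case True
    show ?thesis
    proof (rule ccontr)
      assume "r \<noteq> s"
      then have "s > 0" using True by simp
      have "\<exists>k. site d s k \<noteq> 0" using \<open>s > 0\<close>
      proof (induction s rule: less_induct)
        case (less s)
        show ?case
        proof (cases "s < d")
          case True
          then show ?thesis using less.prems by (intro exI[of _ 0]) (simp add: site_def)
        next
          case False
          then have "s div d > 0" "s div d < s" using d less.prems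
            by (auto simp: div_greater_zero_iff)
          then show ?thesis using less.IH[of "s div d"] step by metis
        qed
      qed
      then show False using less.prems True by (simp add: site_def)
    qed
  next
    case False
    then have "r div d < r" using d by simp
    then have "r div d = s div d" by (rule less.IH) (simp add: step less.prems)
    then show ?thesis using mod by (metis div_mult_mod_eq)
  qed
qed

lemma site_eq_0: "d \<ge> 2 \<Longrightarrow> r < d ^ n \<Longrightarrow> n \<le> k \<Longrightarrow> site d r k = 0"
  unfolding site_def by (metis div_less less_le_trans mod_0 order_trans power_increasing one_le_numeral)

lemma less_power_iff_sites:
  assumes "d \<ge> 2"
  shows "r < d ^ n \<longleftrightarrow> (\<forall>k\<ge>n. site d r k = 0)"
proof
  assume "\<forall>k\<ge>n. site d r k = 0"
  moreover have "site d (r div d ^ n) k = site d r (n + k)" for k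
    by (simp add: site_def power_add div_mult2_eq)
  ultimately have "site d (r div d ^ n) k = site d 0 k" for k
    by (simp add: site_def[of _ 0])
  then have "r div d ^ n = 0" by (rule sites_eqI[OF assms])
  then show "r < d ^ n" using assms by (simp add: div_eq_0_iff)
qed (use site_eq_0[OF assms] in auto)

fun bond_state :: "nat \<Rightarrow> nat \<times> nat \<Rightarrow> nat \<Rightarrow> nat" where
  "bond_state d (i, j) r = site d r i * d + site d r j"

fun put_bond :: "nat \<Rightarrow> nat \<times> nat \<Rightarrow> nat \<Rightarrow> nat \<Rightarrow> nat" where
  "put_bond d (i, j) y r = put_site d i (y div d) (put_site d j (y mod d) r)"

lemma site_less: "d > 0 \<Longrightarrow> site d r k < d"
  by (simp add: site_def)

lemma bond_state_less: "d > 0 \<Longrightarrow> bond_state d e r < d\<^sup>2"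
proof (cases e)
  case (Pair i j)
  assume d: "d > 0"
  have "site d r i * d + site d r j < (site d r i + 1) * d" using site_less[OF d] by simp
  also have "\<dots> \<le> d * d" using site_less[OF d, of r i] by (intro mult_right_mono) auto
  finally show ?thesis by (simp add: Pair power2_eq_square)
qed

text \<open>Every bond touches itself, hence the extra \<open>f \<noteq> l\<close> wherever proper
  neighbours are meant.\<close>

definition touches :: "nat \<times> nat \<Rightarrow> nat \<times> nat \<Rightarrow> bool" where
  "touches e f \<longleftrightarrow> {fst e, snd e} \<inter> {fst f, snd f} \<noteq> {}"

context
  fixes d :: nat
  assumes d: "d \<ge> 2"
begin

lemma site_put_bond:
  assumes "y < d\<^sup>2" "fst e \<noteq> snd e"
  shows "site d (put_bond d e y r) k =
    (if k = fst e then y div d else if k = snd e then y mod d else site d r k)"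
proof -
  have "y div d < d" using assms(1) d by (simp add: power2_eq_square div_less_iff_less_mult)
  then show ?thesis using d assms(2) by (cases e) (auto simp: site_put_site)
qed

text \<open>With the next two lemmas this gives the put-get, put-put and get-put laws for the state
  of a bond, on which the algebra of operators on one bond rests.\<close>

lemma bond_state_put_bond:
  assumes "y < d\<^sup>2" "fst e \<noteq> snd e"
  shows "bond_state d e (put_bond d e y r) = y"
  using assms site_put_bond[OF assms] by (cases e) (simp del: put_bond.simps)

lemma put_bond_put_bond:
  assumes "y < d\<^sup>2" "z < d\<^sup>2" "fst e \<noteq> snd e"
  shows "put_bond d e y (put_bond d e z r) = put_bond d e y r"
  by (rule sites_eqI[OF d]) (simp add: site_put_bond assms)

lemma put_bond_bond_state:
  assumes "fst e \<noteq> snd e"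
  shows "put_bond d e (bond_state d e r) r = r"
proof (rule sites_eqI[OF d])
  have "bond_state d e r < d\<^sup>2" using bond_state_less d by simp
  then show "site d (put_bond d e (bond_state d e r) r) k = site d r k" for k
    using site_less[of d r "snd e"] d assms by (cases e) (auto simp: site_put_bond simp del: put_bond.simps)
qed

lemma put_bond_commute:
  assumes "y < d\<^sup>2" "z < d\<^sup>2" "fst e \<noteq> snd e" "fst f \<noteq> snd f" "\<not> touches e f"
  shows "put_bond d e y (put_bond d f z r) = put_bond d f z (put_bond d e y r)"
  by (rule sites_eqI[OF d]) (use assms in \<open>auto simp: site_put_bond touches_def\<close>)

lemma bond_state_put_bond_other:
  assumes "z < d\<^sup>2" "fst f \<noteq> snd f" "\<not> touches e f"
  shows "bond_state d e (put_bond d f z r) = bond_state d e r"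
  using assms by (cases e) (auto simp: site_put_bond touches_def simp del: put_bond.simps)

lemma put_bond_less_iff:
  assumes "y < d\<^sup>2" "fst e < snd e" "snd e < n"
  shows "put_bond d e y r < d ^ n \<longleftrightarrow> r < d ^ n"
  using assms by (auto simp: less_power_iff_sites[OF d] site_put_bond)

end

section \<open>The algebra of bond operators\<close>

text \<open>The kernel is a function rather than a matrix, so that products, the identity and
  rank-one kernels built from eigenvectors can be inserted directly.\<close>

definition bond_op :: "nat \<Rightarrow> nat \<times> nat \<Rightarrow> (nat \<Rightarrow> nat \<Rightarrow> complex) \<Rightarrow> (nat \<Rightarrow> complex) \<Rightarrow> nat \<Rightarrow> complex" where
  "bond_op d e g \<psi> r = (\<Sum>y<d\<^sup>2. g (bond_state d e r) y * \<psi> (put_bond d e y r))"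

text \<open>In row r only the basis states agreeing with r off the bond contribute;
  \<open>put_bond\<close> enumerates them by the two-site state, with inverse
  \<open>bond_state\<close>.\<close>

lemma embed_apply:
  assumes d: "d \<ge> 2" and e: "fst e < snd e" "snd e < n" and r: "r < d ^ n"
  shows "(\<Sum>s<d ^ n. embed d n e h $$ (r, s) * \<psi> s) = bond_op d e (\<lambda>x y. h $$ (x, y)) \<psi> r"
proof -
  obtain i j where ij: "e = (i, j)" by (cases e)
  define S where "S = {s \<in> {..<d ^ n}. \<forall>k<n. k \<noteq> i \<and> k \<noteq> j \<longrightarrow> site d r k = site d s k}"
  have "(\<Sum>s<d ^ n. embed d n e h $$ (r, s) * \<psi> s) =
      (\<Sum>s<d ^ n. if s \<in> S then h $$ (bond_state d e r, bond_state d e s) * \<psi> s else 0)"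
    using r by (intro sum.cong refl) (auto simp: embed_def ij S_def)
  also have "\<dots> = (\<Sum>s\<in>S. h $$ (bond_state d e r, bond_state d e s) * \<psi> s)"
    by (subst sum.inter_filter[symmetric]) (auto simp: S_def intro: sum.cong)
  also have "\<dots> = (\<Sum>y<d\<^sup>2. h $$ (bond_state d e r, y) * \<psi> (put_bond d e y r))"
  proof (rule sum.reindex_bij_witness[of _ "\<lambda>y. put_bond d e y r" "bond_state d e"])
    fix s assume s: "s \<in> S"
    show "put_bond d e (bond_state d e s) r = s"
    proof (rule sites_eqI[OF d])
      fix k
      \<comment> \<open>At positions n and above both numbers have digit 0.\<close>
      have "site d s k = site d r k" if "k \<noteq> i" "k \<noteq> j"
        using s r that site_eq_0[OF d, of _ n k] by (cases "k < n") (auto simp: S_def)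
      moreover have "bond_state d e s < d\<^sup>2" using bond_state_less d by simp
      ultimately show "site d (put_bond d e (bond_state d e s) r) k = site d s k"
        using site_less[of d s j] d e ij by (auto simp: site_put_bond simp del: put_bond.simps)
    qed
    then show "h $$ (bond_state d e r, bond_state d e s) * \<psi> (put_bond d e (bond_state d e s) r) =
        h $$ (bond_state d e r, bond_state d e s) * \<psi> s"
      by simp
    show "bond_state d e s \<in> {..<d\<^sup>2}" using bond_state_less d by simp
  next
    fix y assume y: "y \<in> {..<d\<^sup>2}"
    then show "bond_state d e (put_bond d e y r) = y"
      using bond_state_put_bond[OF d] e by simp
    show "put_bond d e y r \<in> S"
      using y e r ij put_bond_less_iff[OF d, of y e n r]
      by (auto simp: S_def site_put_bond[OF d] simp del: put_bond.simps)
  qed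
  finally show ?thesis by (simp add: bond_op_def)
qed

context
  fixes d :: nat
  assumes d: "d \<ge> 2"
begin

lemma bond_op_linear:
  "bond_op d e g (\<lambda>r. a * \<phi> r + b * \<psi> r) r = a * bond_op d e g \<phi> r + b * bond_op d e g \<psi> r"
  by (simp add: bond_op_def ring_distribs sum.distrib sum_distrib_left mult_ac)

lemma bond_op_bond_op:
  assumes "fst e \<noteq> snd e"
  shows "bond_op d e g (bond_op d e g' \<psi>) = bond_op d e (\<lambda>x y. \<Sum>z<d\<^sup>2. g x z * g' z y) \<psi>"
proof
  fix r
  have "bond_op d e g (bond_op d e g' \<psi>) r =
      (\<Sum>z<d\<^sup>2. \<Sum>y<d\<^sup>2. g (bond_state d e r) z * g' z y * \<psi> (put_bond d e y r))"
    unfolding bond_op_def sum_distrib_left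
    by (intro sum.cong refl) (simp add: bond_state_put_bond[OF d] put_bond_put_bond[OF d] assms mult_ac)
  also have "\<dots> = bond_op d e (\<lambda>x y. \<Sum>z<d\<^sup>2. g x z * g' z y) \<psi> r"
    unfolding bond_op_def sum_distrib_right by (rule sum.swap)
  finally show "bond_op d e g (bond_op d e g' \<psi>) r = bond_op d e (\<lambda>x y. \<Sum>z<d\<^sup>2. g x z * g' z y) \<psi> r" .
qed

lemma bond_op_scalar:
  assumes "fst e \<noteq> snd e"
  shows "bond_op d e (\<lambda>x y. if x = y then c else 0) \<psi> = (\<lambda>r. c * \<psi> r)"
proof
  fix r
  have "bond_state d e r < d\<^sup>2" using bond_state_less d by simp
  then show "bond_op d e (\<lambda>x y. if x = y then c else 0) \<psi> r = c * \<psi> r"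
    by (simp add: bond_op_def if_distrib[of "\<lambda>c. c * _"] put_bond_bond_state[OF d] assms cong: if_cong)
qed

text \<open>Disjoint bonds are read and written independently, so exchanging the operators amounts
  to exchanging two summations.\<close>

lemma bond_op_commute:
  assumes "fst e \<noteq> snd e" "fst f \<noteq> snd f" "\<not> touches e f"
  shows "bond_op d e g (bond_op d f g' \<psi>) = bond_op d f g' (bond_op d e g \<psi>)"
proof
  fix r
  have t: "\<not> touches f e" using assms(3) by (auto simp: touches_def)
  have "bond_op d e g (bond_op d f g' \<psi>) r =
      (\<Sum>y<d\<^sup>2. \<Sum>z<d\<^sup>2. g (bond_state d e r) y * (g' (bond_state d f r) z * \<psi> (put_bond d f z (put_bond d e y r))))"
    unfolding bond_op_def sum_distrib_left
    by (intro sum.cong refl) (simp add: bond_state_put_bond_other[OF d] assms t)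
  also have "\<dots> = (\<Sum>z<d\<^sup>2. \<Sum>y<d\<^sup>2. g (bond_state d e r) y * (g' (bond_state d f r) z * \<psi> (put_bond d f z (put_bond d e y r))))"
    by (rule sum.swap)
  also have "\<dots> = (\<Sum>z<d\<^sup>2. \<Sum>y<d\<^sup>2. g' (bond_state d f r) z * (g (bond_state d e r) y * \<psi> (put_bond d e y (put_bond d f z r))))"
    by (intro sum.cong refl) (simp add: put_bond_commute[OF d _ _ assms] mult_ac)
  also have "\<dots> = bond_op d f g' (bond_op d e g \<psi>) r"
    unfolding bond_op_def sum_distrib_left
    by (intro sum.cong refl) (simp add: bond_state_put_bond_other[OF d] assms t)
  finally show "bond_op d e g (bond_op d f g' \<psi>) r = bond_op d f g' (bond_op d e g \<psi>) r" .
qed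

lemma bond_op_support:
  assumes "fst e < snd e" "snd e < n" "\<And>r. r \<ge> d ^ n \<Longrightarrow> \<psi> r = 0" "r \<ge> d ^ n"
  shows "bond_op d e g \<psi> r = 0"
proof -
  have "\<psi> (put_bond d e y r) = 0" if "y < d\<^sup>2" for y
    using put_bond_less_iff[OF d that assms(1,2), of r] assms(3,4) by (simp add: not_less)
  then show ?thesis by (simp add: bond_op_def)
qed

text \<open>The involution \<open>(r, z) \<mapsto> (put_bond d e z r, bond_state d e r)\<close> preserves the sum.\<close>
lemma sum_put_bond:
  fixes \<phi> :: "nat \<Rightarrow> real"
  assumes "fst e < snd e" "snd e < n"
  shows "(\<Sum>r<d ^ n. \<Sum>z<d\<^sup>2. \<phi> (put_bond d e z r)) = (real d)\<^sup>2 * (\<Sum>r<d ^ n. \<phi> r)"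
proof -
  have "(\<Sum>r<d ^ n. \<Sum>z<d\<^sup>2. \<phi> (put_bond d e z r)) =
      (\<Sum>(r, z) \<in> {..<d ^ n} \<times> {..<d\<^sup>2}. \<phi> (put_bond d e z r))"
    by (rule sum.cartesian_product)
  also have "\<dots> = (\<Sum>(r, z) \<in> {..<d ^ n} \<times> {..<d\<^sup>2}. \<phi> r)"
    by (rule sum.reindex_bij_witness[of _ "\<lambda>(r, z). (put_bond d e z r, bond_state d e r)"
          "\<lambda>(r, z). (put_bond d e z r, bond_state d e r)"])
      (use assms d in \<open>auto simp: bond_state_put_bond put_bond_put_bond put_bond_bond_state
        put_bond_less_iff bond_state_less\<close>)
  also have "\<dots> = (\<Sum>r<d ^ n. \<Sum>z<d\<^sup>2. \<phi> r)" by (rule sum.cartesian_product[symmetric])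
  finally show ?thesis by (simp add: sum_distrib_left)
qed

text \<open>On each fibre of configurations that differ only on e, the operator is the matrix h
  itself, so the matrix estimate applies fibre by fibre.\<close>

lemma bond_op_deviation_le:
  assumes e: "fst e < snd e" "snd e < n" and h: "hermitian_mat (d\<^sup>2) h"
    and near: "\<And>x. x \<in> set (eigs h) \<Longrightarrow> \<bar>x - \<mu>\<bar> \<le> \<eta>"
  shows "(\<Sum>r<d ^ n. (cmod (bond_op d e (\<lambda>x y. h $$ (x, y)) \<psi> r - of_real \<mu> * \<psi> r))\<^sup>2)
    \<le> \<eta>\<^sup>2 * (\<Sum>r<d ^ n. (cmod (\<psi> r))\<^sup>2)"
proof -
  define \<phi> where "\<phi> r = (cmod (bond_op d e (\<lambda>x y. h $$ (x, y)) \<psi> r - of_real \<mu> * \<psi> r))\<^sup>2" for r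
  have ne: "fst e \<noteq> snd e" using e by simp
  \<comment> \<open>Letting r run over all configurations counts each fibre d^2 times, which spares
    a choice of representatives; the factor cancels at the end.\<close>
  have "(real d)\<^sup>2 * (\<Sum>r<d ^ n. \<phi> r) = (\<Sum>r<d ^ n. \<Sum>z<d\<^sup>2. \<phi> (put_bond d e z r))"
    using sum_put_bond[OF e] by simp
  also have "\<dots> \<le> (\<Sum>r<d ^ n. \<eta>\<^sup>2 * (\<Sum>y<d\<^sup>2. (cmod (\<psi> (put_bond d e y r)))\<^sup>2))"
  proof (rule sum_mono)
    fix r
    define w where "w y = \<psi> (put_bond d e y r)" for y
    have "\<phi> (put_bond d e z r) = (cmod (mat_apply (d\<^sup>2) h w z - of_real \<mu> * w z))\<^sup>2" if "z < d\<^sup>2" for z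
      using that by (simp add: \<phi>_def bond_op_def mat_apply_def w_def bond_state_put_bond[OF d _ ne]
          put_bond_put_bond[OF d _ _ ne])
    then have "(\<Sum>z<d\<^sup>2. \<phi> (put_bond d e z r)) =
        (\<Sum>z<d\<^sup>2. (cmod (mat_apply (d\<^sup>2) h w z - of_real \<mu> * w z))\<^sup>2)" by simp
    also have "\<dots> \<le> \<eta>\<^sup>2 * (\<Sum>y<d\<^sup>2. (cmod (w y))\<^sup>2)"
      by (rule hermitian_deviation_le[OF h near])
    finally show "(\<Sum>z<d\<^sup>2. \<phi> (put_bond d e z r)) \<le> \<eta>\<^sup>2 * (\<Sum>y<d\<^sup>2. (cmod (\<psi> (put_bond d e y r)))\<^sup>2)"
      by (simp add: w_def)
  qed
  also have "\<dots> = (real d)\<^sup>2 * (\<eta>\<^sup>2 * (\<Sum>r<d ^ n. (cmod (\<psi> r))\<^sup>2))"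
    unfolding sum_distrib_left[symmetric] using sum_put_bond[OF e, of "\<lambda>r. (cmod (\<psi> r))\<^sup>2"] by simp
  finally show ?thesis using d by (simp add: \<phi>_def)
qed

end

subsection \<open>Decoupled bonds\<close>

lemma eigenbasis_eigenvector:
  assumes e: "eigenbasis k A u D" and a: "a < k" "x < k"
  shows "(\<Sum>z<k. A $$ (x, z) * u a z) = of_real (D a) * u a x"
proof -
  have "(\<Sum>z<k. A $$ (x, z) * u a z) = (\<Sum>b<k. D b * u b x * inner_prod k (u b) (u a))"
    using eigenbasis_mat_apply[OF e a(2), of "u a"] a(2) by (simp add: mat_apply_def)
  also have "\<dots> = (\<Sum>b<k. if b = a then D b * u b x else 0)"
    using a by (intro sum.cong) (auto simp: eigenbasisD(1)[OF e])
  finally show ?thesis using a by simp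
qed

lemma eigenbasis_left_eigenvector:
  assumes e: "eigenbasis k A u D" and b: "b < k" "y < k"
  shows "(\<Sum>z<k. cnj (u b z) * A $$ (z, y)) = of_real (D b) * cnj (u b y)"
proof -
  have "(\<Sum>z<k. cnj (u b z) * A $$ (z, y)) = (\<Sum>z<k. \<Sum>c<k. cnj (u b z) * (D c * u c z * cnj (u c y)))"
    using b by (simp add: eigenbasisD(3)[OF e] sum_distrib_left)
  also have "\<dots> = (\<Sum>c<k. inner_prod k (u b) (u c) * (D c * cnj (u c y)))"
    unfolding inner_prod_def sum_distrib_right by (subst sum.swap) (simp add: mult_ac)
  also have "\<dots> = (\<Sum>c<k. if b = c then D c * cnj (u c y) else 0)"
    using b by (intro sum.cong) (auto simp: eigenbasisD(1)[OF e])
  finally show ?thesis using b by simp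
qed

lemma eigs_eigenvector:
  assumes A: "hermitian_mat k A" and t: "t \<in> set (eigs A)"
  shows "\<exists>\<psi>. (\<forall>x\<ge>k. \<psi> x = 0) \<and> \<psi> \<noteq> (\<lambda>_. 0) \<and> mat_apply k A \<psi> = (\<lambda>x. of_real t * \<psi> x)"
proof -
  obtain u D where e: "eigenbasis k A u D" using hermitian_eigenbasis[OF A] by blast
  obtain a where a: "a < k" "t = D a" using t unfolding eigenbasisD(4)[OF e] by auto
  define \<psi> where "\<psi> = (\<lambda>x. if x < k then u a x else 0)"
  have "\<psi> \<noteq> (\<lambda>_. 0)"
  proof
    assume "\<psi> = (\<lambda>_. 0)"
    then have "u a x = 0" if "x < k" for x using that unfolding \<psi>_def fun_eq_iff by metis
    then have "inner_prod k (u a) (u a) = 0" by (simp add: inner_prod_def)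
    then show False using eigenbasisD(1)[OF e a(1) a(1)] by simp
  qed
  moreover have "mat_apply k A \<psi> = (\<lambda>x. of_real t * \<psi> x)"
    using eigenbasis_eigenvector[OF e a(1)] by (auto simp: mat_apply_def \<psi>_def a(2))
  moreover have "\<forall>x\<ge>k. \<psi> x = 0" by (simp add: \<psi>_def)
  ultimately show ?thesis by blast
qed

text \<open>The residual criterion with tolerance 0.\<close>

lemma eigenvector_eigs:
  assumes "hermitian_mat k A" and "\<And>x. x \<ge> k \<Longrightarrow> \<psi> x = 0" "\<psi> \<noteq> (\<lambda>_. 0)"
    and ev: "\<And>x. x < k \<Longrightarrow> mat_apply k A \<psi> x = of_real t * \<psi> x"
  shows "t \<in> set (eigs A)"
proof -
  obtain x0 where "\<psi> x0 \<noteq> 0" using assms(3) by auto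
  then have x0: "x0 < k" "\<psi> x0 \<noteq> 0" using assms(2)[of x0] by (auto simp: not_less[symmetric])
  have "\<exists>x\<in>set (eigs A). \<bar>x - t\<bar> \<le> 0"
    using assms(1) x0 by (rule approximate_eigenvalue) (simp_all add: ev)
  then show ?thesis by auto
qed

section \<open>The Hamiltonian as a sum of bond operators\<close>

definition ham_op ::
    "nat \<Rightarrow> (nat \<times> nat) set \<Rightarrow> (nat \<times> nat \<Rightarrow> complex mat) \<Rightarrow> (nat \<Rightarrow> complex) \<Rightarrow> nat \<Rightarrow> complex" where
  "ham_op d E h \<psi> r = (\<Sum>e\<in>E. bond_op d e (\<lambda>x y. h e $$ (x, y)) \<psi> r)"

lemma simple_graphD: "simple_graph n E \<Longrightarrow> e \<in> E \<Longrightarrow> fst e < snd e \<and> snd e < n"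
  by (auto simp: simple_graph_def)

lemma hamiltonian_apply:
  assumes "d \<ge> 2" "simple_graph n E" "r < d ^ n"
  shows "mat_apply (d ^ n) (hamiltonian d n E h) \<psi> r = ham_op d E h \<psi> r"
proof -
  have "mat_apply (d ^ n) (hamiltonian d n E h) \<psi> r =
      (\<Sum>s<d ^ n. \<Sum>e\<in>E. embed d n e (h e) $$ (r, s) * \<psi> s)"
    using assms(3) by (simp add: mat_apply_def hamiltonian_def sum_distrib_right)
  also have "\<dots> = (\<Sum>e\<in>E. \<Sum>s<d ^ n. embed d n e (h e) $$ (r, s) * \<psi> s)"
    by (rule sum.swap)
  also have "\<dots> = ham_op d E h \<psi> r"
    unfolding ham_op_def using assms simple_graphD[OF assms(2)]
    by (intro sum.cong refl embed_apply) auto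
  finally show ?thesis .
qed

lemma hermitian_hamiltonian:
  assumes "d \<ge> 2" and h: "\<And>e. e \<in> E \<Longrightarrow> hermitian_mat (d\<^sup>2) (h e)"
  shows "hermitian_mat (d ^ n) (hamiltonian d n E h)"
proof (rule hermitian_matI)
  fix r s assume rs: "r < d ^ n" "s < d ^ n"
  have "cnj (embed d n e (h e) $$ (r, s)) = embed d n e (h e) $$ (s, r)" if "e \<in> E" for e
  proof -
    obtain i j where ij: "e = (i, j)" by (cases e)
    have "cnj (h e $$ (bond_state d e r, bond_state d e s)) = h e $$ (bond_state d e s, bond_state d e r)"
      using assms(1) by (intro hermitian_entries[OF h[OF that]] bond_state_less) auto
    then show ?thesis using rs by (auto simp: embed_def ij)
  qed
  then show "cnj (hamiltonian d n E h $$ (r, s)) = hamiltonian d n E h $$ (s, r)"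
    using rs by (simp add: hamiltonian_def)
qed (simp add: hamiltonian_def)

lemma bond_op_cong:
  assumes "d > 0" "\<And>x y. x < d\<^sup>2 \<Longrightarrow> y < d\<^sup>2 \<Longrightarrow> g x y = g' x y"
  shows "bond_op d e g \<psi> = bond_op d e g' \<psi>"
  unfolding bond_op_def using assms bond_state_less[OF assms(1)] by (intro ext sum.cong) auto

lemma bond_op_sum: "bond_op d e g (\<lambda>r. \<Sum>f\<in>E. v f r) r = (\<Sum>f\<in>E. bond_op d e g (v f) r)"
  unfolding bond_op_def sum_distrib_left by (rule sum.swap)

lemma bond_op_sum_kernel: "bond_op d e (\<lambda>x y. \<Sum>a\<in>B. g a x y) \<psi> r = (\<Sum>a\<in>B. bond_op d e (g a) \<psi> r)"
  unfolding bond_op_def sum_distrib_right by (rule sum.swap)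

lemma bond_op_smult_kernel: "bond_op d e (\<lambda>x y. c * g x y) \<psi> r = c * bond_op d e g \<psi> r"
  by (simp add: bond_op_def sum_distrib_left mult_ac)

lemma bond_op_smult: "bond_op d e g (\<lambda>r. c * \<psi> r) r = c * bond_op d e g \<psi> r"
  by (simp add: bond_op_def sum_distrib_left mult_ac)

lemma L2_set_norm_sum:
  fixes v :: "'b \<Rightarrow> 'a \<Rightarrow> complex"
  assumes "finite F"
  shows "L2_set (\<lambda>r. cmod (\<Sum>f\<in>F. v f r)) X \<le> (\<Sum>f\<in>F. L2_set (\<lambda>r. cmod (v f r)) X)"
  using assms
proof (induction F)
  case (insert f F)
  have "L2_set (\<lambda>r. cmod (\<Sum>f\<in>insert f F. v f r)) X \<le> L2_set (\<lambda>r. cmod (v f r) + cmod (\<Sum>f\<in>F. v f r)) X"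
    using insert.hyps by (intro L2_set_mono) (auto intro: norm_triangle_ineq)
  also have "\<dots> \<le> L2_set (\<lambda>r. cmod (v f r)) X + L2_set (\<lambda>r. cmod (\<Sum>f\<in>F. v f r)) X"
    by (rule L2_set_triangle_ineq)
  finally show ?case using insert by simp
qed (simp add: L2_set_def)

text \<open>Only the terms in F differ, each from its scalar by at most \<eta> in norm; the triangle
  inequality for \<open>L2_set\<close> adds these errors.\<close>

lemma ham_op_perturb:
  fixes \<mu> :: "nat \<times> nat \<Rightarrow> real" and \<eta> :: real
  assumes d: "d \<ge> 2" and g: "simple_graph n E" and E: "finite E" "F \<subseteq> E"
    and eq: "\<And>e. e \<in> E - F \<Longrightarrow> h e = h' e"
    and scalar: "\<And>e x y. e \<in> F \<Longrightarrow> x < d\<^sup>2 \<Longrightarrow> y < d\<^sup>2 \<Longrightarrow> h' e $$ (x, y) = (if x = y then of_real (\<mu> e) else 0)"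
    and herm: "\<And>e. e \<in> F \<Longrightarrow> hermitian_mat (d\<^sup>2) (h e)" and "\<eta> \<ge> 0"
    and near: "\<And>e x. e \<in> F \<Longrightarrow> x \<in> set (eigs (h e)) \<Longrightarrow> \<bar>x - \<mu> e\<bar> \<le> \<eta>"
  shows "(\<Sum>r<d ^ n. (cmod (ham_op d E h \<psi> r - ham_op d E h' \<psi> r))\<^sup>2)
    \<le> (card F * \<eta>)\<^sup>2 * (\<Sum>r<d ^ n. (cmod (\<psi> r))\<^sup>2)"
proof -
  let ?X = "{..<d ^ n}"
  define v where "v e r = bond_op d e (\<lambda>x y. h e $$ (x, y)) \<psi> r - of_real (\<mu> e) * \<psi> r" for e r
  have fF: "finite F" using E finite_subset by blast
  have "ham_op d E h \<psi> r - ham_op d E h' \<psi> r = (\<Sum>e\<in>F. v e r)" for r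
  proof -
    have "bond_op d e (\<lambda>x y. h' e $$ (x, y)) \<psi> r = of_real (\<mu> e) * \<psi> r" if "e \<in> F" for e
    proof -
      have "bond_op d e (\<lambda>x y. h' e $$ (x, y)) \<psi> = bond_op d e (\<lambda>x y. if x = y then of_real (\<mu> e) else 0) \<psi>"
        using d scalar[OF that] by (intro bond_op_cong) auto
      also have "\<dots> = (\<lambda>r. of_real (\<mu> e) * \<psi> r)"
        using simple_graphD[OF g, of e] that E by (intro bond_op_scalar[OF d]) auto
      finally show ?thesis by simp
    qed
    then have "(\<Sum>e\<in>F. v e r) = (\<Sum>e\<in>F. bond_op d e (\<lambda>x y. h e $$ (x, y)) \<psi> r - bond_op d e (\<lambda>x y. h' e $$ (x, y)) \<psi> r)"
      by (simp add: v_def)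
    also have "\<dots> = (\<Sum>e\<in>E. bond_op d e (\<lambda>x y. h e $$ (x, y)) \<psi> r - bond_op d e (\<lambda>x y. h' e $$ (x, y)) \<psi> r)"
      using E eq by (intro sum.mono_neutral_left) auto
    finally show ?thesis by (simp add: ham_op_def sum_subtractf)
  qed
  then have "L2_set (\<lambda>r. cmod (ham_op d E h \<psi> r - ham_op d E h' \<psi> r)) ?X \<le> (\<Sum>e\<in>F. L2_set (\<lambda>r. cmod (v e r)) ?X)"
    using L2_set_norm_sum[OF fF, of v ?X] by simp
  also have "\<dots> \<le> (\<Sum>e\<in>F. \<eta> * L2_set (\<lambda>r. cmod (\<psi> r)) ?X)"
  proof (rule sum_mono)
    fix e assume e: "e \<in> F"
    have "(\<Sum>r<d ^ n. (cmod (v e r))\<^sup>2) \<le> \<eta>\<^sup>2 * (\<Sum>r<d ^ n. (cmod (\<psi> r))\<^sup>2)"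
      unfolding v_def using simple_graphD[OF g, of e] e E
      by (intro bond_op_deviation_le[OF d _ _ herm[OF e] near[OF e]]) auto
    then have "sqrt (\<Sum>r<d ^ n. (cmod (v e r))\<^sup>2) \<le> sqrt (\<eta>\<^sup>2 * (\<Sum>r<d ^ n. (cmod (\<psi> r))\<^sup>2))"
      by (rule real_sqrt_le_mono)
    then show "L2_set (\<lambda>r. cmod (v e r)) ?X \<le> \<eta> * L2_set (\<lambda>r. cmod (\<psi> r)) ?X"
      using \<open>\<eta> \<ge> 0\<close> by (simp add: L2_set_def real_sqrt_mult)
  qed
  also have "\<dots> = (card F * \<eta>) * L2_set (\<lambda>r. cmod (\<psi> r)) ?X" by simp
  finally have "(L2_set (\<lambda>r. cmod (ham_op d E h \<psi> r - ham_op d E h' \<psi> r)) ?X)\<^sup>2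
      \<le> ((card F * \<eta>) * L2_set (\<lambda>r. cmod (\<psi> r)) ?X)\<^sup>2"
    by (rule power_mono) simp
  then show ?thesis by (simp add: L2_set_def power_mult_distrib sum_nonneg)
qed

text \<open>
  \<open>T l a b\<close> stands for the matrix unit \<open>|a\<rangle>\<langle>b|\<close> in the eigenbasis of the term \<open>l\<close>, with eigenvalues \<open>D l a\<close>.
  The diagonal units project an eigenvector to one with definite levels \<open>\<alpha> l\<close>, and the
  off-diagonal ones then move these levels independently.
\<close>
lemma joint_eigenvectors:
  fixes F :: "(nat \<Rightarrow> complex) \<Rightarrow> nat \<Rightarrow> complex"
    and T :: "'l \<Rightarrow> nat \<Rightarrow> nat \<Rightarrow> (nat \<Rightarrow> complex) \<Rightarrow> nat \<Rightarrow> complex"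
    and D :: "'l \<Rightarrow> nat \<Rightarrow> real"
  assumes fin: "finite \<Lambda>"
    and V: "\<And>l a b \<psi>. l \<in> \<Lambda> \<Longrightarrow> \<psi> \<in> V \<Longrightarrow> T l a b \<psi> \<in> V"
    and zero: "\<And>l a b. T l a b (\<lambda>_. 0) = (\<lambda>_. 0)"
    and F: "\<And>l a b \<psi> c. l \<in> \<Lambda> \<Longrightarrow> a < k \<Longrightarrow> b < k \<Longrightarrow> \<psi> \<in> V \<Longrightarrow> F \<psi> = (\<lambda>r. of_real c * \<psi> r) \<Longrightarrow>
      F (T l a b \<psi>) = (\<lambda>r. of_real (c + (D l a - D l b)) * T l a b \<psi> r)"
    and unit: "\<And>l a b c \<psi>. l \<in> \<Lambda> \<Longrightarrow> a < k \<Longrightarrow> b < k \<Longrightarrow> c < k \<Longrightarrow> T l a b (T l b c \<psi>) = T l a c \<psi>"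
    and total: "\<And>l \<psi>. l \<in> \<Lambda> \<Longrightarrow> \<psi> \<noteq> (\<lambda>_. 0) \<Longrightarrow> \<exists>a<k. T l a a \<psi> \<noteq> (\<lambda>_. 0)"
    and comm: "\<And>l m a b a' b' \<psi>. l \<in> \<Lambda> \<Longrightarrow> m \<in> \<Lambda> \<Longrightarrow> l \<noteq> m \<Longrightarrow>
      T l a b (T m a' b' \<psi>) = T m a' b' (T l a b \<psi>)"
    and \<psi>: "\<psi> \<in> V" "\<psi> \<noteq> (\<lambda>_. 0)" "F \<psi> = (\<lambda>r. of_real c * \<psi> r)"
  shows "\<exists>\<alpha>. (\<forall>l\<in>\<Lambda>. \<alpha> l < k) \<and> (\<forall>\<Theta> \<beta>. \<Theta> \<subseteq> \<Lambda> \<longrightarrow> (\<forall>l\<in>\<Theta>. \<beta> l < k) \<longrightarrow>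
    (\<exists>\<phi>\<in>V. \<phi> \<noteq> (\<lambda>_. 0) \<and> F \<phi> = (\<lambda>r. of_real (c + (\<Sum>l\<in>\<Theta>. D l (\<beta> l) - D l (\<alpha> l))) * \<phi> r)))"
proof -
  have "\<exists>\<alpha> \<phi>. (\<forall>l\<in>\<Gamma>. \<alpha> l < k \<and> T l (\<alpha> l) (\<alpha> l) \<phi> = \<phi>) \<and> \<phi> \<in> V \<and> \<phi> \<noteq> (\<lambda>_. 0) \<and>
      F \<phi> = (\<lambda>r. of_real c * \<phi> r)" if "\<Gamma> \<subseteq> \<Lambda>" for \<Gamma>
    using finite_subset[OF that fin] that
  proof (induction \<Gamma>)
    case empty
    then show ?case using \<psi> by auto
  next
    case (insert l \<Gamma>)
    then obtain \<alpha> \<phi> where IH: "\<And>m. m \<in> \<Gamma> \<Longrightarrow> \<alpha> m < k \<and> T m (\<alpha> m) (\<alpha> m) \<phi> = \<phi>" "\<phi> \<in> V"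
        "\<phi> \<noteq> (\<lambda>_. 0)" "F \<phi> = (\<lambda>r. of_real c * \<phi> r)" by auto
    have l: "l \<in> \<Lambda>" using insert.prems by simp
    obtain a where a: "a < k" "T l a a \<phi> \<noteq> (\<lambda>_. 0)" using total[OF l IH(3)] by blast
    \<comment> \<open>Projecting at l preserves the levels already fixed at the other terms, by
      commutation.\<close>
    have m: "T m (\<alpha> m) (\<alpha> m) (T l a a \<phi>) = T l a a \<phi>" if "m \<in> \<Gamma>" for m
    proof -
      have "m \<in> \<Lambda>" "m \<noteq> l" using that insert by auto
      then show ?thesis using comm[of m l] l IH(1)[OF that] by simp
    qed
    have "\<forall>m\<in>insert l \<Gamma>. (\<alpha>(l := a)) m < k \<and> T m ((\<alpha>(l := a)) m) ((\<alpha>(l := a)) m) (T l a a \<phi>) = T l a a \<phi>"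
      using m IH(1) a(1) unit[OF l a(1) a(1) a(1)] insert.hyps by auto
    moreover have "F (T l a a \<phi>) = (\<lambda>r. of_real c * T l a a \<phi> r)"
      using F[OF l a(1) a(1) IH(2,4)] by simp
    ultimately show ?case using a(2) V[OF l IH(2)] by blast
  qed
  from this[OF order_refl] obtain \<alpha> \<phi>
    where \<alpha>: "\<And>l. l \<in> \<Lambda> \<Longrightarrow> \<alpha> l < k" and \<phi>: "\<And>l. l \<in> \<Lambda> \<Longrightarrow> T l (\<alpha> l) (\<alpha> l) \<phi> = \<phi>" "\<phi> \<in> V"
      "\<phi> \<noteq> (\<lambda>_. 0)" "F \<phi> = (\<lambda>r. of_real c * \<phi> r)" by blast
  \<comment> \<open>The terms outside \<Theta> keep their level \<open>\<alpha>\<close>; this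
    invariant is what allows the next one to be moved.\<close>
  have shift: "\<exists>\<phi>. (\<forall>l\<in>\<Lambda> - \<Theta>. T l (\<alpha> l) (\<alpha> l) \<phi> = \<phi>) \<and> \<phi> \<in> V \<and> \<phi> \<noteq> (\<lambda>_. 0) \<and>
      F \<phi> = (\<lambda>r. of_real (c + (\<Sum>l\<in>\<Theta>. D l (\<beta> l) - D l (\<alpha> l))) * \<phi> r)"
    if "\<Theta> \<subseteq> \<Lambda>" "\<And>l. l \<in> \<Theta> \<Longrightarrow> \<beta> l < k" for \<Theta> \<beta>
    using finite_subset[OF that(1) fin] that
  proof (induction \<Theta>)
    case empty
    then show ?case using \<phi> by auto
  next
    case (insert l \<Theta>)
    then obtain \<phi> where IH: "\<And>m. m \<in> \<Lambda> - \<Theta> \<Longrightarrow> T m (\<alpha> m) (\<alpha> m) \<phi> = \<phi>" "\<phi> \<in> V"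
        "\<phi> \<noteq> (\<lambda>_. 0)" "F \<phi> = (\<lambda>r. of_real (c + (\<Sum>l\<in>\<Theta>. D l (\<beta> l) - D l (\<alpha> l))) * \<phi> r)" by auto
    have l: "l \<in> \<Lambda>" "\<beta> l < k" "\<alpha> l < k" using insert.prems \<alpha> by auto
    define \<xi> where "\<xi> = T l (\<beta> l) (\<alpha> l) \<phi>"
    \<comment> \<open>The reverse matrix unit undoes the move, so the moved vector cannot
      vanish.\<close>
    have "T l (\<alpha> l) (\<beta> l) \<xi> = \<phi>"
      unfolding \<xi>_def unit[OF l(1,3,2,3)] using IH(1)[of l] l(1) insert.hyps by simp
    then have nz: "\<xi> \<noteq> (\<lambda>_. 0)" using IH(3) zero by auto
    have m: "T m (\<alpha> m) (\<alpha> m) \<xi> = \<xi>" if "m \<in> \<Lambda> - insert l \<Theta>" for m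
      unfolding \<xi>_def using comm[of m l] IH(1)[of m] that l(1) by auto
    have \<xi>V: "\<xi> \<in> V" unfolding \<xi>_def by (rule V[OF l(1) IH(2)])
    have \<xi>F: "F \<xi> = (\<lambda>r. of_real (c + (\<Sum>l\<in>insert l \<Theta>. D l (\<beta> l) - D l (\<alpha> l))) * \<xi> r)"
      unfolding \<xi>_def F[OF l IH(2,4)] using insert.hyps by (simp add: algebra_simps)
    show ?case by (rule exI[of _ \<xi>], intro conjI ballI m nz \<xi>V \<xi>F)
  qed
  show ?thesis
  proof (rule exI[of _ \<alpha>], intro conjI ballI allI impI)
    fix \<Theta> \<beta> assume "\<Theta> \<subseteq> \<Lambda>" "\<forall>l\<in>\<Theta>. \<beta> l < k"
    then obtain \<phi> where "\<phi> \<in> V" "\<phi> \<noteq> (\<lambda>_. 0)"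
        "F \<phi> = (\<lambda>r. of_real (c + (\<Sum>l\<in>\<Theta>. D l (\<beta> l) - D l (\<alpha> l))) * \<phi> r)"
      using shift[of \<Theta> \<beta>] by metis
    then show "\<exists>\<phi>\<in>V. \<phi> \<noteq> (\<lambda>_. 0) \<and>
        F \<phi> = (\<lambda>r. of_real (c + (\<Sum>l\<in>\<Theta>. D l (\<beta> l) - D l (\<alpha> l))) * \<phi> r)"
      by (intro bexI[of _ \<phi>] conjI)
  qed (rule \<alpha>)
qed

definition spread :: "complex mat \<Rightarrow> real" where
  "spread A = Max (set (eigs A)) - Min (set (eigs A))"

text \<open>For a bond l of \<Lambda> every other term is either scalar or disjoint from l, hence
  commutes with the matrix units of l; only the term at l shifts the energy. The levels of a ground
  state are then necessarily the lowest, and raising those in \<Theta> to the highest adds their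
  spreads.\<close>

lemma decoupled_spectrum:
  assumes d: "d \<ge> 2" and g: "simple_graph n E" and E: "finite E" "\<Lambda> \<subseteq> E"
    and h: "\<And>e. e \<in> E \<Longrightarrow> hermitian_mat (d\<^sup>2) (h e)"
    and disj: "\<And>l m. l \<in> \<Lambda> \<Longrightarrow> m \<in> \<Lambda> \<Longrightarrow> l \<noteq> m \<Longrightarrow> \<not> touches l m"
    and scalar: "\<And>l f. l \<in> \<Lambda> \<Longrightarrow> f \<in> E \<Longrightarrow> f \<noteq> l \<Longrightarrow> touches l f \<Longrightarrow>
      \<exists>\<mu>. \<forall>x<d\<^sup>2. \<forall>y<d\<^sup>2. h f $$ (x, y) = (if x = y then \<mu> else 0)"
    and \<Theta>: "\<Theta> \<subseteq> \<Lambda>"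
  shows "ground_energy (hamiltonian d n E h) + (\<Sum>l\<in>\<Theta>. spread (h l)) \<in> set (eigs (hamiltonian d n E h))"
proof -
  let ?H = "hamiltonian d n E h" and ?k = "d\<^sup>2" and ?F = "ham_op d E h"
  define V where "V = {\<psi> :: nat \<Rightarrow> complex. \<forall>r\<ge>d ^ n. \<psi> r = 0}"
  have H: "hermitian_mat (d ^ n) ?H" using d h by (rule hermitian_hamiltonian)
  have ne: "fst e \<noteq> snd e" if "e \<in> E" for e using simple_graphD[OF g that] by simp
  have support: "bond_op d e q \<psi> \<in> V" if "e \<in> E" "\<psi> \<in> V" for e q \<psi>
    using that simple_graphD[OF g that(1)] bond_op_support[OF d, of e n \<psi>] by (auto simp: V_def)
  have FV: "?F \<psi> r = 0" if "\<psi> \<in> V" "r \<ge> d ^ n" for \<psi> r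
    unfolding ham_op_def using support[OF _ that(1)] that(2) by (intro sum.neutral) (simp add: V_def)
  \<comment> \<open>Eigenvectors extended by zero beyond d ^ n allow \<open>ham_op\<close> to be
    used in place of the matrix.\<close>
  have eigs_iff: "t \<in> set (eigs ?H) \<longleftrightarrow> (\<exists>\<psi>\<in>V. \<psi> \<noteq> (\<lambda>_. 0) \<and> ?F \<psi> = (\<lambda>r. of_real t * \<psi> r))" for t
  proof
    assume "t \<in> set (eigs ?H)"
    then obtain \<psi> where \<psi>: "\<forall>x\<ge>d ^ n. \<psi> x = 0" "\<psi> \<noteq> (\<lambda>_. 0)"
        "mat_apply (d ^ n) ?H \<psi> = (\<lambda>x. of_real t * \<psi> x)"
      using eigs_eigenvector[OF H] by blast
    have "?F \<psi> r = of_real t * \<psi> r" for r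
      using hamiltonian_apply[OF d g, of r h \<psi>] fun_cong[OF \<psi>(3), of r] FV[of \<psi> r] \<psi>(1)
      by (cases "r < d ^ n") (auto simp: V_def)
    then show "\<exists>\<psi>\<in>V. \<psi> \<noteq> (\<lambda>_. 0) \<and> ?F \<psi> = (\<lambda>r. of_real t * \<psi> r)"
      using \<psi> by (intro bexI[of _ \<psi>]) (auto simp: V_def)
  next
    assume "\<exists>\<psi>\<in>V. \<psi> \<noteq> (\<lambda>_. 0) \<and> ?F \<psi> = (\<lambda>r. of_real t * \<psi> r)"
    then obtain \<psi> where \<psi>: "\<psi> \<in> V" "\<psi> \<noteq> (\<lambda>_. 0)" "?F \<psi> = (\<lambda>r. of_real t * \<psi> r)" by blast
    show "t \<in> set (eigs ?H)"
      using H \<psi> by (intro eigenvector_eigs[of "d ^ n" ?H \<psi>])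
        (auto simp: V_def hamiltonian_apply[OF d g] fun_eq_iff)
  qed
  have "\<exists>u D. eigenbasis ?k (h l) u D" if "l \<in> \<Lambda>" for l
    using hermitian_eigenbasis[OF h] E that by blast
  then obtain u D where e: "\<And>l. l \<in> \<Lambda> \<Longrightarrow> eigenbasis ?k (h l) (u l) (D l)" by metis
  define T where "T l a b = bond_op d l (\<lambda>x y. u l a x * cnj (u l b y))" for l a b
  have T_F: "?F (T l a b \<psi>) = (\<lambda>r. of_real (c + (D l a - D l b)) * T l a b \<psi> r)"
    if l: "l \<in> \<Lambda>" and ab: "a < ?k" "b < ?k" and \<psi>: "?F \<psi> = (\<lambda>r. of_real c * \<psi> r)" for l a b \<psi> c
  proof
    fix r
    define B where "B f = bond_op d f (\<lambda>x y. h f $$ (x, y))" for f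
    have lE: "l \<in> E" using l E by auto
    have F: "?F \<phi> r = B l \<phi> r + (\<Sum>f\<in>E - {l}. B f \<phi> r)" for \<phi> r
      unfolding ham_op_def B_def using E(1) lE by (rule sum.remove)
    have other: "B f (T l a b \<psi>) = T l a b (B f \<psi>)" if f: "f \<in> E - {l}" for f
    proof (cases "touches l f")
      case True
      then obtain \<mu> where "\<forall>x<d\<^sup>2. \<forall>y<d\<^sup>2. h f $$ (x, y) = (if x = y then \<mu> else 0)"
        using scalar[OF l] f by blast
      then have "B f \<phi> = bond_op d f (\<lambda>x y. if x = y then \<mu> else 0) \<phi>" for \<phi>
        unfolding B_def using d by (intro bond_op_cong) auto
      then have "B f \<phi> = (\<lambda>r. \<mu> * \<phi> r)" for \<phi> using bond_op_scalar[OF d ne] f by auto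
      then show ?thesis by (auto simp: T_def bond_op_smult)
    next
      case False
      then have "\<not> touches f l" by (auto simp: touches_def)
      then show ?thesis unfolding B_def T_def using f lE ne by (intro bond_op_commute[OF d]) auto
    qed
    \<comment> \<open>The kernel of a matrix unit is a right eigenvector times a left one: the term
      at l produces D l a when applied after it and D l b when applied before it.\<close>
    have "B l (T l a b \<psi>) = bond_op d l (\<lambda>x y. of_real (D l a) * (u l a x * cnj (u l b y))) \<psi>"
      unfolding B_def T_def bond_op_bond_op[OF d ne[OF lE]] using d eigenbasis_eigenvector[OF e[OF l] ab(1)]
      by (intro bond_op_cong) (auto simp: mult.assoc[symmetric] simp flip: sum_distrib_right)
    then have 1: "B l (T l a b \<psi>) r = of_real (D l a) * T l a b \<psi> r"
      by (simp add: bond_op_smult_kernel T_def)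
    have "T l a b (B l \<psi>) = bond_op d l (\<lambda>x y. of_real (D l b) * (u l a x * cnj (u l b y))) \<psi>"
      unfolding B_def T_def bond_op_bond_op[OF d ne[OF lE]] using d eigenbasis_left_eigenvector[OF e[OF l] ab(2)]
      by (intro bond_op_cong) (auto simp: mult.assoc mult.left_commute[of "of_real _"] simp flip: sum_distrib_left)
    then have 2: "T l a b (B l \<psi>) r = of_real (D l b) * T l a b \<psi> r"
      by (simp add: bond_op_smult_kernel T_def)
    have "of_real c * T l a b \<psi> r = T l a b (?F \<psi>) r"
      unfolding \<psi> by (simp add: T_def bond_op_smult)
    also have "\<dots> = T l a b (\<lambda>r. 1 * B l \<psi> r + 1 * (\<Sum>f\<in>E - {l}. B f \<psi> r)) r"
      using F[of \<psi>] by (metis (no_types, lifting) ext mult_1)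
    also have "\<dots> = T l a b (B l \<psi>) r + (\<Sum>f\<in>E - {l}. T l a b (B f \<psi>) r)"
      unfolding T_def bond_op_linear[OF d] bond_op_sum by simp
    finally show "?F (T l a b \<psi>) r = of_real (c + (D l a - D l b)) * T l a b \<psi> r"
      unfolding F 1 2 using other by (simp add: algebra_simps)
  qed
  have T_unit: "T l a b (T l b c \<psi>) = T l a c \<psi>" if l: "l \<in> \<Lambda>" and b: "b < ?k" for l a b c \<psi>
  proof -
    have "(\<Sum>z<?k. u l a x * cnj (u l b z) * (u l b z * cnj (u l c y))) = u l a x * cnj (u l c y)" for x y
    proof -
      have "(\<Sum>z<?k. u l a x * cnj (u l b z) * (u l b z * cnj (u l c y))) =
          u l a x * cnj (u l c y) * inner_prod ?k (u l b) (u l b)"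
        unfolding inner_prod_def sum_distrib_left by (simp add: mult_ac)
      then show ?thesis using eigenbasisD(1)[OF e[OF l] b b] by simp
    qed
    moreover have "l \<in> E" using l E by auto
    ultimately show ?thesis unfolding T_def by (simp add: bond_op_bond_op[OF d ne])
  qed
  have T_total: "\<exists>a<?k. T l a a \<psi> \<noteq> (\<lambda>_. 0)" if l: "l \<in> \<Lambda>" and \<psi>: "\<psi> \<noteq> (\<lambda>_. 0)" for l \<psi>
  proof (rule ccontr)
    assume "\<not> ?thesis"
    then have 0: "T l a a \<psi> = (\<lambda>_. 0)" if "a < ?k" for a using that by blast
    \<comment> \<open>The diagonal units sum to the identity, so they cannot all annihilate a
      nonzero vector.\<close>
    have "bond_op d l (\<lambda>x y. \<Sum>a<?k. u l a x * cnj (u l a y)) \<psi> = bond_op d l (\<lambda>x y. if x = y then 1 else 0) \<psi>"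
      using d eigenbasisD(2)[OF e[OF l]] by (intro bond_op_cong) auto
    also have "\<dots> = (\<lambda>r. 1 * \<psi> r)" using l E ne by (intro bond_op_scalar[OF d]) auto
    finally have "(\<Sum>a<?k. T l a a \<psi> r) = \<psi> r" for r
      unfolding T_def bond_op_sum_kernel[symmetric] by (simp add: fun_eq_iff)
    then have "\<psi> r = 0" for r using 0 by (metis (no_types, lifting) lessThan_iff sum.neutral)
    then show False using \<psi> by auto
  qed
  have D_eigs: "set (eigs (h l)) = D l ` {..<?k}" if "l \<in> \<Lambda>" for l using eigenbasisD(4)[OF e[OF that]] .
  have k0: "{..<?k} \<noteq> {}" using d by (simp add: lessThan_empty_iff)
  have fin: "finite \<Lambda>" using E finite_subset by blast
  have "length (eigs ?H) = d ^ n" using H by (intro length_eigs) (simp add: hermitian_mat_def)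
  then have "set (eigs ?H) \<noteq> {}" using d by auto
  then have "ground_energy ?H \<in> set (eigs ?H)" unfolding ground_energy_def by (intro Min_in) auto
  then obtain \<psi> where \<psi>: "\<psi> \<in> V" "\<psi> \<noteq> (\<lambda>_. 0)" "?F \<psi> = (\<lambda>r. of_real (ground_energy ?H) * \<psi> r)"
    unfolding eigs_iff by blast
  have "\<exists>\<alpha>. (\<forall>l\<in>\<Lambda>. \<alpha> l < ?k) \<and> (\<forall>\<Theta> \<beta>. \<Theta> \<subseteq> \<Lambda> \<longrightarrow> (\<forall>l\<in>\<Theta>. \<beta> l < ?k) \<longrightarrow>
    (\<exists>\<phi>\<in>V. \<phi> \<noteq> (\<lambda>_. 0) \<and>
      ?F \<phi> = (\<lambda>r. of_real (ground_energy ?H + (\<Sum>l\<in>\<Theta>. D l (\<beta> l) - D l (\<alpha> l))) * \<phi> r)))"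
  proof (rule joint_eigenvectors[where T = T and F = ?F and V = V and D = D and \<Lambda> = \<Lambda> and k = ?k
        and c = "ground_energy ?H" and \<psi> = \<psi>])
    show "T l a b (T m a' b' \<phi>) = T m a' b' (T l a b \<phi>)" if "l \<in> \<Lambda>" "m \<in> \<Lambda>" "l \<noteq> m" for l m a b a' b' \<phi>
      unfolding T_def using that E ne disj by (intro bond_op_commute[OF d]) auto
    show "T l a b \<phi> \<in> V" if "l \<in> \<Lambda>" "\<phi> \<in> V" for l a b \<phi>
      unfolding T_def using that E by (intro support) auto
    show "T l a b (\<lambda>_. 0) = (\<lambda>_. 0)" for l a b by (auto simp: T_def bond_op_def)
  qed (fact fin | fact \<psi> | erule (3) T_F | erule (1) T_unit | erule (1) T_total)+
  then obtain \<alpha> where "(\<forall>l\<in>\<Lambda>. \<alpha> l < ?k) \<and> (\<forall>\<Theta> \<beta>. \<Theta> \<subseteq> \<Lambda> \<longrightarrow> (\<forall>l\<in>\<Theta>. \<beta> l < ?k) \<longrightarrow>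
      ground_energy ?H + (\<Sum>l\<in>\<Theta>. D l (\<beta> l) - D l (\<alpha> l)) \<in> set (eigs ?H))"
    unfolding eigs_iff ..
  then have \<alpha>: "\<And>l. l \<in> \<Lambda> \<Longrightarrow> \<alpha> l < ?k"
    and shift: "\<And>\<Theta> \<beta>. \<Theta> \<subseteq> \<Lambda> \<Longrightarrow> (\<And>l. l \<in> \<Theta> \<Longrightarrow> \<beta> l < ?k) \<Longrightarrow>
      ground_energy ?H + (\<Sum>l\<in>\<Theta>. D l (\<beta> l) - D l (\<alpha> l)) \<in> set (eigs ?H)"
    by auto
  \<comment> \<open>A level below \<open>D l (\<alpha> l)\<close> would produce an eigenvalue below
    the ground energy.\<close>
  have min: "D l (\<alpha> l) = Min (set (eigs (h l)))" if l: "l \<in> \<Lambda>" for l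
    unfolding D_eigs[OF l]
  proof (rule Min_eqI[symmetric])
    fix x assume "x \<in> D l ` {..<?k}"
    then obtain b where b: "b < ?k" "x = D l b" by auto
    have "ground_energy ?H + (D l b - D l (\<alpha> l)) \<in> set (eigs ?H)"
      using shift[of "{l}" "\<lambda>_. b"] l b by simp
    then have "ground_energy ?H \<le> ground_energy ?H + (D l b - D l (\<alpha> l))"
      unfolding ground_energy_def by (intro Min_le) auto
    then show "D l (\<alpha> l) \<le> x" using b by simp
  qed (use \<alpha>[OF l] in auto)
  have "\<exists>b<?k. D l b = Max (set (eigs (h l)))" if l: "l \<in> \<Lambda>" for l
  proof -
    have "Max (D l ` {..<?k}) \<in> D l ` {..<?k}" using k0 by (intro Max_in) auto
    then show ?thesis unfolding D_eigs[OF l] by force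
  qed
  then obtain \<beta> where \<beta>: "\<And>l. l \<in> \<Lambda> \<Longrightarrow> \<beta> l < ?k \<and> D l (\<beta> l) = Max (set (eigs (h l)))" by metis
  have "(\<Sum>l\<in>\<Theta>. D l (\<beta> l) - D l (\<alpha> l)) = (\<Sum>l\<in>\<Theta>. spread (h l))"
    using \<Theta> \<beta> min by (intro sum.cong) (auto simp: spread_def)
  then show ?thesis using shift[OF \<Theta>, of \<beta>] \<beta> \<Theta> by (metis subsetD)
qed

subsection \<open>Filling an energy window\<close>

text \<open>Adding the terms one at a time, the first partial sum to reach s overshoots it by at
  most the last term.\<close>

lemma subset_sum_between:
  fixes x :: "'l \<Rightarrow> real"
  assumes "finite \<Lambda>" "\<And>l. l \<in> \<Lambda> \<Longrightarrow> x l \<le> \<epsilon>" "0 \<le> \<epsilon>" "0 \<le> s" "s \<le> (\<Sum>l\<in>\<Lambda>. x l)"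
  shows "\<exists>\<Theta>\<subseteq>\<Lambda>. s \<le> (\<Sum>l\<in>\<Theta>. x l) \<and> (\<Sum>l\<in>\<Theta>. x l) \<le> s + \<epsilon>"
  using assms
proof (induction \<Lambda>)
  case (insert l \<Lambda>)
  show ?case
  proof (cases "s \<le> (\<Sum>l\<in>\<Lambda>. x l)")
    case True
    then show ?thesis using insert.IH insert.prems by blast
  next
    case False
    moreover have "(\<Sum>l\<in>insert l \<Lambda>. x l) \<le> s + \<epsilon>" using False insert.prems(1)[of l] insert.hyps by simp
    ultimately show ?thesis using insert.prems by blast
  qed
qed auto

text \<open>An eigenvector of the second Hamiltonian is an approximate eigenvector of the first,
  with residual at most \<kappa> times its norm.\<close>

lemma eigs_hamiltonian_perturb:
  assumes d: "d \<ge> 2" and g: "simple_graph n E"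
    and h: "\<And>e. e \<in> E \<Longrightarrow> hermitian_mat (d\<^sup>2) (h e)" "\<And>e. e \<in> E \<Longrightarrow> hermitian_mat (d\<^sup>2) (h' e)"
    and "\<kappa> \<ge> 0"
    and close: "\<And>\<psi>. (\<Sum>r<d ^ n. (cmod (ham_op d E h \<psi> r - ham_op d E h' \<psi> r))\<^sup>2)
      \<le> \<kappa>\<^sup>2 * (\<Sum>r<d ^ n. (cmod (\<psi> r))\<^sup>2)"
    and t: "t \<in> set (eigs (hamiltonian d n E h'))"
  shows "\<exists>x\<in>set (eigs (hamiltonian d n E h)). \<bar>x - t\<bar> \<le> \<kappa>"
proof -
  let ?H = "hamiltonian d n E h" and ?H' = "hamiltonian d n E h'"
  have H: "hermitian_mat (d ^ n) ?H" "hermitian_mat (d ^ n) ?H'"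
    using hermitian_hamiltonian[OF d] h by auto
  obtain \<psi> where \<psi>: "\<forall>x\<ge>d ^ n. \<psi> x = 0" "\<psi> \<noteq> (\<lambda>_. 0)" "mat_apply (d ^ n) ?H' \<psi> = (\<lambda>x. of_real t * \<psi> x)"
    using eigs_eigenvector[OF H(2) t] by blast
  then obtain x0 where "\<psi> x0 \<noteq> 0" by auto
  then have x0: "x0 < d ^ n" "\<psi> x0 \<noteq> 0" using \<psi>(1) by (auto simp: not_less[symmetric])
  show ?thesis
  proof (rule approximate_eigenvalue[where w = \<psi> and t = t, OF H(1) x0 \<open>\<kappa> \<ge> 0\<close>])
    have "mat_apply (d ^ n) ?H \<psi> r - of_real t * \<psi> r = ham_op d E h \<psi> r - ham_op d E h' \<psi> r"
      if "r < d ^ n" for r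
      using that fun_cong[OF \<psi>(3), of r] by (simp add: hamiltonian_apply[OF d g])
    then show "(\<Sum>r<d ^ n. (cmod (mat_apply (d ^ n) ?H \<psi> r - of_real t * \<psi> r))\<^sup>2)
        \<le> \<kappa>\<^sup>2 * (\<Sum>r<d ^ n. (cmod (\<psi> r))\<^sup>2)"
      using close[of \<psi>] by simp
  qed
qed

text \<open>The error consists of \<epsilon> from the choice of a subset sum, \<kappa> for the
  excited eigenvalue and \<kappa> for the ground energy, both displaced when the neighbours are
  replaced by exact scalars.\<close>

theorem hamiltonian_spectrum_dense:
  fixes \<epsilon> \<delta> \<eta> \<kappa> s :: real
  assumes d: "d \<ge> 2" and g: "simple_graph n E" and E: "finite E" "\<Lambda> \<subseteq> E"
    and h: "\<And>e. e \<in> E \<Longrightarrow> hermitian_mat (d\<^sup>2) (h e)"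
    and disj: "\<And>l m. l \<in> \<Lambda> \<Longrightarrow> m \<in> \<Lambda> \<Longrightarrow> l \<noteq> m \<Longrightarrow> \<not> touches l m"
    and spread: "\<And>l. l \<in> \<Lambda> \<Longrightarrow> \<delta> \<le> spread (h l) \<and> spread (h l) \<le> \<epsilon>"
    and "\<epsilon> \<ge> 0" and many: "1 \<le> card \<Lambda> * \<delta>"
    and F: "F = {f \<in> E. \<exists>l\<in>\<Lambda>. f \<noteq> l \<and> touches l f}"
    and near: "\<And>f. f \<in> F \<Longrightarrow> \<exists>\<mu>. \<forall>x\<in>set (eigs (h f)). \<bar>x - \<mu>\<bar> \<le> \<eta>"
    and "\<eta> \<ge> 0" and \<kappa>: "card F * \<eta> \<le> \<kappa>" and s: "0 \<le> s" "s \<le> 1"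
  shows "\<exists>x\<in>set (eigs (hamiltonian d n E h)).
    \<bar>x - ground_energy (hamiltonian d n E h) - s\<bar> \<le> \<epsilon> + 2 * \<kappa>"
proof -
  obtain \<mu> where \<mu>: "\<And>f x. f \<in> F \<Longrightarrow> x \<in> set (eigs (h f)) \<Longrightarrow> \<bar>x - \<mu> f\<bar> \<le> \<eta>"
    using near by metis
  define h' where "h' f = (if f \<in> F then mat (d\<^sup>2) (d\<^sup>2) (\<lambda>(x, y). if x = y then of_real (\<mu> f) else 0) else h f)" for f
  let ?H = "hamiltonian d n E h" and ?H' = "hamiltonian d n E h'"
  have FE: "F \<subseteq> E" using F by auto
  \<comment> \<open>Bonds of \<Lambda> do not touch each other, so none is replaced and their
    spreads are unchanged.\<close>
  have F\<Lambda>: "l \<notin> F" if "l \<in> \<Lambda>" for l using disj that F by blast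
  have "0 \<le> card F * \<eta>" using \<open>\<eta> \<ge> 0\<close> by simp
  then have \<kappa>0: "\<kappa> \<ge> 0" using \<kappa> by linarith
  have h': "hermitian_mat (d\<^sup>2) (h' e)" if "e \<in> E" for e
    using h[OF that] by (auto simp: h'_def intro!: hermitian_matI)
  have close: "(\<Sum>r<d ^ n. (cmod (ham_op d E h \<psi> r - ham_op d E h' \<psi> r))\<^sup>2)
      \<le> \<kappa>\<^sup>2 * (\<Sum>r<d ^ n. (cmod (\<psi> r))\<^sup>2)" for \<psi>
  proof -
    have "(\<Sum>r<d ^ n. (cmod (ham_op d E h \<psi> r - ham_op d E h' \<psi> r))\<^sup>2)
        \<le> (card F * \<eta>)\<^sup>2 * (\<Sum>r<d ^ n. (cmod (\<psi> r))\<^sup>2)"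
    proof (rule ham_op_perturb[where \<mu> = \<mu>, OF d g E(1) FE _ _ _ \<open>\<eta> \<ge> 0\<close> \<mu>])
      show "hermitian_mat (d\<^sup>2) (h e)" if "e \<in> F" for e using that FE h by blast
    qed (auto simp: h'_def)
    also have "\<dots> \<le> \<kappa>\<^sup>2 * (\<Sum>r<d ^ n. (cmod (\<psi> r))\<^sup>2)"
      using \<kappa> \<open>0 \<le> card F * \<eta>\<close> by (intro mult_right_mono power_mono) (auto intro: sum_nonneg)
    finally show ?thesis .
  qed
  have close': "(\<Sum>r<d ^ n. (cmod (ham_op d E h' \<psi> r - ham_op d E h \<psi> r))\<^sup>2)
      \<le> \<kappa>\<^sup>2 * (\<Sum>r<d ^ n. (cmod (\<psi> r))\<^sup>2)" for \<psi>
    using close[of \<psi>] by (simp only: norm_minus_commute)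
  note perturb = eigs_hamiltonian_perturb[OF d g h h' \<kappa>0 close]
  note perturb' = eigs_hamiltonian_perturb[OF d g h' h \<kappa>0 close']
  have sum: "s \<le> (\<Sum>l\<in>\<Lambda>. spread (h' l))"
  proof -
    have "card \<Lambda> * \<delta> \<le> (\<Sum>l\<in>\<Lambda>. spread (h' l))"
      using spread F\<Lambda> by (intro sum_bounded_below) (auto simp: h'_def)
    then show ?thesis using many s by linarith
  qed
  have "finite \<Lambda>" using E finite_subset by blast
  then obtain \<Theta> where \<Theta>: "\<Theta> \<subseteq> \<Lambda>" "s \<le> (\<Sum>l\<in>\<Theta>. spread (h' l))" "(\<Sum>l\<in>\<Theta>. spread (h' l)) \<le> s + \<epsilon>"
    using subset_sum_between[of \<Lambda> "\<lambda>l. spread (h' l)" \<epsilon> s] spread F\<Lambda> \<open>\<epsilon> \<ge> 0\<close> s(1) sum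
    by (auto simp: h'_def)
  have "ground_energy ?H' + (\<Sum>l\<in>\<Theta>. spread (h' l)) \<in> set (eigs ?H')"
  proof (rule decoupled_spectrum[OF d g E h' disj _ \<Theta>(1)])
    show "\<exists>\<mu>. \<forall>x<d\<^sup>2. \<forall>y<d\<^sup>2. h' f $$ (x, y) = (if x = y then \<mu> else 0)"
      if "l \<in> \<Lambda>" "f \<in> E" "f \<noteq> l" "touches l f" for l f
    proof -
      have "f \<in> F" using that F by blast
      then show ?thesis by (intro exI[of _ "of_real (\<mu> f)"]) (simp add: h'_def)
    qed
  qed
  then obtain x where x: "x \<in> set (eigs ?H)" "\<bar>x - (ground_energy ?H' + (\<Sum>l\<in>\<Theta>. spread (h' l)))\<bar> \<le> \<kappa>"
    using perturb by blast
  have H': "hermitian_mat (d ^ n) ?H'" using hermitian_hamiltonian[OF d] h' by auto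
  then have "length (eigs ?H') = d ^ n" by (intro length_eigs) (simp add: hermitian_mat_def)
  then have "set (eigs ?H') \<noteq> {}" using d by auto
  then have g': "ground_energy ?H' \<in> set (eigs ?H')" unfolding ground_energy_def by (intro Min_in) auto
  have gr: "ground_energy ?H \<in> set (eigs ?H)" unfolding ground_energy_def using x(1) by (intro Min_in) auto
  have le: "ground_energy ?H \<le> y" if "y \<in> set (eigs ?H)" for y
    unfolding ground_energy_def using that by (intro Min_le) auto
  have le': "ground_energy ?H' \<le> y" if "y \<in> set (eigs ?H')" for y
    unfolding ground_energy_def using that by (intro Min_le) auto
  \<comment> \<open>The ground energies are compared in both directions: an eigenvalue of one
    operator near the minimum of the other bounds its own minimum from above.\<close>
  obtain y where "y \<in> set (eigs ?H)" "\<bar>y - ground_energy ?H'\<bar> \<le> \<kappa>" using perturb g' by blast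
  then have 1: "ground_energy ?H \<le> ground_energy ?H' + \<kappa>" using le[of y] by linarith
  obtain y where "y \<in> set (eigs ?H')" "\<bar>y - ground_energy ?H\<bar> \<le> \<kappa>" using perturb' gr by blast
  then have 2: "ground_energy ?H' \<le> ground_energy ?H + \<kappa>" using le'[of y] by linarith
  have "\<bar>x - ground_energy ?H - s\<bar> \<le> \<epsilon> + 2 * \<kappa>"
    using x(2) \<Theta>(2,3) 1 2 by linarith
  then show ?thesis using x(1) by blast
qed

section \<open>From dense spectra to gaplessness and continuous density of states\<close>

text \<open>The deterministic property that the probabilistic part has to supply. The window length
  1 is only a normalisation, since the density of states concerns small energies above the ground
  state.\<close>

definition dense_spectrum :: "real \<Rightarrow> complex mat \<Rightarrow> bool" where
  "dense_spectrum \<epsilon> A \<longleftrightarrow> (\<forall>s\<in>{0..1}. \<exists>x\<in>set (eigs A). \<bar>x - ground_energy A - s\<bar> \<le> \<epsilon>)"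

lemma eigs_0:
  assumes "set (eigs A) \<noteq> {}"
  shows "eigs A ! 0 = ground_energy A"
proof -
  have "sorted (eigs A)" by (simp add: eigs_def)
  then have "Min (set (eigs A)) = hd (eigs A)" using assms by (cases "eigs A") (auto intro!: Min_eqI)
  then show ?thesis using assms by (simp add: ground_energy_def hd_conv_nth)
qed

lemma eventually_dense_imp_continuous_dos:
  assumes "\<And>k. \<exists>N\<^sub>0. \<forall>N\<in>S. N \<ge> N\<^sub>0 \<longrightarrow> dense_spectrum (1 / real (Suc k)) (HN N)"
  shows "continuous_dos S HN"
  unfolding continuous_dos_def
\<comment> \<open>The window length serves as the bound for c, and 1 also as the bound for
  \<epsilon>, so that a target raised to \<epsilon> / 2 stays inside the window.\<close>
proof (intro exI[of _ "1::real"] conjI allI impI ballI)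
  fix c :: real and s \<epsilon> :: real
  assume c: "0 < c \<and> c \<le> 1" and s: "s \<in> {0..c}" and \<epsilon>: "0 < \<epsilon> \<and> \<epsilon> \<le> 1"
  \<comment> \<open>The target will move by at most \<epsilon> / 2 and is missed by less than
    \<epsilon> / 4: the total stays below \<epsilon>, and the eigenvalue stays strictly above the
    ground energy.\<close>
  obtain k where k: "1 / real (Suc k) < \<epsilon> / 4" using nat_approx_posE[of "\<epsilon> / 4"] \<epsilon> by auto
  obtain N0 where N0: "\<And>N. N \<in> S \<Longrightarrow> N \<ge> N0 \<Longrightarrow> dense_spectrum (1 / real (Suc k)) (HN N)"
    using assms by blast
  show "\<exists>N\<^sub>0>0. \<forall>N\<in>S. N > N\<^sub>0 \<longrightarrow> (\<exists>j>0. j < length (eigs (HN N)) \<and>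
      \<bar>eigs (HN N) ! j - (eigs (HN N) ! 0 + s)\<bar> \<le> \<epsilon>)"
  proof (rule exI[of _ "Suc N0"], intro conjI ballI impI)
    fix N assume N: "N \<in> S" "N > Suc N0"
    \<comment> \<open>aiming at least \<open>\<epsilon> / 2\<close> above the ground energy excludes the index \<open>0\<close>\<close>
    define s' where "s' = max s (\<epsilon> / 2)"
    have "s' \<in> {0..1}" using s c \<epsilon> by (auto simp: s'_def)
    then obtain x where x: "x \<in> set (eigs (HN N))" "\<bar>x - ground_energy (HN N) - s'\<bar> \<le> 1 / real (Suc k)"
      using N0[OF N(1)] N(2) unfolding dense_spectrum_def by fastforce
    obtain j where j: "j < length (eigs (HN N))" "eigs (HN N) ! j = x"
      using x(1) by (auto simp: in_set_conv_nth)
    have e0: "eigs (HN N) ! 0 = ground_energy (HN N)" using x(1) by (intro eigs_0) auto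
    have "s' \<ge> \<epsilon> / 2" "s' \<le> s + \<epsilon> / 2" using s \<epsilon> by (auto simp: s'_def)
    then have "x > ground_energy (HN N)" "\<bar>x - (ground_energy (HN N) + s)\<bar> \<le> \<epsilon>"
      using x(2) k \<epsilon> \<open>s' \<ge> \<epsilon> / 2\<close> by (auto simp: s'_def abs_le_iff max_def split: if_splits)
    then show "\<exists>j>0. j < length (eigs (HN N)) \<and> \<bar>eigs (HN N) ! j - (eigs (HN N) ! 0 + s)\<bar> \<le> \<epsilon>"
      using j e0 by (intro exI[of _ j]) (auto intro!: Nat.gr0I)
  qed simp
qed simp_all

lemma eventually_dense_imp_gapless:
  assumes "infinite S" and "\<And>k. \<exists>N\<^sub>0. \<forall>N\<in>S. N \<ge> N\<^sub>0 \<longrightarrow> dense_spectrum (1 / real (Suc k)) (HN N)"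
  shows "gapless S HN"
  unfolding gapless_def
proof (intro allI impI)
  fix \<epsilon> :: real assume "\<epsilon> > 0"
  \<comment> \<open>Capping at 1 keeps the target e / 2 in the window; tolerance e / 4 separates the
    eigenvalue found from the ground energy.\<close>
  define e where "e = min \<epsilon> 1"
  have e: "0 < e" "e \<le> 1" "e \<le> \<epsilon>" using \<open>\<epsilon> > 0\<close> by (auto simp: e_def)
  obtain k where k: "1 / real (Suc k) < e / 4" using nat_approx_posE[of "e / 4"] e by auto
  obtain N0 where N0: "\<And>N. N \<in> S \<Longrightarrow> N \<ge> N0 \<Longrightarrow> dense_spectrum (1 / real (Suc k)) (HN N)"
    using assms(2) by blast
  obtain N where N: "N \<in> S" "N > N0" using assms(1) by (meson infinite_nat_iff_unbounded)
  obtain x where x: "x \<in> set (eigs (HN N))" "\<bar>x - ground_energy (HN N) - e / 2\<bar> \<le> 1 / real (Suc k)"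
    using N0[OF N(1)] N(2) e unfolding dense_spectrum_def by fastforce
  have lt: "ground_energy (HN N) < x" "x \<le> ground_energy (HN N) + \<epsilon>"
    using x(2) k e by (auto simp: abs_le_iff)
  have gr: "ground_energy (HN N) \<in> set (eigs (HN N))"
    unfolding ground_energy_def using x(1) by (intro Min_in) auto
  have "card {ground_energy (HN N), x} \<le> card (set (eigs (HN N)))"
    using gr x(1) by (intro card_mono) auto
  then have "2 \<le> card (set (eigs (HN N)))" using lt(1) by simp
  moreover have "first_excited_energy (HN N) \<le> x"
    unfolding first_excited_energy_def using x(1) lt(1) by (intro Min_le) auto
  ultimately show "\<exists>N\<in>S. N > 0 \<and> card (set (eigs (HN N))) \<ge> 2 \<and>
      first_excited_energy (HN N) - ground_energy (HN N) \<le> \<epsilon>"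
    using N lt(2) by (intro bexI[of _ N]) auto
qed

subsection \<open>Events for a single local term\<close>

lemma near_scalar_eq_vimage:
  assumes "\<And>\<omega>. \<omega> \<in> space M \<Longrightarrow> hermitian_mat k (A \<omega>)" "\<epsilon> > 0"
  shows "near_scalar M A \<mu> \<epsilon> = (\<lambda>\<omega>. entries k (A \<omega>)) -` near_scalar_entries k \<mu> \<epsilon> \<inter> space M"
  using near_scalar_entries_iff[OF assms(1) assms(2)] by (auto simp: near_scalar_def)

lemma emeasure_eig_space_box:
  fixes a b :: real
  assumes "a \<le> b"
  shows "emeasure (eig_space k) (PiE {..<k} (\<lambda>_. {a..b})) = ennreal ((b - a) ^ k)"
proof -
  interpret product_sigma_finite "\<lambda>_::nat. lborel :: real measure" ..
  show ?thesis
    using assms by (subst emeasure_PiM) (auto simp: prod_ennreal ennreal_power)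
qed

text \<open>
  Eigenvalues within \<open>\<epsilon>\<close> of \<open>\<mu>\<close> which are within \<open>\<epsilon> / K\<close> of each other lie in one of
  \<open>2 K + 1\<close> cubes of side \<open>5 \<epsilon> / K\<close>, of total volume \<open>O(1 / K)\<close>.
\<close>
lemma diagonal_strip_small:
  fixes \<epsilon> \<delta>\<^sub>0 :: real
  assumes "k \<ge> 2" "\<epsilon> > 0" "\<delta>\<^sub>0 > 0"
  shows "\<exists>\<delta>>0. \<forall>\<mu>. \<exists>B\<in>sets (eig_space k). emeasure (eig_space k) B \<le> ennreal \<delta>\<^sub>0 \<and>
    (\<forall>v q. v \<in> space (eig_space k) \<longrightarrow> (\<forall>l<k. \<bar>v l - \<mu>\<bar> \<le> \<epsilon> \<and> \<bar>v l - q\<bar> \<le> \<delta>) \<longrightarrow> v \<in> B)"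
proof -
  \<comment> \<open>K > 5 \<epsilon> makes the cube side at most 1, so its k-th power is at most its
    square; with 2 K + 1 \<le> 3 K cubes the volume is at most 3 K (5 \<epsilon> / K)^2 = 75
    \<epsilon>^2 / K.\<close>
  obtain K :: nat where K: "max (max 1 (5 * \<epsilon>)) (75 * \<epsilon>\<^sup>2 / \<delta>\<^sub>0) < K"
    using reals_Archimedean2 by blast
  then have K1: "1 < real K" "5 * \<epsilon> < real K" "75 * \<epsilon>\<^sup>2 / \<delta>\<^sub>0 < real K" by auto
  define \<delta> where "\<delta> = \<epsilon> / K"
  have \<delta>: "\<delta> > 0" using assms K1 by (simp add: \<delta>_def)
  \<comment> \<open>The cell of length \<delta> containing coordinate 0 is enlarged by 2 \<delta> on
    each side, since two coordinates within \<delta> of a common q differ by at most 2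
    \<delta>.\<close>
  define Q where "Q \<mu> j = PiE {..<k} (\<lambda>_. {\<mu> - \<epsilon> + real j * \<delta> - 2 * \<delta> .. \<mu> - \<epsilon> + real j * \<delta> + 3 * \<delta>})" for \<mu> j
  have Q[measurable]: "Q \<mu> j \<in> sets (eig_space k)" for \<mu> j
    unfolding Q_def by (intro sets_PiM_I_finite) auto
  have "emeasure (eig_space k) (\<Union>j\<le>2 * K. Q \<mu> j) \<le> ennreal \<delta>\<^sub>0" for \<mu>
  proof -
    have "emeasure (eig_space k) (\<Union>j\<le>2 * K. Q \<mu> j) \<le> (\<Sum>j\<le>2 * K. emeasure (eig_space k) (Q \<mu> j))"
      by (intro emeasure_subadditive_finite) auto
    also have "\<dots> = (\<Sum>j\<le>2 * K. ennreal ((5 * \<delta>) ^ k))"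
      unfolding Q_def using \<delta> by (intro sum.cong refl, subst emeasure_eig_space_box) auto
    also have "\<dots> = ennreal ((2 * real K + 1) * (5 * \<delta>) ^ k)"
      using \<delta> by (subst sum_ennreal) (auto simp: algebra_simps)
    also have "\<dots> \<le> ennreal \<delta>\<^sub>0"
    proof (rule ennreal_leI)
      have "5 * \<delta> \<le> 1" using K1 by (simp add: \<delta>_def)
      then have "(5 * \<delta>) ^ k \<le> (5 * \<delta>)\<^sup>2" using \<delta> assms(1) by (intro power_decreasing) auto
      then have "(2 * real K + 1) * (5 * \<delta>) ^ k \<le> (3 * real K) * (5 * \<delta>)\<^sup>2"
        using K1 \<delta> by (intro mult_mono) auto
      also have "\<dots> = 75 * \<epsilon>\<^sup>2 / real K" using K1 by (simp add: \<delta>_def power2_eq_square)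
      also have "\<dots> \<le> \<delta>\<^sub>0" using K1 assms by (simp add: field_simps)
      finally show "(2 * real K + 1) * (5 * \<delta>) ^ k \<le> \<delta>\<^sub>0" .
    qed
    finally show ?thesis .
  qed
  moreover have "v \<in> (\<Union>j\<le>2 * K. Q \<mu> j)"
    if v: "v \<in> space (eig_space k)" and near: "\<forall>l<k. \<bar>v l - \<mu>\<bar> \<le> \<epsilon> \<and> \<bar>v l - q\<bar> \<le> \<delta>" for v q \<mu>
  proof -
    have n0: "\<bar>v 0 - \<mu>\<bar> \<le> \<epsilon>" "\<bar>v 0 - q\<bar> \<le> \<delta>" using near assms(1) by auto
    define t where "t = (v 0 - (\<mu> - \<epsilon>)) / \<delta>"
    define j where "j = nat \<lfloor>t\<rfloor>"
    have t0: "t \<ge> 0" using n0 \<delta> by (simp add: t_def)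
    have "t \<le> 2 * \<epsilon> / \<delta>" unfolding t_def using n0 \<delta> by (intro divide_right_mono) auto
    also have "\<dots> = real (2 * K)" using assms K1 by (simp add: \<delta>_def)
    finally have j2: "j \<le> 2 * K" unfolding j_def using t0 by linarith
    have "real j \<le> t" "t < real j + 1" unfolding j_def using t0 by linarith+
    then have j: "real j * \<delta> \<le> v 0 - (\<mu> - \<epsilon>)" "v 0 - (\<mu> - \<epsilon>) < real j * \<delta> + \<delta>"
      using \<delta> by (auto simp: t_def field_simps)
    have "v l \<in> {\<mu> - \<epsilon> + real j * \<delta> - 2 * \<delta> .. \<mu> - \<epsilon> + real j * \<delta> + 3 * \<delta>}" if "l < k" for l
    proof -
      have "\<bar>v l - q\<bar> \<le> \<delta>" using near that by blast
      then show ?thesis using n0(2) j unfolding atLeastAtMost_iff by linarith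
    qed
    then have "v \<in> Q \<mu> j" using v unfolding Q_def by (auto simp: space_PiM PiE_def)
    then show ?thesis using j2 by blast
  qed
  ultimately show ?thesis
    using \<delta> by (intro exI[of _ \<delta>] conjI allI bexI[of _ "\<Union>j\<le>2 * K. Q _ j"]) auto
qed

text \<open>A spread of at most \<delta> leaves room for a rational number within \<delta> of all
  eigenvalues. Small spread is thus covered by countably many near-scalar conditions, which are
  measurable in the entries.\<close>

lemma spread_gt_if_not_near_rational:
  assumes "set (eigs A) \<noteq> {}" "\<delta> > 0" "\<And>q. q \<in> \<rat> \<Longrightarrow> \<exists>x\<in>set (eigs A). \<not> \<bar>x - q\<bar> \<le> \<delta>"
  shows "\<delta> < spread A"
proof (rule ccontr)
  assume "\<not> ?thesis"
  then have "Max (set (eigs A)) - \<delta> < Min (set (eigs A)) + \<delta>" using assms(2) by (simp add: spread_def)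
  then obtain q where q: "q \<in> \<rat>" "Max (set (eigs A)) - \<delta> < q" "q < Min (set (eigs A)) + \<delta>"
    using Rats_dense_in_real by blast
  obtain x where x: "x \<in> set (eigs A)" "\<not> \<bar>x - q\<bar> \<le> \<delta>" using assms(3)[OF q(1)] by blast
  have "x \<le> Max (set (eigs A))" "Min (set (eigs A)) \<le> x" using x(1) by auto
  then show False using q x(2) by linarith
qed

lemma spread_le_if_near:
  assumes "set (eigs A) \<noteq> {}" "\<And>x. x \<in> set (eigs A) \<Longrightarrow> \<bar>x - \<mu>\<bar> \<le> \<epsilon>"
  shows "spread A \<le> 2 * \<epsilon>"
proof -
  have "Max (set (eigs A)) \<in> set (eigs A)" "Min (set (eigs A)) \<in> set (eigs A)" using assms(1) by auto
  then show ?thesis using assms(2)[of "Max (set (eigs A))"] assms(2)[of "Min (set (eigs A))"]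
    unfolding spread_def by linarith
qed

lemma (in prob_space) uniform_near_scalar:
  assumes "uniform_laws M k I A"
    and herm: "\<And>i \<omega>. i \<in> I \<Longrightarrow> \<omega> \<in> space M \<Longrightarrow> hermitian_mat k (A i \<omega>)" and "\<epsilon> > 0"
  shows "\<exists>p>0. p \<le> 1 \<and> (\<forall>i\<in>I. \<exists>\<mu>. p \<le> prob ((\<lambda>\<omega>. entries k (A i \<omega>)) -` near_scalar_entries k \<mu> \<epsilon> \<inter> space M))"
proof -
  obtain p where p: "p > 0" "\<And>i. i \<in> I \<Longrightarrow> \<exists>\<mu>. measure M (near_scalar M (A i) \<mu> \<epsilon>) \<ge> p"
    using assms(1) \<open>\<epsilon> > 0\<close> unfolding uniform_laws_def by blast
  have "\<exists>\<mu>. min p 1 \<le> prob ((\<lambda>\<omega>. entries k (A i \<omega>)) -` near_scalar_entries k \<mu> \<epsilon> \<inter> space M)" if i: "i \<in> I" for i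
  proof -
    obtain \<mu> where "measure M (near_scalar M (A i) \<mu> \<epsilon>) \<ge> p" using p(2)[OF i] by blast
    moreover have "near_scalar M (A i) \<mu> \<epsilon> =
        (\<lambda>\<omega>. entries k (A i \<omega>)) -` near_scalar_entries k \<mu> \<epsilon> \<inter> space M"
      by (rule near_scalar_eq_vimage[OF herm[OF i] \<open>\<epsilon> > 0\<close>])
    ultimately have "min p 1 \<le> prob ((\<lambda>\<omega>. entries k (A i \<omega>)) -` near_scalar_entries k \<mu> \<epsilon> \<inter> space M)"
      by (metis min.coboundedI1)
    then show ?thesis ..
  qed
  then show ?thesis using p(1) by (intro exI[of _ "min p 1"]) auto
qed

text \<open>Being within \<epsilon> of a scalar has probability at least p. Within that event, small
  spread puts the eigenvalues in a thin neighbourhood of the diagonal, of probability at most p / 2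
  by uniform absolute continuity; the other half remains.\<close>

lemma (in prob_space) uniform_spread:
  assumes unif: "uniform_laws M k I A" and "k \<ge> 2" "\<epsilon> > 0"
    and herm: "\<And>i \<omega>. i \<in> I \<Longrightarrow> \<omega> \<in> space M \<Longrightarrow> hermitian_mat k (A i \<omega>)"
    and cont: "\<And>i. i \<in> I \<Longrightarrow> continuous_eig_distribution M k (A i)"
    and meas: "\<And>i. i \<in> I \<Longrightarrow> (\<lambda>\<omega>. entries k (A i \<omega>)) \<in> measurable M (matrix_space k)"
  shows "\<exists>p>0. p \<le> 1 \<and> (\<exists>\<delta>>0. \<forall>i\<in>I. \<exists>Y\<in>sets (matrix_space k).
    p \<le> prob ((\<lambda>\<omega>. entries k (A i \<omega>)) -` Y \<inter> space M) \<and>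
    (\<forall>\<omega>\<in>space M. entries k (A i \<omega>) \<in> Y \<longrightarrow> \<delta> \<le> spread (A i \<omega>) \<and> spread (A i \<omega>) \<le> 2 * \<epsilon>))"
proof -
  let ?X = "\<lambda>i \<omega>. entries k (A i \<omega>)"
  obtain p where p: "p > 0" "p \<le> 1"
      "\<And>i. i \<in> I \<Longrightarrow> \<exists>\<mu>. p \<le> prob (?X i -` near_scalar_entries k \<mu> \<epsilon> \<inter> space M)"
    using uniform_near_scalar[OF unif herm \<open>\<epsilon> > 0\<close>] by blast
  have p2: "p / 2 > 0" using p(1) by simp
  from unif[unfolded uniform_laws_def, THEN conjunct2, THEN spec, THEN mp, OF p2]
  obtain \<delta>\<^sub>0 where \<delta>0: "\<delta>\<^sub>0 > 0" and "\<forall>i\<in>I. \<forall>B\<in>sets (eig_space k). emeasure (eig_space k) B \<le> ennreal \<delta>\<^sub>0 \<longrightarrow>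
      prob {\<omega> \<in> space M. eig_vec k (A i \<omega>) \<in> B} \<le> p / 2"
    by (elim exE conjE)
  note small = this(2)[rule_format]
  obtain \<delta> where \<delta>: "\<delta> > 0" "\<And>\<mu>. \<exists>B\<in>sets (eig_space k). emeasure (eig_space k) B \<le> ennreal \<delta>\<^sub>0 \<and>
      (\<forall>v q. v \<in> space (eig_space k) \<longrightarrow> (\<forall>l<k. \<bar>v l - \<mu>\<bar> \<le> \<epsilon> \<and> \<bar>v l - q\<bar> \<le> \<delta>) \<longrightarrow> v \<in> B)"
    using diagonal_strip_small[OF \<open>k \<ge> 2\<close> \<open>\<epsilon> > 0\<close> \<delta>0] by (elim exE conjE) (erule_tac that, blast)
  have "\<exists>Y\<in>sets (matrix_space k). p / 2 \<le> prob (?X i -` Y \<inter> space M) \<and>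
    (\<forall>\<omega>\<in>space M. ?X i \<omega> \<in> Y \<longrightarrow> \<delta> \<le> spread (A i \<omega>) \<and> spread (A i \<omega>) \<le> 2 * \<epsilon>)" if i: "i \<in> I" for i
  proof -
    obtain \<mu> where \<mu>: "p \<le> prob (?X i -` near_scalar_entries k \<mu> \<epsilon> \<inter> space M)" using p(3)[OF i] by blast
    obtain B where B: "B \<in> sets (eig_space k)" "emeasure (eig_space k) B \<le> ennreal \<delta>\<^sub>0"
        "\<And>v q. v \<in> space (eig_space k) \<Longrightarrow> (\<And>l. l < k \<Longrightarrow> \<bar>v l - \<mu>\<bar> \<le> \<epsilon> \<and> \<bar>v l - q\<bar> \<le> \<delta>) \<Longrightarrow> v \<in> B"
      using \<delta>(2)[of \<mu>] by blast
    have len: "length (eigs (A i \<omega>)) = k" if "\<omega> \<in> space M" for \<omega>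
      using herm[OF i that] by (intro length_eigs) (simp add: hermitian_mat_def)
    have ev: "(\<lambda>\<omega>. eig_vec k (A i \<omega>)) \<in> measurable M (eig_space k)"
      using cont[OF i] by (auto simp: continuous_eig_distribution_def distributed_def)
    define G where "G = near_scalar_entries k \<mu> \<epsilon>"
    define R where "R = (\<Union>q\<in>\<rat>. near_scalar_entries k q \<delta>)"
    have G: "G \<in> sets (matrix_space k)" by (simp add: G_def sets_near_scalar_entries)
    have R: "R \<in> sets (matrix_space k)"
      unfolding R_def by (intro sets.countable_UN' countable_rat) (auto simp: sets_near_scalar_entries)
    \<comment> \<open>An event in the entries is bounded by one in the ordered eigenvalues;
      inclusion suffices to carry the estimate over.\<close>
    have "?X i -` (G \<inter> R) \<inter> space M \<subseteq> {\<omega> \<in> space M. eig_vec k (A i \<omega>) \<in> B}"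
    proof
      fix \<omega> assume \<omega>: "\<omega> \<in> ?X i -` (G \<inter> R) \<inter> space M"
      then have sp: "\<omega> \<in> space M" by simp
      obtain q where q: "q \<in> \<rat>" "?X i \<omega> \<in> near_scalar_entries k q \<delta>" using \<omega> by (auto simp: R_def)
      have "?X i \<omega> \<in> near_scalar_entries k \<mu> \<epsilon>" using \<omega> by (simp add: G_def)
      then have "\<bar>x - \<mu>\<bar> \<le> \<epsilon> \<and> \<bar>x - q\<bar> \<le> \<delta>" if "x \<in> set (eigs (A i \<omega>))" for x
        using q that near_scalar_entries_iff[OF herm[OF i sp]] \<delta>(1) \<open>\<epsilon> > 0\<close> by blast
      then have "\<bar>eig_vec k (A i \<omega>) l - \<mu>\<bar> \<le> \<epsilon> \<and> \<bar>eig_vec k (A i \<omega>) l - q\<bar> \<le> \<delta>" if "l < k" for l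
        using that len[OF sp] by (simp add: eig_vec_def)
      moreover have "eig_vec k (A i \<omega>) \<in> space (eig_space k)"
        using measurable_space[OF ev sp] .
      ultimately show "\<omega> \<in> {\<omega> \<in> space M. eig_vec k (A i \<omega>) \<in> B}" using B(3) sp by blast
    qed
    moreover have "{\<omega> \<in> space M. eig_vec k (A i \<omega>) \<in> B} \<in> sets M"
      using measurable_sets[OF ev B(1)] by (simp add: vimage_def Int_def conj_commute)
    ultimately have "prob (?X i -` (G \<inter> R) \<inter> space M) \<le> prob {\<omega> \<in> space M. eig_vec k (A i \<omega>) \<in> B}"
      by (rule finite_measure_mono)
    also have "\<dots> \<le> p / 2" by (rule small[OF i B(1,2)])
    finally have GR: "prob (?X i -` (G \<inter> R) \<inter> space M) \<le> p / 2" .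
    have s: "?X i -` (G - R) \<inter> space M \<in> sets M" "?X i -` (G \<inter> R) \<inter> space M \<in> sets M"
      using G R by (blast intro: measurable_sets[OF meas[OF i]])+
    have "?X i -` G \<inter> space M = (?X i -` (G - R) \<inter> space M) \<union> (?X i -` (G \<inter> R) \<inter> space M)" by auto
    then have "prob (?X i -` G \<inter> space M) = prob (?X i -` (G - R) \<inter> space M) + prob (?X i -` (G \<inter> R) \<inter> space M)"
      using s by (simp only:) (rule finite_measure_Union, auto)
    then have "p / 2 \<le> prob (?X i -` (G - R) \<inter> space M)" using \<mu> GR by (simp add: G_def)
    moreover have "\<delta> \<le> spread (A i \<omega>) \<and> spread (A i \<omega>) \<le> 2 * \<epsilon>" if sp: "\<omega> \<in> space M" and "?X i \<omega> \<in> G - R" for \<omega>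
    proof
      have ne: "set (eigs (A i \<omega>)) \<noteq> {}" using len[OF sp] \<open>k \<ge> 2\<close> by auto
      note iff = near_scalar_entries_iff[OF herm[OF i sp]]
      have "\<exists>x\<in>set (eigs (A i \<omega>)). \<not> \<bar>x - q\<bar> \<le> \<delta>" if "q \<in> \<rat>" for q
        using \<open>?X i \<omega> \<in> G - R\<close> that iff[OF \<delta>(1)] by (auto simp: R_def)
      then show "\<delta> \<le> spread (A i \<omega>)" using spread_gt_if_not_near_rational[OF ne \<delta>(1)] by force
      show "spread (A i \<omega>) \<le> 2 * \<epsilon>"
        using \<open>?X i \<omega> \<in> G - R\<close> iff[OF \<open>\<epsilon> > 0\<close>, of \<mu>] by (intro spread_le_if_near[OF ne, of \<mu>]) (auto simp: G_def)
    qed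
    ultimately show ?thesis using G R by (intro bexI[of _ "G - R"]) auto
  qed
  then show ?thesis using p(1,2) \<delta>(1) by (intro exI[of _ "p / 2"]) auto
qed

subsection \<open>Independent regions\<close>

text \<open>A conflict-free set of maximal size works: no element of E can be added, so its conflict
  neighbourhoods, each of size at most C, cover E.\<close>

lemma independent_subset:
  fixes conflict :: "'a \<Rightarrow> 'a \<Rightarrow> bool"
  assumes "finite E" and "\<And>l. l \<in> E \<Longrightarrow> conflict l l" and "\<And>l m. conflict l m \<Longrightarrow> conflict m l"
    and C: "\<And>l. l \<in> E \<Longrightarrow> card {m \<in> E. conflict l m} \<le> C"
  shows "\<exists>\<Lambda>\<subseteq>E. (\<forall>l\<in>\<Lambda>. \<forall>m\<in>\<Lambda>. l \<noteq> m \<longrightarrow> \<not> conflict l m) \<and> card E \<le> C * card \<Lambda>"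
proof -
  define P where "P \<Lambda> \<longleftrightarrow> \<Lambda> \<subseteq> E \<and> (\<forall>l\<in>\<Lambda>. \<forall>m\<in>\<Lambda>. l \<noteq> m \<longrightarrow> \<not> conflict l m)" for \<Lambda>
  have "P {}" by (simp add: P_def)
  moreover have "\<forall>\<Lambda>. P \<Lambda> \<longrightarrow> card \<Lambda> < Suc (card E)"
    using assms(1) by (auto simp: P_def less_Suc_eq_le intro: card_mono)
  ultimately obtain \<Lambda> where \<Lambda>: "P \<Lambda>" "\<And>\<Lambda>'. P \<Lambda>' \<Longrightarrow> card \<Lambda>' \<le> card \<Lambda>"
    using ex_has_greatest_nat[of P "{}" card "Suc (card E)"] by blast
  have fin: "finite \<Lambda>" using \<Lambda>(1) assms(1) finite_subset by (auto simp: P_def)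
  have "E \<subseteq> (\<Union>l\<in>\<Lambda>. {m \<in> E. conflict l m})"
  proof
    fix m assume m: "m \<in> E"
    show "m \<in> (\<Union>l\<in>\<Lambda>. {m \<in> E. conflict l m})"
    proof (rule ccontr)
      assume "m \<notin> (\<Union>l\<in>\<Lambda>. {m \<in> E. conflict l m})"
      then have no: "\<And>l. l \<in> \<Lambda> \<Longrightarrow> \<not> conflict l m" using m by auto
      then have "P (insert m \<Lambda>)" using \<Lambda>(1) m assms(3) unfolding P_def by blast
      moreover have "m \<notin> \<Lambda>" using no assms(2)[OF m] by auto
      ultimately show False using \<Lambda>(2)[of "insert m \<Lambda>"] fin by simp
    qed
  qed
  then have "card E \<le> card (\<Union>l\<in>\<Lambda>. {m \<in> E. conflict l m})"
    using fin assms(1) by (intro card_mono) auto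
  also have "\<dots> \<le> (\<Sum>l\<in>\<Lambda>. card {m \<in> E. conflict l m})" by (rule card_UN_le[OF fin])
  also have "\<dots> \<le> (\<Sum>l\<in>\<Lambda>. C)" using \<Lambda>(1) by (intro sum_mono C) (auto simp: P_def)
  finally show ?thesis using \<Lambda>(1) by (auto simp: P_def mult.commute)
qed

text \<open>Asking for one success in each of m blocks guarantees m successes and replaces the
  estimate of a binomial tail by a union bound.\<close>

lemma disjoint_blocks:
  assumes "finite \<Lambda>" "m * K \<le> card \<Lambda>"
  shows "\<exists>B. (\<forall>b<m. B b \<subseteq> \<Lambda> \<and> card (B b) = K) \<and> (\<forall>b<m. \<forall>c<m. b \<noteq> c \<longrightarrow> B b \<inter> B c = {})"
proof -
  obtain g where g: "bij_betw g {0..<card \<Lambda>} \<Lambda>" using ex_bij_betw_nat_finite[OF assms(1)] by blast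
  define I where "I b = {b * K..<Suc b * K}" for b
  have I: "I b \<subseteq> {0..<card \<Lambda>}" if "b < m" for b
  proof -
    have "Suc b * K \<le> m * K" using that by (intro mult_right_mono) auto
    then show ?thesis using assms(2) by (auto simp: I_def)
  qed
  have inj: "inj_on g {0..<card \<Lambda>}" using g by (rule bij_betw_imp_inj_on)
  have "card (g ` I b) = K" if "b < m" for b
    using card_image[OF inj_on_subset[OF inj I[OF that]]] by (simp add: I_def)
  moreover have "g ` I b \<subseteq> \<Lambda>" if "b < m" for b
    using I[OF that] g by (auto simp: bij_betw_def)
  moreover have "g ` I b \<inter> g ` I c = {}" if "b < m" "c < m" "b \<noteq> c" for b c
  proof -
    have disj: "I b \<inter> I c = {}" if "b < c" for b c
    proof -
      have "Suc b * K \<le> c * K" using that by (intro mult_right_mono) auto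
      then show ?thesis by (auto simp: I_def)
    qed
    have "I b \<inter> I c = {}" using disj[of b c] disj[of c b] that(3) by (cases b c rule: linorder_cases) auto
    then show ?thesis using inj_on_image_Int[OF inj I[OF that(1)] I[OF that(2)]] by simp
  qed
  ultimately show ?thesis by (intro exI[of _ "\<lambda>b. g ` I b"]) auto
qed

lemma card_touches_le:
  assumes "finite E" "simple_graph n E" "\<And>v. v < n \<Longrightarrow> degree_at E v \<le> \<Delta>" "l \<in> E"
  shows "card {f \<in> E. touches l f} \<le> 2 * \<Delta>"
proof -
  have v: "fst l < n" "snd l < n" using simple_graphD[OF assms(2,4)] by auto
  let ?S = "\<lambda>v. {(i, j) \<in> E. i = v \<or> j = v}"
  have "{f \<in> E. touches l f} \<subseteq> ?S (fst l) \<union> ?S (snd l)" by (auto simp: touches_def)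
  moreover have "finite (?S v)" for v by (rule finite_subset[OF _ assms(1)]) auto
  ultimately have "card {f \<in> E. touches l f} \<le> card (?S (fst l) \<union> ?S (snd l))" by (intro card_mono) auto
  also have "\<dots> \<le> card (?S (fst l)) + card (?S (snd l))" by (rule card_Un_le)
  also have "\<dots> \<le> 2 * \<Delta>" using assms(3)[OF v(1)] assms(3)[OF v(2)] by (simp add: degree_at_def)
  finally show ?thesis .
qed

lemma touches_sym: "touches l m \<longleftrightarrow> touches m l"
  by (auto simp: touches_def)

lemma touches_refl: "touches l l"
  by (simp add: touches_def)

text \<open>Grouping the independent terms by disjoint regions gives independent families, so the
  failures of the regions multiply; within a region independence is used once more for the success
  probability.\<close>

lemma (in prob_space) prob_no_region_le:
  assumes ind: "indep_vars (\<lambda>_. N) X E" and B: "finite B" "\<And>l. l \<in> B \<Longrightarrow> R l \<subseteq> E" "disjoint_family_on R B"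
    and R: "\<And>l. l \<in> B \<Longrightarrow> finite (R l) \<and> R l \<noteq> {}"
    and Y: "\<And>l f. l \<in> B \<Longrightarrow> f \<in> R l \<Longrightarrow> Y l f \<in> sets N"
    and q: "\<And>l. l \<in> B \<Longrightarrow> q \<le> (\<Prod>f\<in>R l. prob (X f -` Y l f \<inter> space M))" and "q \<le> 1"
  shows "prob {\<omega> \<in> space M. \<forall>l\<in>B. \<exists>f\<in>R l. X f \<omega> \<notin> Y l f} \<le> (1 - q) ^ card B"
    and "{\<omega> \<in> space M. \<forall>l\<in>B. \<exists>f\<in>R l. X f \<omega> \<notin> Y l f} \<in> events"
proof -
  have X: "X f \<in> measurable M N" if "f \<in> E" for f using ind that by (auto simp: indep_vars_def)
  have sX: "X f -` Y l f \<inter> space M \<in> events" if "l \<in> B" "f \<in> R l" for l f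
    using measurable_sets[OF X Y] B(2) that by blast
  define G where "G l = (\<Inter>f\<in>R l. X f -` Y l f \<inter> space M)" for l
  have G: "G l \<in> events" if "l \<in> B" for l
    unfolding G_def using R[OF that] sX[OF that] by (intro sets.finite_INT) auto
  have eq: "{\<omega> \<in> space M. \<forall>l\<in>B. \<exists>f\<in>R l. X f \<omega> \<notin> Y l f} = space M - (\<Union>l\<in>B. G l)"
    using R by (auto simp: G_def)
  then show "{\<omega> \<in> space M. \<forall>l\<in>B. \<exists>f\<in>R l. X f \<omega> \<notin> Y l f} \<in> events"
    using G B(1) by (auto intro!: sets.finite_UN)
  show "prob {\<omega> \<in> space M. \<forall>l\<in>B. \<exists>f\<in>R l. X f \<omega> \<notin> Y l f} \<le> (1 - q) ^ card B"
  \<comment> \<open>The product formula for intersections requires a nonempty index set; for empty B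
    the bound is 1.\<close>
  proof (cases "B = {}")
    case False
    let ?Z = "\<lambda>l \<omega>. restrict (\<lambda>f. X f \<omega>) (R l)"
    have Z: "indep_vars (\<lambda>l. PiM (R l) (\<lambda>_. N)) ?Z B"
      using ind B(2,3) by (rule indep_vars_restrict)
    define Q where "Q l = space (PiM (R l) (\<lambda>_. N)) - PiE (R l) (Y l)" for l
    have Q: "Q l \<in> sets (PiM (R l) (\<lambda>_. N))" if "l \<in> B" for l
      unfolding Q_def using Y[OF that] R[OF that] by (intro sets.compl_sets sets_PiM_I_finite) auto
    have pre: "?Z l -` Q l \<inter> space M = space M - G l" if l: "l \<in> B" for l
    proof -
      have "?Z l \<omega> \<in> space (PiM (R l) (\<lambda>_. N))" if "\<omega> \<in> space M" for \<omega>
        using measurable_space[OF X that] B(2)[OF l] by (auto simp: space_PiM)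
      moreover have "?Z l \<omega> \<in> PiE (R l) (Y l) \<longleftrightarrow> (\<forall>f\<in>R l. X f \<omega> \<in> Y l f)" for \<omega>
        by (auto simp: PiE_iff)
      ultimately show ?thesis using R[OF l] by (auto simp: Q_def G_def)
    qed
    have "prob (\<Inter>l\<in>B. ?Z l -` Q l \<inter> space M) = (\<Prod>l\<in>B. prob (?Z l -` Q l \<inter> space M))"
      using Z False B(1) Q by (intro indep_varsD[OF Z]) auto
    also have "\<dots> = (\<Prod>l\<in>B. prob (space M - G l))" by (intro prod.cong) (auto simp: pre)
    also have "\<dots> \<le> (\<Prod>l\<in>B. 1 - q)"
    proof (intro prod_mono conjI)
      fix l assume l: "l \<in> B"
      have "prob (G l) = (\<Prod>f\<in>R l. prob (X f -` Y l f \<inter> space M))"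
        unfolding G_def using R[OF l] B(2)[OF l] Y[OF l] by (intro indep_varsD[OF ind]) auto
      then show "prob (space M - G l) \<le> 1 - q" using q[OF l] prob_compl[OF G[OF l]] by simp
    qed simp
    finally have "prob (\<Inter>l\<in>B. ?Z l -` Q l \<inter> space M) \<le> (\<Prod>l\<in>B. 1 - q)" .
    moreover have "(\<Inter>l\<in>B. ?Z l -` Q l \<inter> space M) = (\<Inter>l\<in>B. space M - G l)"
      using pre by simp
    moreover have "(\<Inter>l\<in>B. space M - G l) = space M - (\<Union>l\<in>B. G l)" using False by blast
    ultimately show ?thesis unfolding eq by simp
  qed simp
qed

section \<open>Probability that the spectrum fails to be dense\<close>

text \<open>Failure is covered by a measurable \<open>Bad\<close>, so measurability of density of
  the spectrum itself is never at issue. The size (2 \<Delta>)^2 bounds the conflicts of a region: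
  at most 2 \<Delta> bonds, each touching at most 2 \<Delta> bonds.\<close>

lemma (in prob_space) spectrum_not_dense_event:
  fixes h :: "nat \<times> nat \<Rightarrow> 'a \<Rightarrow> complex mat" and d :: nat
  defines "X \<equiv> \<lambda>e \<omega>. entries (d\<^sup>2) (h e \<omega>)"
  assumes d: "d \<ge> 2" and g: "simple_graph n E" and fin: "finite E"
    and deg: "\<And>v. v < n \<Longrightarrow> degree_at E v \<le> \<Delta>"
    and herm: "\<And>e \<omega>. e \<in> E \<Longrightarrow> \<omega> \<in> space M \<Longrightarrow> hermitian_mat (d\<^sup>2) (h e \<omega>)"
    and ind: "indep_vars (\<lambda>_. matrix_space (d\<^sup>2)) X E"
    and p1: "0 \<le> p\<^sub>1" "p\<^sub>1 \<le> 1" "\<And>e. e \<in> E \<Longrightarrow> \<exists>Y\<in>sets (matrix_space (d\<^sup>2)). p\<^sub>1 \<le> prob (X e -` Y \<inter> space M) \<and>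
      (\<forall>\<omega>\<in>space M. X e \<omega> \<in> Y \<longrightarrow> \<delta> \<le> spread (h e \<omega>) \<and> spread (h e \<omega>) \<le> 2 * \<epsilon>)"
    and p2: "0 \<le> p\<^sub>2" "p\<^sub>2 \<le> 1" "\<And>e. e \<in> E \<Longrightarrow> \<exists>\<mu>. p\<^sub>2 \<le> prob (X e -` near_scalar_entries (d\<^sup>2) \<mu> \<eta> \<inter> space M)"
    and "\<epsilon> > 0" "\<eta> > 0" and m: "1 \<le> real m * \<delta>" "real m * (2 * real \<Delta>) * \<eta> \<le> \<epsilon>"
  shows "\<exists>Bad\<in>events. prob Bad \<le> real m * (1 - p\<^sub>1 * p\<^sub>2 ^ (2 * \<Delta>)) ^ (card E div ((2 * \<Delta>)\<^sup>2 * m)) \<and>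
    (\<forall>\<omega>\<in>space M - Bad. dense_spectrum (4 * \<epsilon>) (hamiltonian d n E (\<lambda>e. h e \<omega>)))"
proof -
  define R where "R l = {f \<in> E. touches l f}" for l
  have R: "finite (R l)" "R l \<subseteq> E" "l \<in> E \<Longrightarrow> l \<in> R l" "l \<in> E \<Longrightarrow> card (R l) \<le> 2 * \<Delta>" for l
    using fin card_touches_le[OF fin g deg] by (auto simp: R_def touches_refl)
  define conflict where "conflict l m \<longleftrightarrow> R l \<inter> R m \<noteq> {}" for l m
  obtain Y\<^sub>1 where Y1: "\<And>e. e \<in> E \<Longrightarrow> Y\<^sub>1 e \<in> sets (matrix_space (d\<^sup>2)) \<and> p\<^sub>1 \<le> prob (X e -` Y\<^sub>1 e \<inter> space M) \<and>
      (\<forall>\<omega>\<in>space M. X e \<omega> \<in> Y\<^sub>1 e \<longrightarrow> \<delta> \<le> spread (h e \<omega>) \<and> spread (h e \<omega>) \<le> 2 * \<epsilon>)"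
    using p1(3) by metis
  obtain \<mu> where \<mu>: "\<And>e. e \<in> E \<Longrightarrow> p\<^sub>2 \<le> prob (X e -` near_scalar_entries (d\<^sup>2) (\<mu> e) \<eta> \<inter> space M)"
    using p2(3) by metis
  define Y where "Y l f = (if f = l then Y\<^sub>1 f else near_scalar_entries (d\<^sup>2) (\<mu> f) \<eta>)" for l f
  have "\<exists>\<Lambda>\<subseteq>E. (\<forall>l\<in>\<Lambda>. \<forall>m\<in>\<Lambda>. l \<noteq> m \<longrightarrow> \<not> conflict l m) \<and> card E \<le> (2 * \<Delta>)\<^sup>2 * card \<Lambda>"
  proof (rule independent_subset[OF fin])
    fix l assume l: "l \<in> E"
    show "conflict l l" using R(3)[OF l] by (auto simp: conflict_def)
    have "{m \<in> E. conflict l m} \<subseteq> (\<Union>f\<in>R l. R f)"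
      by (auto simp: conflict_def R_def touches_sym)
    then have "card {m \<in> E. conflict l m} \<le> card (\<Union>f\<in>R l. R f)" using R(1) by (intro card_mono) auto
    also have "\<dots> \<le> (\<Sum>f\<in>R l. card (R f))" by (rule card_UN_le[OF R(1)])
    also have "\<dots> \<le> (\<Sum>f\<in>R l. 2 * \<Delta>)" by (intro sum_mono R(4)) (use R(2) in blast)
    also have "\<dots> \<le> 2 * \<Delta> * (2 * \<Delta>)" using R(4)[OF l] by simp
    finally show "card {m \<in> E. conflict l m} \<le> (2 * \<Delta>)\<^sup>2" by (simp add: power2_eq_square)
  qed (auto simp: conflict_def)
  then obtain \<Lambda>\<^sub>0 where L0: "\<Lambda>\<^sub>0 \<subseteq> E \<and> (\<forall>l\<in>\<Lambda>\<^sub>0. \<forall>m\<in>\<Lambda>\<^sub>0. l \<noteq> m \<longrightarrow> \<not> conflict l m) \<and>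
      card E \<le> (2 * \<Delta>)\<^sup>2 * card \<Lambda>\<^sub>0" ..
  have \<Lambda>0: "\<Lambda>\<^sub>0 \<subseteq> E" "card E \<le> (2 * \<Delta>)\<^sup>2 * card \<Lambda>\<^sub>0" using L0 by blast+
  have disjoint: "R l \<inter> R m = {}" if "l \<in> \<Lambda>\<^sub>0" "m \<in> \<Lambda>\<^sub>0" "l \<noteq> m" for l m
    using L0 that unfolding conflict_def by blast
  have fin0: "finite \<Lambda>\<^sub>0" using \<Lambda>0(1) fin finite_subset by blast
  define K where "K = card E div ((2 * \<Delta>)\<^sup>2 * m)"
  have "m * K \<le> card \<Lambda>\<^sub>0"
  \<comment> \<open>For \<Delta> = 0 the divisor is 0, hence K = 0 by the convention for
    \<open>div\<close>.\<close>
  proof (cases "\<Delta> = 0")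
    case False
    have "(2 * \<Delta>)\<^sup>2 * (m * K) = K * ((2 * \<Delta>)\<^sup>2 * m)" by (simp only: mult_ac)
    also have "\<dots> \<le> card E" unfolding K_def by (rule div_times_less_eq_dividend)
    finally have "(2 * \<Delta>)\<^sup>2 * (m * K) \<le> (2 * \<Delta>)\<^sup>2 * card \<Lambda>\<^sub>0" using \<Lambda>0(2) by (rule order_trans)
    moreover have "0 < (2 * \<Delta>)\<^sup>2" using False by simp
    ultimately show ?thesis by (simp only: mult_le_cancel1)
  qed (simp add: K_def)
  then obtain B where B: "\<And>b. b < m \<Longrightarrow> B b \<subseteq> \<Lambda>\<^sub>0 \<and> card (B b) = K"
      "\<And>b c. b < m \<Longrightarrow> c < m \<Longrightarrow> b \<noteq> c \<Longrightarrow> B b \<inter> B c = {}"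
    using disjoint_blocks[OF fin0, of m K] by blast
  define bad where "bad b = {\<omega> \<in> space M. \<forall>l\<in>B b. \<exists>f\<in>R l. X f \<omega> \<notin> Y l f}" for b
  have q: "p\<^sub>1 * p\<^sub>2 ^ (2 * \<Delta>) \<le> (\<Prod>f\<in>R l. prob (X f -` Y l f \<inter> space M))" if l: "l \<in> E" for l
  proof -
    \<comment> \<open>Regions vary in size; since \<open>p\<^sub>2 \<le> 1\<close>, the exponent of
      the largest possible region gives a common lower bound.\<close>
    have "p\<^sub>2 ^ (2 * \<Delta>) \<le> p\<^sub>2 ^ card (R l - {l})"
      using p2(1,2) R(4)[OF l] card_Diff1_le[of "R l" l] by (intro power_decreasing) auto
    also have "\<dots> = (\<Prod>f\<in>R l - {l}. p\<^sub>2)" by simp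
    also have "\<dots> \<le> (\<Prod>f\<in>R l - {l}. prob (X f -` Y l f \<inter> space M))"
    proof (intro prod_mono conjI p2(1))
      fix f assume f: "f \<in> R l - {l}"
      then have "f \<in> E" using R(2) by blast
      then show "p\<^sub>2 \<le> prob (X f -` Y l f \<inter> space M)" using \<mu> f by (simp add: Y_def)
    qed
    finally have "p\<^sub>1 * p\<^sub>2 ^ (2 * \<Delta>) \<le>
        prob (X l -` Y l l \<inter> space M) * (\<Prod>f\<in>R l - {l}. prob (X f -` Y l f \<inter> space M))"
      using Y1[OF l] p1(1) p2(1) by (intro mult_mono) (auto simp: Y_def)
    also have "\<dots> = (\<Prod>f\<in>R l. prob (X f -` Y l f \<inter> space M))"
      using R(1) R(3)[OF l] by (rule prod.remove[symmetric])
    finally show ?thesis .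
  qed
  have q1: "p\<^sub>1 * p\<^sub>2 ^ (2 * \<Delta>) \<le> 1" using p1(1,2) p2(1,2) by (intro mult_le_one power_le_one) auto
  have bad: "prob (bad b) \<le> (1 - p\<^sub>1 * p\<^sub>2 ^ (2 * \<Delta>)) ^ K" "bad b \<in> events" if b: "b < m" for b
  proof -
    have finB: "finite (B b)" using B(1)[OF b] fin0 finite_subset by blast
    have BE: "l \<in> E" if "l \<in> B b" for l using that B(1)[OF b] \<Lambda>0(1) by blast
    have disj: "disjoint_family_on R (B b)"
      using B(1)[OF b] disjoint unfolding disjoint_family_on_def by blast
    have Yset: "Y l f \<in> sets (matrix_space (d\<^sup>2))" if "l \<in> B b" "f \<in> R l" for l f
      using that Y1[of f] R(2)[of l] by (auto simp: Y_def sets_near_scalar_entries)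
    have Rne: "finite (R l) \<and> R l \<noteq> {}" if "l \<in> B b" for l using R(1,3) BE[OF that] by blast
    note * = prob_no_region_le[of "matrix_space (d\<^sup>2)" X E "B b" R Y "p\<^sub>1 * p\<^sub>2 ^ (2 * \<Delta>)",
        OF ind finB R(2) disj Rne Yset q[OF BE] q1]
    show "prob (bad b) \<le> (1 - p\<^sub>1 * p\<^sub>2 ^ (2 * \<Delta>)) ^ K" "bad b \<in> events"
      using * B(1)[OF b] by (simp_all add: bad_def)
  qed
  define Bad where "Bad = (\<Union>b<m. bad b)"
  have "Bad \<in> events" unfolding Bad_def using bad(2) by auto
  moreover have "prob Bad \<le> real m * (1 - p\<^sub>1 * p\<^sub>2 ^ (2 * \<Delta>)) ^ K"
  proof -
    have "prob Bad \<le> (\<Sum>b<m. prob (bad b))"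
      unfolding Bad_def using bad(2) by (intro finite_measure_subadditive_finite) auto
    also have "\<dots> \<le> (\<Sum>b<m. (1 - p\<^sub>1 * p\<^sub>2 ^ (2 * \<Delta>)) ^ K)" using bad(1) by (intro sum_mono) auto
    finally show ?thesis by simp
  qed
  moreover have "dense_spectrum (4 * \<epsilon>) (hamiltonian d n E (\<lambda>e. h e \<omega>))" if \<omega>: "\<omega> \<in> space M - Bad" for \<omega>
    unfolding dense_spectrum_def
  proof
    fix s :: real assume s: "s \<in> {0..1}"
    have sp: "\<omega> \<in> space M" using \<omega> by simp
    have "\<exists>l\<in>B b. \<forall>f\<in>R l. X f \<omega> \<in> Y l f" if "b < m" for b
      using \<omega> that by (auto simp: Bad_def bad_def)
    \<comment> \<open>One successful region per block; disjointness of the blocks makes the chosen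
      bonds distinct, so exactly m are obtained.\<close>
    then obtain L where L: "\<And>b. b < m \<Longrightarrow> L b \<in> B b" "\<And>b f. b < m \<Longrightarrow> f \<in> R (L b) \<Longrightarrow> X f \<omega> \<in> Y (L b) f"
      by metis
    define \<Lambda> where "\<Lambda> = L ` {..<m}"
    have inj: "inj_on L {..<m}"
    proof (rule inj_onI)
      fix b c assume "b \<in> {..<m}" "c \<in> {..<m}" "L b = L c"
      then show "b = c" using L(1)[of b] L(1)[of c] B(2)[of b c] by auto
    qed
    then have card: "card \<Lambda> = m" by (simp add: \<Lambda>_def card_image)
    have \<Lambda>\<Lambda>0: "\<Lambda> \<subseteq> \<Lambda>\<^sub>0" unfolding \<Lambda>_def using L(1) B(1) by blast
    have \<Lambda>E: "\<Lambda> \<subseteq> E" using \<Lambda>\<Lambda>0 \<Lambda>0(1) by blast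
    have good: "X f \<omega> \<in> Y l f" if "l \<in> \<Lambda>" "f \<in> R l" for l f using that L(2) unfolding \<Lambda>_def by blast
    define F where "F = {f \<in> E. \<exists>l\<in>\<Lambda>. f \<noteq> l \<and> touches l f}"
    have "card F \<le> m * (2 * \<Delta>)"
    proof -
      have "F \<subseteq> (\<Union>l\<in>\<Lambda>. R l)" by (auto simp: F_def R_def)
      then have "card F \<le> card (\<Union>l\<in>\<Lambda>. R l)" using R(1) by (intro card_mono) (auto simp: \<Lambda>_def)
      also have "\<dots> \<le> (\<Sum>l\<in>\<Lambda>. card (R l))" by (rule card_UN_le) (simp add: \<Lambda>_def)
      also have "\<dots> \<le> (\<Sum>l\<in>\<Lambda>. 2 * \<Delta>)" by (intro sum_mono R(4)) (use \<Lambda>E in blast)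
      finally show ?thesis by (simp add: card)
    qed
    then have "real (card F) \<le> real m * (2 * real \<Delta>)" by (metis of_nat_le_iff of_nat_mult of_nat_numeral)
    then have "real (card F) * \<eta> \<le> real m * (2 * real \<Delta>) * \<eta>" using \<open>\<eta> > 0\<close> by (intro mult_right_mono) auto
    then have \<kappa>: "real (card F) * \<eta> \<le> \<epsilon>" using m(2) by linarith
    \<comment> \<open>Spreads are at most 2 \<epsilon> and the perturbation is \<kappa> =
      \<epsilon>, which gives the tolerance 4 \<epsilon>.\<close>
    have "\<exists>x\<in>set (eigs (hamiltonian d n E (\<lambda>e. h e \<omega>))).
        \<bar>x - ground_energy (hamiltonian d n E (\<lambda>e. h e \<omega>)) - s\<bar> \<le> 2 * \<epsilon> + 2 * \<epsilon>"
    proof (rule hamiltonian_spectrum_dense[OF d g fin \<Lambda>E _ _ _ _ _ F_def _ _ \<kappa>, where \<delta> = \<delta>])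
      show "\<not> touches l l'" if "l \<in> \<Lambda>" "l' \<in> \<Lambda>" "l \<noteq> l'" for l l'
      proof
        assume "touches l l'"
        then have "l' \<in> R l \<inter> R l'" using that \<Lambda>E by (auto simp: R_def touches_refl)
        then show False using disjoint[of l l'] that \<Lambda>\<Lambda>0 by blast
      qed
      show "\<delta> \<le> spread (h l \<omega>) \<and> spread (h l \<omega>) \<le> 2 * \<epsilon>" if l: "l \<in> \<Lambda>" for l
      proof -
        have lE: "l \<in> E" using l \<Lambda>E by blast
        have "X l \<omega> \<in> Y\<^sub>1 l" using good[OF l R(3)[OF lE]] by (simp add: Y_def)
        then show ?thesis using Y1[OF lE] sp by blast
      qed
      show "\<exists>\<mu>. \<forall>x\<in>set (eigs (h f \<omega>)). \<bar>x - \<mu>\<bar> \<le> \<eta>" if f: "f \<in> F" for f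
      proof -
        obtain l where l: "l \<in> \<Lambda>" "f \<noteq> l" "f \<in> R l" "f \<in> E" using f by (auto simp: F_def R_def)
        have "X f \<omega> \<in> near_scalar_entries (d\<^sup>2) (\<mu> f) \<eta>" using good[OF l(1,3)] l(2) by (simp add: Y_def)
        then show ?thesis
          using near_scalar_entries_iff[OF herm[OF l(4) sp] \<open>\<eta> > 0\<close>] unfolding X_def by blast
      qed
    qed (use herm sp s m(1) card \<open>\<epsilon> > 0\<close> \<open>\<eta> > 0\<close> in auto)
    then show "\<exists>x\<in>set (eigs (hamiltonian d n E (\<lambda>e. h e \<omega>))).
        \<bar>x - ground_energy (hamiltonian d n E (\<lambda>e. h e \<omega>)) - s\<bar> \<le> 4 * \<epsilon>" by simp
  qed
  ultimately show ?thesis unfolding K_def by blast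
qed

section \<open>Summable failure probabilities and the almost sure statement\<close>

text \<open>Rounding in N div c costs at most one factor, so the terms are dominated by a geometric
  sequence whose ratio is a c-th root.\<close>

lemma summable_power_div:
  fixes r :: real
  assumes "0 \<le> r" "r < 1" "c > 0"
  shows "summable (\<lambda>N. r ^ (N div c))"
proof -
  \<comment> \<open>The value r = 0 is possible, while the bound divides by the base.\<close>
  define r' where "r' = max r (1 / 2)"
  have r': "0 < r'" "r' < 1" "r \<le> r'" using assms by (auto simp: r'_def)
  define t where "t = root c r'"
  have t: "0 \<le> t" "t < 1" "t ^ c = r'" using r' assms(3) by (auto simp: t_def)
  have bound: "r ^ (N div c) \<le> t ^ N / r'" for N
  proof -
    have "N \<le> c * (N div c) + c" using mult_div_mod_eq[of c N] mod_less_divisor[OF assms(3), of N] by linarith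
    then have "t ^ (c * (N div c) + c) \<le> t ^ N" using t by (intro power_decreasing) auto
    then have "r' ^ (N div c) * r' \<le> t ^ N" by (simp add: power_add power_mult t(3))
    moreover have "r ^ (N div c) \<le> r' ^ (N div c)" using assms r' by (intro power_mono) auto
    ultimately show ?thesis using r' by (simp add: field_simps) (smt (verit) mult_left_mono)
  qed
  have "summable (\<lambda>N. t ^ N / r')" using t by (intro summable_divide summable_geometric) auto
  then show ?thesis
  proof (rule summable_comparison_test')
    show "norm (r ^ (N div c)) \<le> t ^ N / r'" for N using bound[of N] assms(1) by simp
  qed
qed

theorem theorem1:
  fixes M :: "'w measure"
    and d :: nat
    and S :: "nat set"
    and n :: "nat \<Rightarrow> nat"
    and E :: "nat \<Rightarrow> (nat \<times> nat) set"
    and H :: "nat \<Rightarrow> nat \<times> nat \<Rightarrow> 'w \<Rightarrow> complex mat"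
  assumes "prob_space M"
    and "d \<ge> 2"
    and "infinite S"
    and graph: "\<And>N. N \<in> S \<Longrightarrow> simple_graph (n N) (E N) \<and> card (E N) = N"
    and bounded_degree: "\<exists>\<Delta>. \<forall>N\<in>S. \<forall>v<n N. degree_at (E N) v \<le> \<Delta>"
    and hermitian: "\<And>N e \<omega>. N \<in> S \<Longrightarrow> e \<in> E N \<Longrightarrow> \<omega> \<in> space M \<Longrightarrow> hermitian_mat (d\<^sup>2) (H N e \<omega>)"
    and bounded_norm: "\<exists>J. \<forall>N\<in>S. \<forall>e\<in>E N. AE \<omega> in M. op_norm (H N e \<omega>) \<le> J"
    and independent: "\<And>N. N \<in> S \<Longrightarrow>
      prob_space.indep_vars M (\<lambda>_. matrix_space (d\<^sup>2)) (\<lambda>e \<omega>. entries (d\<^sup>2) (H N e \<omega>)) (E N)"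
    and continuous: "\<And>N e. N \<in> S \<Longrightarrow> e \<in> E N \<Longrightarrow> continuous_eig_distribution M (d\<^sup>2) (H N e)"
    and near_scalar: "\<And>N e \<epsilon>. N \<in> S \<Longrightarrow> e \<in> E N \<Longrightarrow> \<epsilon> > 0 \<Longrightarrow>
      \<exists>\<mu>. measure M (near_scalar M (H N e) \<mu> \<epsilon>) > 0"
    and uniform: "uniform_laws M (d\<^sup>2) (Sigma S E) (\<lambda>(N, e). H N e)"
  shows "AE \<omega> in M.
      gapless S (\<lambda>N. hamiltonian d (n N) (E N) (\<lambda>e. H N e \<omega>)) \<and>
      continuous_dos S (\<lambda>N. hamiltonian d (n N) (E N) (\<lambda>e. H N e \<omega>))"
proof -
  interpret prob_space M by fact
  let ?HN = "\<lambda>\<omega> N. hamiltonian d (n N) (E N) (\<lambda>e. H N e \<omega>)"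
  obtain \<Delta>' where \<Delta>': "\<And>N v. N \<in> S \<Longrightarrow> v < n N \<Longrightarrow> degree_at (E N) v \<le> \<Delta>'" using bounded_degree by blast
  \<comment> \<open>Positivity keeps the divisors in \<open>\<eta>\<close> and \<open>c\<close>
    nonzero.\<close>
  define \<Delta> where "\<Delta> = Suc \<Delta>'"
  have \<Delta>: "degree_at (E N) v \<le> \<Delta>" if "N \<in> S" "v < n N" for N v
    using \<Delta>'[OF that] by (simp add: \<Delta>_def)
  have fin: "finite (E N)" if "N \<in> S" for N
  proof (rule finite_subset)
    show "E N \<subseteq> {..<n N} \<times> {..<n N}" using graph[OF that] by (auto simp: simple_graph_def)
  qed simp
  have meas: "(\<lambda>\<omega>. entries (d\<^sup>2) (H N e \<omega>)) \<in> measurable M (matrix_space (d\<^sup>2))" if "N \<in> S" "e \<in> E N" for N e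
    using independent[OF that(1)] that(2) by (auto simp: indep_vars_def)
  have d2: "d\<^sup>2 \<ge> 2" using \<open>d \<ge> 2\<close> power_mono[of 2 d 2] by simp
  have "AE \<omega> in M. \<exists>N\<^sub>0. \<forall>N\<in>S. N \<ge> N\<^sub>0 \<longrightarrow> dense_spectrum (1 / real (Suc k)) (?HN \<omega> N)" for k
  proof -
    define \<epsilon> where "\<epsilon> = 1 / (4 * real (Suc k))"
    have \<epsilon>: "\<epsilon> > 0" "4 * \<epsilon> = 1 / real (Suc k)" by (simp_all add: \<epsilon>_def field_simps)
    obtain p\<^sub>1 \<delta> where p1: "p\<^sub>1 > 0" "p\<^sub>1 \<le> 1" "\<delta> > 0" "\<And>N e. N \<in> S \<Longrightarrow> e \<in> E N \<Longrightarrow> \<exists>Y\<in>sets (matrix_space (d\<^sup>2)).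
        p\<^sub>1 \<le> prob ((\<lambda>\<omega>. entries (d\<^sup>2) (H N e \<omega>)) -` Y \<inter> space M) \<and>
        (\<forall>\<omega>\<in>space M. entries (d\<^sup>2) (H N e \<omega>) \<in> Y \<longrightarrow> \<delta> \<le> spread (H N e \<omega>) \<and> spread (H N e \<omega>) \<le> 2 * \<epsilon>)"
      using uniform_spread[OF uniform d2 \<epsilon>(1)] hermitian continuous meas by fastforce
    \<comment> \<open>Enough bonds of spread at least \<delta> for their sum to cover the window
      [0, 1].\<close>
    define m where "m = nat \<lceil>1 / \<delta>\<rceil>"
    have "1 / \<delta> \<le> real m" by (simp add: m_def real_nat_ceiling_ge)
    then have m: "1 \<le> real m * \<delta>" using p1(3) by (simp add: field_simps)
    then have m0: "m > 0" by (cases m) auto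
    define \<eta> where "\<eta> = \<epsilon> / (real m * (2 * real \<Delta>))"
    have pos: "real m * (2 * real \<Delta>) > 0" using m0 by (simp add: \<Delta>_def)
    have \<eta>: "\<eta> > 0" "real m * (2 * real \<Delta>) * \<eta> \<le> \<epsilon>" using pos \<epsilon>(1) by (simp_all add: \<eta>_def)
    obtain p\<^sub>2 where p2: "p\<^sub>2 > 0" "p\<^sub>2 \<le> 1" "\<And>N e. N \<in> S \<Longrightarrow> e \<in> E N \<Longrightarrow>
        \<exists>\<mu>. p\<^sub>2 \<le> prob ((\<lambda>\<omega>. entries (d\<^sup>2) (H N e \<omega>)) -` near_scalar_entries (d\<^sup>2) \<mu> \<eta> \<inter> space M)"
      using uniform_near_scalar[OF uniform _ \<eta>(1)] hermitian by fastforce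
    define r where "r = 1 - p\<^sub>1 * p\<^sub>2 ^ (2 * \<Delta>)"
    have "0 < p\<^sub>1 * p\<^sub>2 ^ (2 * \<Delta>)" "p\<^sub>1 * p\<^sub>2 ^ (2 * \<Delta>) \<le> 1"
      using p1 p2 by (auto intro!: mult_le_one power_le_one)
    then have r: "0 \<le> r" "r < 1" by (auto simp: r_def)
    define c where "c = (2 * \<Delta>)\<^sup>2 * m"
    have c: "c > 0" using m0 by (simp add: c_def \<Delta>_def)
    have "\<exists>Bad\<in>events. prob Bad \<le> real m * r ^ (N div c) \<and>
        (\<forall>\<omega>\<in>space M - Bad. dense_spectrum (1 / real (Suc k)) (?HN \<omega> N))" if N: "N \<in> S" for N
      using spectrum_not_dense_event[where h = "H N" and n = "n N" and E = "E N" and \<Delta> = \<Delta> and m = m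
          and \<delta> = \<delta> and \<epsilon> = \<epsilon> and \<eta> = \<eta> and p\<^sub>1 = p\<^sub>1 and p\<^sub>2 = p\<^sub>2,
          OF \<open>d \<ge> 2\<close> _ fin[OF N] \<Delta>[OF N] hermitian[OF N] independent[OF N] _ p1(2) p1(4)[OF N]
            _ p2(2) p2(3)[OF N] \<epsilon>(1) \<eta>(1) m \<eta>(2)] graph[OF N] p1(1) p2(1)
      unfolding \<epsilon>(2) r_def[symmetric] c_def[symmetric] by simp
    then obtain Bad where Bad: "\<And>N. N \<in> S \<Longrightarrow> Bad N \<in> events \<and> prob (Bad N) \<le> real m * r ^ (N div c) \<and>
        (\<forall>\<omega>\<in>space M - Bad N. dense_spectrum (1 / real (Suc k)) (?HN \<omega> N))" by metis
    \<comment> \<open>Sizes outside S get the empty event, so that the events are indexed by all N;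
      the bounds are summable in N because the number of bonds equals N.\<close>
    define A where "A N = (if N \<in> S then Bad N else {})" for N
    have "AE \<omega> in M. eventually (\<lambda>N. \<omega> \<in> space M - A N) sequentially"
    proof (rule borel_cantelli_AE1)
      show "A N \<in> events" for N using Bad by (simp add: A_def)
      show "emeasure M (A N) < \<infinity>" for N by (simp add: emeasure_eq_measure)
      have "summable (\<lambda>N. real m * r ^ (N div c))"
        by (intro summable_mult summable_power_div r c)
      moreover have "norm (prob (A N)) \<le> real m * r ^ (N div c)" for N
        using Bad r(1) by (simp add: A_def)
      ultimately show "summable (\<lambda>N. prob (A N))" by (rule summable_comparison_test'[where N = 0])
    qed
    then show ?thesis
    proof eventually_elim
      case (elim \<omega>)
      then obtain N\<^sub>0 where "\<And>N. N \<ge> N\<^sub>0 \<Longrightarrow> \<omega> \<in> space M - A N" unfolding eventually_sequentially by blast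
      then have "\<forall>N\<in>S. N \<ge> N\<^sub>0 \<longrightarrow> dense_spectrum (1 / real (Suc k)) (?HN \<omega> N)"
        using Bad by (metis A_def)
      then show ?case by blast
    qed
  qed
  \<comment> \<open>Countably many tolerances suffice, so the exceptional null sets can be
    united.\<close>
  then have "AE \<omega> in M. \<forall>k. \<exists>N\<^sub>0. \<forall>N\<in>S. N \<ge> N\<^sub>0 \<longrightarrow> dense_spectrum (1 / real (Suc k)) (?HN \<omega> N)"
    by (simp add: AE_all_countable)
  then show ?thesis
  proof eventually_elim
    case (elim \<omega>)
    then have dense: "\<exists>N\<^sub>0. \<forall>N\<in>S. N \<ge> N\<^sub>0 \<longrightarrow> dense_spectrum (1 / real (Suc k)) (?HN \<omega> N)" for k
      by (rule spec)
    show ?case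
      by (intro conjI eventually_dense_imp_gapless[OF \<open>infinite S\<close> dense]
          eventually_dense_imp_continuous_dos[OF dense])
  qed
qed

end
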